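(* Let $\lambda\in\mathbf R$ with $f(\lambda)>0$ and $\lambda\neq\lambda_0$ (notation of the context), write $Q=Q(\lambda,1)$, $f=f(\lambda)$, and for $\theta\in\mathbf R$ let $C_\theta\subset H_\lambda$ be the real touching conic $$2(Q^2-f)y_1^2+\sqrt f\,e^{i\theta}y_2^2+2Qy_2y_3+\sqrt f\,e^{-i\theta}y_3^2=0.$$ Then: (i) $\Phi^{-1}(C_\theta)$ has just two irreducible components, both of which are smooth rational curves mapped biholomorphically onto $C_\theta$ by $\Phi$; (ii) each irreducible component of $\Phi^{-1}(C_\theta)$ has trivial normal bundle in $S_\lambda=\Phi^{-1}(H_\lambda)$; (iii) the two irreducible components of $\Phi^{-1}(C_\theta)$ belong to mutually different pencils on $S_\lambda$; (iv) each irreducible component of $\Phi^{-1}(C_\theta)$ is real.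
   Context: Fix real numbers $a,b>0$ and a real quadratic form $Q(y_0,y_1)$; put $f(\lambda)=\lambda(\lambda+1)(a\lambda-b)$. Assume: there is $\lambda_0\in\mathbf R$ such that $Q(\lambda,1)^2-f(\lambda)\ge0$ for all $\lambda\in\mathbf R$ with equality iff $\lambda=\lambda_0$, and $\lambda_0$ is a root of multiplicity two; and $Q(\lambda,1)>\sqrt{f(\lambda)}$ whenever $\lambda\in\mathbf R$, $f(\lambda)\ge0$, $\lambda\ne\lambda_0$. $B\subset\mathbf{CP}^3$ is the quartic surface $(y_2y_3+Q(y_0,y_1))^2-y_0y_1(y_0+y_1)(ay_0-by_1)=0$; the real structure on $\mathbf{CP}^3$ is $\sigma(y_0:y_1:y_2:y_3)=(\overline y_0:\overline y_1:\overline y_3:\overline y_2)$. $B$ has exactly three singular points: $P_\infty=(0:0:0:1)$, $\overline P_\infty=(0:0:1:0)$, $P_0=(\lambda_0:1:0:0)$. $\Phi_0:Z_0\to\mathbf{CP}^3$ is the double covering branched along $B$, i.e. $Z_0=\{z^2+(y_2y_3+Q)^2-y_0y_1(y_0+y_1)(ay_0-by_1)=0\}$ in the total space of $O(2)$, with real structure $(y,z)\mapsto(\sigma(y),\overline z)$. $\mu:Z\to Z_0$ is a small resolution (with $Z$ smooth) of its three singular points to which the real structure lifts, and $\Phi=\Phi_0\circ\mu$. For $\lambda\in\mathbf R$, $H_\lambda=\{y_0=\lambda y_1\}$ with homogeneous coordinates $(y_1:y_2:y_3)$, and $S_\lambda=\Phi^{-1}(H_\lambda)$, which is a smooth rational surface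 when $f(\lambda)\ne0$. A curve in $Z$ is real if it is invariant under the real structure. A smooth rational curve with trivial normal bundle in $S_\lambda$ moves in a pencil (its complete linear system) on $S_\lambda$. *)

theory Defs
  imports "HOL-Analysis.Analysis" "HOL-Computational_Algebra.Polynomial"
begin

section \<open>Reduced complex spaces as spaces with functions\<close>

text \<open>
  A reduced complex space is a topological space \<open>X\<close> together with, for every open \<open>U\<close>, the
  set \<open>hol X U\<close> of holomorphic functions on \<open>U\<close>.  Functions are total in HOL; membership in
  \<open>hol X U\<close> only concerns the values on \<open>U\<close>.  Complex manifolds are the spaces with functions
  that are locally isomorphic to open subsets of complex affine space.
\<close>

record 'a cspace =
  opens :: "'a topology"
  hol :: "'a set \<Rightarrow> ('a \<Rightarrow> complex) set"

abbreviation points :: "'a cspace \<Rightarrow> 'a set" where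
  "points X \<equiv> topspace (opens X)"

definition function_sheaf :: "'a cspace \<Rightarrow> bool" where
  "function_sheaf X \<longleftrightarrow>
     (\<forall>U f. f \<in> hol X U \<longleftrightarrow>
        openin (opens X) U \<and>
        (\<forall>p\<in>U. \<exists>V. openin (opens X) V \<and> p \<in> V \<and> V \<subseteq> U \<and> f \<in> hol X V)) \<and>
     (\<forall>U f g. f \<in> hol X U \<longrightarrow> (\<forall>p\<in>U. f p = g p) \<longrightarrow> g \<in> hol X U)"

definition induced :: "'a cspace \<Rightarrow> 'a set \<Rightarrow> 'a cspace" where
  "induced X A =
     \<lparr>opens = subtopology (opens X) A,
      hol = (\<lambda>W. {f. openin (subtopology (opens X) A) W \<and>
                (\<forall>p\<in>W. \<exists>V F. openin (opens X) V \<and> p \<in> V \<and> F \<in> hol X V \<and>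
                     (\<forall>q\<in>V \<inter> W. f q = F q))})\<rparr>"

definition holomorphic_map :: "'a cspace \<Rightarrow> 'b cspace \<Rightarrow> ('a \<Rightarrow> 'b) \<Rightarrow> bool" where
  "holomorphic_map X Y \<phi> \<longleftrightarrow>
     continuous_map (opens X) (opens Y) \<phi> \<and>
     (\<forall>U. \<forall>f\<in>hol Y U. (\<lambda>x. f (\<phi> x)) \<in> hol X {x \<in> points X. \<phi> x \<in> U})"

definition antiholomorphic_map :: "'a cspace \<Rightarrow> 'b cspace \<Rightarrow> ('a \<Rightarrow> 'b) \<Rightarrow> bool" where
  "antiholomorphic_map X Y \<phi> \<longleftrightarrow>
     continuous_map (opens X) (opens Y) \<phi> \<and>
     (\<forall>U. \<forall>f\<in>hol Y U. (\<lambda>x. cnj (f (\<phi> x))) \<in> hol X {x \<in> points X. \<phi> x \<in> U})"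

definition biholomorphic_map :: "'a cspace \<Rightarrow> 'b cspace \<Rightarrow> ('a \<Rightarrow> 'b) \<Rightarrow> bool" where
  "biholomorphic_map X Y \<phi> \<longleftrightarrow>
     bij_betw \<phi> (points X) (points Y) \<and>
     holomorphic_map X Y \<phi> \<and> holomorphic_map Y X (inv_into (points X) \<phi>)"

text \<open>An involution is only constrained on the points of the space.\<close>

definition real_structure :: "'a cspace \<Rightarrow> ('a \<Rightarrow> 'a) \<Rightarrow> bool" where
  "real_structure X \<tau> \<longleftrightarrow> antiholomorphic_map X X \<tau> \<and> (\<forall>x\<in>points X. \<tau> (\<tau> x) = x)"

text \<open>Holomorphy in several variables: the Frechet derivative exists and is complex linear.\<close>

definition holo_on :: "(complex ^ 'n \<Rightarrow> complex) \<Rightarrow> (complex ^ 'n) set \<Rightarrow> bool" where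
  "holo_on f U \<longleftrightarrow>
     (\<forall>x\<in>U. \<exists>D. (f has_derivative D) (at x) \<and> (\<forall>c v. D (c *s v) = c * D v))"

text \<open>
  The quotient of an open \<open>M\<close> in affine space by the fibres of \<open>\<pi>\<close>: open sets and holomorphic
  functions are tested on the preimage.  It is used for \<open>\<pi> = id\<close> and for free proper actions of
  the group of nonzero complex numbers, where it yields the usual structure.
\<close>

definition quotient_space :: "(complex ^ 'n) set \<Rightarrow> (complex ^ 'n \<Rightarrow> 'b) \<Rightarrow> 'b cspace" where
  "quotient_space M \<pi> =
     \<lparr>opens = topology (\<lambda>U. U \<subseteq> \<pi> ` M \<and> open {x \<in> M. \<pi> x \<in> U}),
      hol = (\<lambda>U. {f. U \<subseteq> \<pi> ` M \<and> open {x \<in> M. \<pi> x \<in> U} \<and>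
                   holo_on (\<lambda>x. f (\<pi> x)) {x \<in> M. \<pi> x \<in> U}})\<rparr>"

lemma openin_quotient_space:
  "openin (opens (quotient_space M \<pi>)) U \<longleftrightarrow> U \<subseteq> \<pi> ` M \<and> open {x \<in> M. \<pi> x \<in> U}"
proof -
  have "istopology (\<lambda>U. U \<subseteq> \<pi> ` M \<and> open {x \<in> M. \<pi> x \<in> U})"
    unfolding istopology_def
  proof (intro conjI allI impI)
    fix S T
    assume "S \<subseteq> \<pi> ` M \<and> open {x \<in> M. \<pi> x \<in> S}" "T \<subseteq> \<pi> ` M \<and> open {x \<in> M. \<pi> x \<in> T}"
    moreover have "{x \<in> M. \<pi> x \<in> S \<inter> T} = {x \<in> M. \<pi> x \<in> S} \<inter> {x \<in> M. \<pi> x \<in> T}" by auto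
    ultimately show "S \<inter> T \<subseteq> \<pi> ` M" "open {x \<in> M. \<pi> x \<in> S \<inter> T}" by auto
  next
    fix \<K> assume K: "\<forall>K\<in>\<K>. K \<subseteq> \<pi> ` M \<and> open {x \<in> M. \<pi> x \<in> K}"
    then show "\<Union>\<K> \<subseteq> \<pi> ` M" by blast
    have "{x \<in> M. \<pi> x \<in> \<Union>\<K>} = (\<Union>K\<in>\<K>. {x \<in> M. \<pi> x \<in> K})" by auto
    with K show "open {x \<in> M. \<pi> x \<in> \<Union>\<K>}" by auto
  qed
  then show ?thesis
    by (simp add: quotient_space_def topology_inverse')
qed

definition affine_space :: "(complex ^ 'n) cspace" where
  "affine_space = quotient_space UNIV (\<lambda>x. x)"

definition complex_manifold :: "'n::finite itself \<Rightarrow> 'a cspace \<Rightarrow> bool" where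
  "complex_manifold _ X \<longleftrightarrow>
     function_sheaf X \<and> Hausdorff_space (opens X) \<and> second_countable (opens X) \<and>
     (\<forall>p\<in>points X. \<exists>U V \<phi>. openin (opens X) U \<and> p \<in> U \<and> open V \<and>
        biholomorphic_map (induced X U) (induced (affine_space :: (complex ^ 'n) cspace) V) \<phi>)"

section \<open>Analytic subsets and irreducible components\<close>

definition analytic_subset :: "'a cspace \<Rightarrow> 'a set \<Rightarrow> bool" where
  "analytic_subset X A \<longleftrightarrow>
     A \<subseteq> points X \<and>
     (\<forall>p\<in>points X. \<exists>U F. openin (opens X) U \<and> p \<in> U \<and> finite F \<and> F \<subseteq> hol X U \<and>
        A \<inter> U = {q \<in> U. \<forall>f\<in>F. f q = 0})"

definition irreducible_analytic :: "'a cspace \<Rightarrow> 'a set \<Rightarrow> bool" where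
  "irreducible_analytic X A \<longleftrightarrow>
     analytic_subset X A \<and> A \<noteq> {} \<and>
     (\<forall>A1 A2. analytic_subset X A1 \<and> analytic_subset X A2 \<and> A = A1 \<union> A2 \<longrightarrow> A = A1 \<or> A = A2)"

definition irreducible_components :: "'a cspace \<Rightarrow> 'a set \<Rightarrow> 'a set set" where
  "irreducible_components X A =
     {K. irreducible_analytic X K \<and> K \<subseteq> A \<and>
         (\<forall>K'. irreducible_analytic X K' \<and> K \<subseteq> K' \<and> K' \<subseteq> A \<longrightarrow> K' = K)}"

text \<open>
  An analytic set has dimension at most one at \<open>p\<close> iff some holomorphic function cuts it down to
  the isolated point \<open>p\<close> (Chevalley dimension).
\<close>

definition dim_le_one :: "'a cspace \<Rightarrow> 'a set \<Rightarrow> bool" where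
  "dim_le_one X A \<longleftrightarrow>
     (\<forall>p\<in>A. \<exists>U. openin (opens X) U \<and> p \<in> U \<and>
        (\<exists>h\<in>hol X U. {q \<in> U \<inter> A. h q = 0} = {p}))"

text \<open>
  A small resolution of a space whose singular set is \<open>\<Sigma>\<close>, in the threefold case: an
  isomorphism off \<open>\<Sigma>\<close>, with fibres of dimension at most one over \<open>\<Sigma>\<close>.
\<close>

definition small_resolution ::
  "'a cspace \<Rightarrow> 'b cspace \<Rightarrow> 'b set \<Rightarrow> ('a \<Rightarrow> 'b) \<Rightarrow> bool" where
  "small_resolution Z Z0 \<Sigma> \<mu> \<longleftrightarrow>
     complex_manifold TYPE(3) Z \<and>
     holomorphic_map Z Z0 \<mu> \<and> proper_map (opens Z) (opens Z0) \<mu> \<and>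
     biholomorphic_map (induced Z {x \<in> points Z. \<mu> x \<notin> \<Sigma>}) (induced Z0 (points Z0 - \<Sigma>)) \<mu> \<and>
     (\<forall>s\<in>\<Sigma>. dim_le_one Z {x \<in> points Z. \<mu> x = s})"

section \<open>Tangent spaces and normal bundles\<close>

text \<open>The functions that represent a germ at \<open>p\<close>.\<close>

definition germs :: "'a cspace \<Rightarrow> 'a \<Rightarrow> ('a \<Rightarrow> complex) set" where
  "germs X p = {f. \<exists>U. openin (opens X) U \<and> p \<in> U \<and> f \<in> hol X U}"

text \<open>
  Tangent vectors are derivations of germs; they are set to \<open>0\<close> on functions that are not
  holomorphic near \<open>p\<close>.
\<close>

definition tangent_space :: "'a cspace \<Rightarrow> 'a \<Rightarrow> (('a \<Rightarrow> complex) \<Rightarrow> complex) set" where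
  "tangent_space X p =
     {D. (\<forall>f. f \<notin> germs X p \<longrightarrow> D f = 0) \<and>
         (\<forall>f\<in>germs X p. \<forall>g\<in>germs X p.
            (\<exists>U. openin (opens X) U \<and> p \<in> U \<and> (\<forall>q\<in>U. f q = g q)) \<longrightarrow> D f = D g) \<and>
         (\<forall>f\<in>germs X p. \<forall>g\<in>germs X p. D (\<lambda>q. f q + g q) = D f + D g) \<and>
         (\<forall>c. \<forall>f\<in>germs X p. D (\<lambda>q. c * f q) = c * D f) \<and>
         (\<forall>f\<in>germs X p. \<forall>g\<in>germs X p. D (\<lambda>q. f q * g q) = D f * g p + f p * D g)}"

text \<open>The tangent space at \<open>p\<close> of the subspace \<open>K\<close>, as a subspace of that of \<open>X\<close>.\<close>

definition tangent_to :: "'a cspace \<Rightarrow> 'a set \<Rightarrow> 'a \<Rightarrow> (('a \<Rightarrow> complex) \<Rightarrow> complex) set" where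
  "tangent_to X K p =
     {D \<in> tangent_space X p. \<exists>D'\<in>tangent_space (induced X K) p. \<forall>f\<in>germs X p. D f = D' f}"

text \<open>
  The normal bundle of \<open>K\<close> in \<open>X\<close> has the fibre \<open>tangent_space X p / tangent_to X K p\<close> over
  \<open>p \<in> K\<close>.  A section is given by a representative \<open>s p \<in> tangent_space X p\<close> for each \<open>p\<close>; it is
  holomorphic iff it is locally the class of a holomorphic field \<open>w\<close> of tangent vectors of \<open>X\<close>
  along \<open>K\<close>.
\<close>

definition holomorphic_normal_section ::
  "'a cspace \<Rightarrow> 'a set \<Rightarrow> ('a \<Rightarrow> ('a \<Rightarrow> complex) \<Rightarrow> complex) \<Rightarrow> bool" where
  "holomorphic_normal_section X K s \<longleftrightarrow>
     (\<forall>p\<in>K. s p \<in> tangent_space X p) \<and>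
     (\<forall>p\<in>K. \<exists>U w. openin (opens X) U \<and> p \<in> U \<and>
        (\<forall>q\<in>U \<inter> K. w q \<in> tangent_space X q \<and> (\<lambda>f. w q f - s q f) \<in> tangent_to X K q) \<and>
        (\<forall>V. V \<subseteq> U \<longrightarrow> (\<forall>f\<in>hol X V. (\<lambda>q. w q f) \<in> hol (induced X K) (V \<inter> K))))"

text \<open>A holomorphic vector bundle is trivial iff it has a global holomorphic frame.\<close>

definition trivial_normal_bundle :: "'a cspace \<Rightarrow> 'a set \<Rightarrow> bool" where
  "trivial_normal_bundle X K \<longleftrightarrow>
     (\<exists>(r::nat) s. (\<forall>i<r. holomorphic_normal_section X K (s i)) \<and>
        (\<forall>p\<in>K. \<forall>D\<in>tangent_space X p.
           \<exists>!c :: nat \<Rightarrow> complex. (\<forall>i\<ge>r. c i = 0) \<and>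
             (\<lambda>f. D f - (\<Sum>i<r. c i * s i p f)) \<in> tangent_to X K p))"

section \<open>Effective divisors and complete linear systems\<close>

text \<open>
  An effective (Cartier) divisor is represented by its ideal sheaf \<open>J\<close>, which is locally generated
  by a function \<open>e\<close> that does not vanish identically on any nonempty open set.
\<close>

definition local_equation ::
  "'a cspace \<Rightarrow> ('a set \<Rightarrow> ('a \<Rightarrow> complex) set) \<Rightarrow> 'a set \<Rightarrow> ('a \<Rightarrow> complex) \<Rightarrow> bool" where
  "local_equation X J U e \<longleftrightarrow>
     openin (opens X) U \<and> e \<in> hol X U \<and>
     (\<forall>V. openin (opens X) V \<and> V \<subseteq> U \<and> V \<noteq> {} \<longrightarrow> (\<exists>q\<in>V. e q \<noteq> 0)) \<and>
     (\<forall>V. openin (opens X) V \<and> V \<subseteq> U \<longrightarrow>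
        J V = {g \<in> hol X V. \<exists>h\<in>hol X V. \<forall>q\<in>V. g q = e q * h q})"

definition effective_divisor :: "'a cspace \<Rightarrow> ('a set \<Rightarrow> ('a \<Rightarrow> complex) set) \<Rightarrow> bool" where
  "effective_divisor X J \<longleftrightarrow>
     (\<forall>U f. f \<in> J U \<longleftrightarrow>
        f \<in> hol X U \<and>
        (\<forall>p\<in>U. \<exists>V. openin (opens X) V \<and> p \<in> V \<and> V \<subseteq> U \<and> f \<in> J V)) \<and>
     (\<forall>p\<in>points X. \<exists>U e. p \<in> U \<and> local_equation X J U e)"

text \<open>
  \<open>J\<close> and \<open>J'\<close> are linearly equivalent iff there is a meromorphic function \<open>F\<close> with divisor
  \<open>J' - J\<close>, that is, \<open>F\<close> is locally a quotient \<open>e' / e\<close> of local equations.  The value of \<open>F\<close>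
  at the zeros of \<open>e\<close> is irrelevant.
\<close>

definition linearly_equivalent ::
  "'a cspace \<Rightarrow> ('a set \<Rightarrow> ('a \<Rightarrow> complex) set) \<Rightarrow> ('a set \<Rightarrow> ('a \<Rightarrow> complex) set) \<Rightarrow> bool" where
  "linearly_equivalent X J J' \<longleftrightarrow>
     (\<exists>F :: 'a \<Rightarrow> complex. \<forall>p\<in>points X. \<exists>U e e'. p \<in> U \<and>
        local_equation X J U e \<and> local_equation X J' U e' \<and>
        (\<forall>q\<in>U. e q \<noteq> 0 \<longrightarrow> F q = e' q / e q))"

definition complete_linear_system ::
  "'a cspace \<Rightarrow> ('a set \<Rightarrow> ('a \<Rightarrow> complex) set) \<Rightarrow> ('a set \<Rightarrow> ('a \<Rightarrow> complex) set) set" where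
  "complete_linear_system X J = {J'. effective_divisor X J' \<and> linearly_equivalent X J J'}"

text \<open>A reduced curve as a divisor: the ideal sheaf of the functions vanishing on it.\<close>

definition divisor_of :: "'a cspace \<Rightarrow> 'a set \<Rightarrow> 'a set \<Rightarrow> ('a \<Rightarrow> complex) set" where
  "divisor_of X K = (\<lambda>U. {g \<in> hol X U. \<forall>q\<in>U \<inter> K. g q = 0})"

text \<open>The pencil in which a smooth rational curve with trivial normal bundle moves.\<close>

definition pencil_of :: "'a cspace \<Rightarrow> 'a set \<Rightarrow> ('a set \<Rightarrow> ('a \<Rightarrow> complex) set) set" where
  "pencil_of X K = complete_linear_system X (divisor_of X K)"

section \<open>Projective space and the total space of O(2)\<close>

definition proj_pt :: "complex ^ 'n \<Rightarrow> (complex ^ 'n) set" where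
  "proj_pt y = {c *s y | c. c \<noteq> 0}"

definition projective_space :: "(complex ^ 'n) set cspace" where
  "projective_space = quotient_space {y. y \<noteq> 0} proj_pt"

definition smooth_rational_curve :: "'a cspace \<Rightarrow> 'a set \<Rightarrow> bool" where
  "smooth_rational_curve X K \<longleftrightarrow>
     analytic_subset X K \<and>
     (\<exists>\<phi>. biholomorphic_map (projective_space :: (complex ^ 2) set cspace) (induced X K) \<phi>)"

text \<open>
  The homogeneous coordinates \<open>y\<^sub>0, \<dots>, y\<^sub>3\<close> of \<open>y :: complex ^ 4\<close> are \<open>y $ 0, \<dots>, y $ 3\<close>.  The
  total space of O(2) over projective 3-space is the set of pairs \<open>(y, z)\<close>, \<open>y \<noteq> 0\<close>, modulo
  \<open>(y, z) \<sim> (c y, c\<^sup>2 z)\<close>.  The pair is stored in one vector \<open>w\<close>, with \<open>y\<^sub>i = w $ Some i\<close> and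
  \<open>z = w $ None\<close>.
\<close>

definition vec4 :: "complex \<Rightarrow> complex \<Rightarrow> complex \<Rightarrow> complex \<Rightarrow> complex ^ 4" where
  "vec4 a b c d = (\<chi> i. if i = 0 then a else if i = 1 then b else if i = 2 then c else d)"

definition pack :: "complex ^ 4 \<Rightarrow> complex \<Rightarrow> complex ^ (4 option)" where
  "pack y z = (\<chi> j. case j of None \<Rightarrow> z | Some i \<Rightarrow> y $ i)"

definition base :: "complex ^ (4 option) \<Rightarrow> complex ^ 4" where
  "base w = (\<chi> i. w $ Some i)"

definition O2_pt :: "complex ^ (4 option) \<Rightarrow> (complex ^ (4 option)) set" where
  "O2_pt w = {pack (c *s base w) (c\<^sup>2 * w $ None) | c. c \<noteq> 0}"

definition O2_space :: "(complex ^ (4 option)) set cspace" where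
  "O2_space = quotient_space {w. base w \<noteq> 0} O2_pt"

section \<open>The quartic, its double covering, and the touching conics\<close>

definition Qform :: "real \<Rightarrow> real \<Rightarrow> real \<Rightarrow> 'a::{real_algebra_1, comm_ring_1} \<Rightarrow> 'a \<Rightarrow> 'a" where
  "Qform q0 q1 q2 u v = of_real q0 * u\<^sup>2 + of_real q1 * u * v + of_real q2 * v\<^sup>2"

definition f_cubic :: "real \<Rightarrow> real \<Rightarrow> real \<Rightarrow> real" where
  "f_cubic a b l = l * (l + 1) * (a * l - b)"

text \<open>The polynomial \<open>Q(l, 1)\<^sup>2 - f(l)\<close> in \<open>l\<close>.\<close>

definition discr_poly :: "real \<Rightarrow> real \<Rightarrow> real \<Rightarrow> real \<Rightarrow> real \<Rightarrow> real poly" where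
  "discr_poly a b q0 q1 q2 = [:q2, q1, q0:]\<^sup>2 - [:0, 1:] * [:1, 1:] * [:- b, a:]"

definition quartic :: "real \<Rightarrow> real \<Rightarrow> real \<Rightarrow> real \<Rightarrow> real \<Rightarrow> complex ^ 4 \<Rightarrow> complex" where
  "quartic a b q0 q1 q2 y =
     (y $ 2 * y $ 3 + Qform q0 q1 q2 (y $ 0) (y $ 1))\<^sup>2
       - y $ 0 * y $ 1 * (y $ 0 + y $ 1) * (of_real a * y $ 0 - of_real b * y $ 1)"

definition Z0_space :: "real \<Rightarrow> real \<Rightarrow> real \<Rightarrow> real \<Rightarrow> real \<Rightarrow> (complex ^ (4 option)) set cspace" where
  "Z0_space a b q0 q1 q2 =
     induced O2_space {O2_pt w | w. base w \<noteq> 0 \<and> (w $ None)\<^sup>2 + quartic a b q0 q1 q2 (base w) = 0}"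

text \<open>The points over \<open>P\<^sub>\<infinity>\<close>, its conjugate, and \<open>P\<^sub>0\<close>, which lie on the branch locus \<open>z = 0\<close>.\<close>

definition Z0_sing :: "real \<Rightarrow> (complex ^ (4 option)) set set" where
  "Z0_sing l0 =
     {O2_pt (pack (vec4 0 0 0 1) 0), O2_pt (pack (vec4 0 0 1 0) 0),
      O2_pt (pack (vec4 (of_real l0) 1 0 0) 0)}"

text \<open>The covering map and the real structure act on classes by taking images.\<close>

definition \<Phi>0 :: "(complex ^ (4 option)) set \<Rightarrow> (complex ^ 4) set" where
  "\<Phi>0 P = base ` P"

definition \<sigma>0 :: "(complex ^ (4 option)) set \<Rightarrow> (complex ^ (4 option)) set" where
  "\<sigma>0 P =
     (\<lambda>w. pack (vec4 (cnj (w $ Some 0)) (cnj (w $ Some 1)) (cnj (w $ Some 3)) (cnj (w $ Some 2)))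
               (cnj (w $ None))) ` P"

definition H_plane :: "real \<Rightarrow> (complex ^ 4) set set" where
  "H_plane l = {proj_pt y | y. y \<noteq> 0 \<and> y $ 0 = of_real l * y $ 1}"

definition S_surface ::
  "'z cspace \<Rightarrow> ('z \<Rightarrow> (complex ^ (4 option)) set) \<Rightarrow> real \<Rightarrow> 'z cspace" where
  "S_surface Z \<mu> l = induced Z {x \<in> points Z. \<Phi>0 (\<mu> x) \<in> H_plane l}"

definition touching_conic :: "real \<Rightarrow> real \<Rightarrow> real \<Rightarrow> real \<Rightarrow> (complex ^ 4) set set" where
  "touching_conic l Q f \<theta> =
     {proj_pt y | y. y \<noteq> 0 \<and> y $ 0 = of_real l * y $ 1 \<and>
        2 * of_real (Q\<^sup>2 - f) * (y $ 1)\<^sup>2 + of_real (sqrt f) * cis \<theta> * (y $ 2)\<^sup>2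
          + 2 * of_real Q * y $ 2 * y $ 3 + of_real (sqrt f) * cis (- \<theta>) * (y $ 3)\<^sup>2 = 0}"

end

theory Submission
  imports Defs "HOL-Complex_Analysis.Conformal_Mappings" "HOL-Real_Asymp.Real_Asymp"
begin

text \<open>
Write \<open>y\<^sub>0 = \<lambda> y\<^sub>1\<close>, \<open>s\<^sup>2 = f\<close>, and let \<open>r\<^sub>1\<^sup>2, r\<^sub>2\<^sup>2\<close> be the roots \<open>Q \<plusminus> \<surd>(Q\<^sup>2 - f)\<close> of \<open>X\<^sup>2 - 2 Q X + f\<close>, so that
\<open>r\<^sub>1 r\<^sub>2 = s\<close>.  With \<open>u, v = y\<^sub>2 y\<^sub>3 + Q y\<^sub>1\<^sup>2 \<plusminus> i z\<close> the double cover of the plane is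
\<open>u v = s\<^sup>2 y\<^sub>1\<^sup>4\<close>, and for \<open>E = e\<^sup>i\<^sup>\<theta>\<close>, \<open>p = r\<^sub>1 E y\<^sub>2 + r\<^sub>2 y\<^sub>3\<close>, \<open>q = r\<^sub>2 E y\<^sub>2 + r\<^sub>1 y\<^sub>3\<close>,
\<open>c\<^sup>2 (r\<^sub>1\<^sup>2 - r\<^sub>2\<^sup>2)\<^sup>2 = -2\<close>, the touching conic is \<open>c\<^sup>2 p q = E y\<^sub>1\<^sup>2\<close>.  On it \<open>z\<close> is a square root of a square: one
sheet is \<open>E u = s c\<^sup>2 p\<^sup>2\<close>, \<open>E v = s c\<^sup>2 q\<^sup>2\<close>, and the other one arises by exchanging \<open>r\<^sub>1\<close> and \<open>r\<^sub>2\<close>.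
Putting \<open>p = E m\<^sup>2\<close>, \<open>q = n\<^sup>2\<close>, \<open>y\<^sub>1 = c m n\<close> parametrizes the sheet by \<open>(m : n)\<close>; letting \<open>E\<close> vary over the
nonzero complex numbers gives a biholomorphic map from a product with the projective line onto an open
part of \<open>S\<^sub>\<lambda>\<close> which avoids the exceptional curves.  Hence \<open>E\<close> is a local coordinate of which the curves are
fibres, and the normal bundle is trivialized by \<open>\<partial>/\<partial>E\<close>.  If the two sheets for \<open>E\<close> were linearly
equivalent, the corresponding meromorphic function would be holomorphic on the fibre over \<open>- E\<close> of the first
family, hence constant there; but that fibre meets the second sheet without being contained in it.
\<close>

section \<open>Holomorphic functions of several variables\<close>

text \<open>\<open>Z\<close> is abstract and is known only through \<open>\<mu>\<close>, so all
  computations use homogeneous vectors in the total space of O(2) and are carried to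
  \<open>Z\<close> by the inverse \<open>\<nu>\<close> of \<open>\<mu>\<close> off the singular
  points. The choice of \<open>c\<close> comes from multiplying the conic by 2 E: with d = r1^2 -
  r2^2 one has d^2 = 4 (Q^2 - f), and the equation becomes E d^2 y1^2 + 2 p q = 0. Exchanging r1 and
  r2 changes the sign of d and exchanges p and q, so the second sheet is a second instance of the
  same locale. The inverse of the parametrization has to avoid square roots: E is a quotient of
  quartic forms, and (m : n) is read off as (m^2 : m n) or (m n : n^2), whose entries are linear in
  the coordinates for given E. Several complex variables enter through division by E - E0, on which
  both the tangent spaces of the fibres and their ideal sheaves depend. In the last step -E is the
  useful parameter because the first sheet at -E has the same equation for z as the second sheet at
  E; their intersection is then y3^2 + E^2 y2^2 = 0, which Q > 0 keeps from holding
  identically.\<close>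

lemma holo_onI:
  assumes "\<And>x. x \<in> U \<Longrightarrow> \<exists>D. (f has_derivative D) (at x) \<and> (\<forall>c v. D (c *s v) = c * D v)"
  shows "holo_on f U"
  using assms by (auto simp: holo_on_def)

lemma holo_on_subset: "holo_on f U \<Longrightarrow> V \<subseteq> U \<Longrightarrow> holo_on f V"
  by (auto simp: holo_on_def)

lemma holo_on_local:
  assumes "\<And>x. x \<in> U \<Longrightarrow> \<exists>V. x \<in> V \<and> holo_on f V"
  shows "holo_on f U"
proof (rule holo_onI)
  fix x assume "x \<in> U"
  then obtain V where "x \<in> V" "holo_on f V" using assms by blast
  then show "\<exists>D. (f has_derivative D) (at x) \<and> (\<forall>c v. D (c *s v) = c * D v)"
    unfolding holo_on_def by blast
qed

lemma holo_on_cong_open: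
  assumes "holo_on f U" "open U" "\<And>x. x \<in> U \<Longrightarrow> f x = g x"
  shows "holo_on g U"
proof (rule holo_onI)
  fix x assume x: "x \<in> U"
  then obtain D where "(f has_derivative D) (at x)" "\<forall>c v. D (c *s v) = c * D v"
    using assms(1) unfolding holo_on_def by blast
  then show "\<exists>D. (g has_derivative D) (at x) \<and> (\<forall>c v. D (c *s v) = c * D v)"
    using has_derivative_transform_within_open [OF _ assms(2) x] assms(3) by blast
qed

lemma holo_on_imp_continuous_on:
  assumes "holo_on f U" shows "continuous_on U f"
  using assms unfolding holo_on_def
  by (meson continuous_at_imp_continuous_on has_derivative_continuous)

lemma holo_on_const [intro!]: "holo_on (\<lambda>x. c) U"
  by (rule holo_onI, rule exI [of _ "\<lambda>v. 0"]) auto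

lemma holo_on_component [intro!]: "holo_on (\<lambda>x. x $ i) U"
  by (rule holo_onI, rule exI [of _ "\<lambda>v. v $ i"])
     (auto intro!: bounded_linear_imp_has_derivative bounded_linear_vec_nth)

lemma holo_on_add [intro!]:
  assumes "holo_on f U" "holo_on g U" shows "holo_on (\<lambda>x. f x + g x) U"
proof (rule holo_onI)
  fix x assume "x \<in> U"
  then obtain D D' where "(f has_derivative D) (at x)" "\<forall>c v. D (c *s v) = c * D v"
    "(g has_derivative D') (at x)" "\<forall>c v. D' (c *s v) = c * D' v"
    using assms unfolding holo_on_def by metis
  then show "\<exists>D. ((\<lambda>x. f x + g x) has_derivative D) (at x) \<and> (\<forall>c v. D (c *s v) = c * D v)"
    by (intro exI [of _ "\<lambda>v. D v + D' v"]) (auto intro!: derivative_eq_intros simp: algebra_simps)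
qed

lemma holo_on_mult [intro!]:
  assumes "holo_on f U" "holo_on g U" shows "holo_on (\<lambda>x. f x * g x) U"
proof (rule holo_onI)
  fix x assume "x \<in> U"
  then obtain D D' where "(f has_derivative D) (at x)" "\<forall>c v. D (c *s v) = c * D v"
    "(g has_derivative D') (at x)" "\<forall>c v. D' (c *s v) = c * D' v"
    using assms unfolding holo_on_def by metis
  then show "\<exists>D. ((\<lambda>x. f x * g x) has_derivative D) (at x) \<and> (\<forall>c v. D (c *s v) = c * D v)"
    by (intro exI [of _ "\<lambda>v. f x * D' v + D v * g x"] conjI has_derivative_mult)
       (auto simp: algebra_simps)
qed

lemma holo_on_minus [intro!]:
  assumes "holo_on f U" shows "holo_on (\<lambda>x. - f x) U"
  using holo_on_mult [OF holo_on_const [of "-1"] assms] by simp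

lemma holo_on_diff [intro!]:
  assumes "holo_on f U" "holo_on g U" shows "holo_on (\<lambda>x. f x - g x) U"
  using holo_on_add [OF assms(1) holo_on_minus [OF assms(2)]] by simp

lemma holo_on_power [intro!]:
  assumes "holo_on f U" shows "holo_on (\<lambda>x. f x ^ n) U"
  using assms by (induction n) auto

lemma holo_on_inverse:
  assumes "holo_on f U" "\<And>x. x \<in> U \<Longrightarrow> f x \<noteq> 0" shows "holo_on (\<lambda>x. inverse (f x)) U"
proof (rule holo_onI)
  fix x assume x: "x \<in> U"
  then obtain D where D: "(f has_derivative D) (at x)" "\<forall>c v. D (c *s v) = c * D v"
    using assms unfolding holo_on_def by metis
  then show "\<exists>D. ((\<lambda>x. inverse (f x)) has_derivative D) (at x) \<and> (\<forall>c v. D (c *s v) = c * D v)"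
    by (intro exI [of _ "\<lambda>v. - (inverse (f x) * D v * inverse (f x))"])
       (use Deriv.has_derivative_inverse [OF assms(2)[OF x] D(1)] in auto)
qed

lemma holo_on_divide [intro!]:
  assumes "holo_on f U" "holo_on g U" "\<And>x. x \<in> U \<Longrightarrow> g x \<noteq> 0"
  shows "holo_on (\<lambda>x. f x / g x) U"
  unfolding divide_inverse by (intro holo_on_mult assms holo_on_inverse)

section \<open>Holomorphic maps and the chain rule\<close>

definition holo_map :: "(complex ^ 'n \<Rightarrow> complex ^ 'm) \<Rightarrow> (complex ^ 'n) set \<Rightarrow> bool" where
  "holo_map \<Lambda> U \<longleftrightarrow> (\<forall>j. holo_on (\<lambda>x. \<Lambda> x $ j) U)"

lemma holo_map_imp_continuous_on:
  assumes "holo_map \<Lambda> U" shows "continuous_on U \<Lambda>"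
proof -
  have "continuous_on U (\<lambda>x. \<chi> j. \<Lambda> x $ j)"
    using assms unfolding holo_map_def
    by (intro continuous_on_vec_lambda holo_on_imp_continuous_on) auto
  then show ?thesis by simp
qed

lemma bounded_linear_axis: "bounded_linear (axis j :: complex \<Rightarrow> complex ^ 'n)"
  by (intro linear_conv_bounded_linear [THEN iffD1] linearI) (auto simp: vec_eq_iff axis_def)

lemma sum_axis_components: "(\<Sum>j\<in>UNIV. axis j (a $ j)) = (a :: complex ^ 'n)"
  by (simp add: vec_eq_iff axis_def if_distrib cong: if_cong)

text \<open>Writing \<open>\<Lambda>\<close> as the sum of its components times axis vectors
  assembles the derivatives of the components into a derivative of the map; complex linearity then
  passes through the chain rule.\<close>

lemma holo_on_compose:
  assumes f: "holo_on f V" and \<Lambda>: "holo_map \<Lambda> U" and sub: "\<Lambda> ` U \<subseteq> V"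
  shows "holo_on (\<lambda>x. f (\<Lambda> x)) U"
proof (rule holo_onI)
  fix x assume x: "x \<in> U"
  have "\<forall>j. \<exists>D. ((\<lambda>x. \<Lambda> x $ j) has_derivative D) (at x) \<and> (\<forall>c v. D (c *s v) = c * D v)"
    using \<Lambda> x by (auto simp: holo_map_def holo_on_def)
  then obtain D where D: "\<And>j. ((\<lambda>x. \<Lambda> x $ j) has_derivative D j) (at x)"
      "\<And>j c v. D j (c *s v) = c * D j v"
    by metis
  obtain D' where D': "(f has_derivative D') (at (\<Lambda> x))" "\<And>c v. D' (c *s v) = c * D' v"
    using f sub x unfolding holo_on_def by blast
  have "((\<lambda>x. \<Sum>j\<in>UNIV. axis j (\<Lambda> x $ j)) has_derivative (\<lambda>v. \<Sum>j\<in>UNIV. axis j (D j v))) (at x)"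
    by (intro has_derivative_sum bounded_linear.has_derivative [OF bounded_linear_axis] D)
  then have "(\<Lambda> has_derivative (\<lambda>v. \<Sum>j\<in>UNIV. axis j (D j v))) (at x)"
    by (simp add: sum_axis_components)
  from diff_chain_at [OF this D'(1)]
  have "((\<lambda>x. f (\<Lambda> x)) has_derivative (\<lambda>v. D' (\<Sum>j\<in>UNIV. axis j (D j v)))) (at x)"
    by (simp add: o_def)
  moreover have "(\<Sum>j\<in>UNIV. axis j (D j (c *s v))) = c *s (\<Sum>j\<in>UNIV. axis j (D j v))" for c v
    by (simp add: vec_eq_iff axis_def D(2) if_distrib cong: if_cong)
  ultimately show "\<exists>D. ((\<lambda>x. f (\<Lambda> x)) has_derivative D) (at x) \<and> (\<forall>c v. D (c *s v) = c * D v)"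
    by (intro exI [of _ "\<lambda>v. D' (\<Sum>j\<in>UNIV. axis j (D j v))"]) (auto simp: D'(2))
qed

lemma holo_map_compose:
  assumes "holo_map g V" and "holo_map \<Lambda> U" and "\<Lambda> ` U \<subseteq> V"
  shows "holo_map (\<lambda>x. g (\<Lambda> x)) U"
  unfolding holo_map_def
proof
  fix j
  show "holo_on (\<lambda>x. g (\<Lambda> x) $ j) U"
    by (rule holo_on_compose [OF _ assms(2,3)]) (use assms(1) in \<open>simp add: holo_map_def\<close>)
qed

lemma open_holo_map_preimage:
  assumes "holo_map \<Lambda> U" "open U" "open V"
  shows "open {x \<in> U. \<Lambda> x \<in> V}"
  using continuous_open_preimage [OF holo_map_imp_continuous_on] assms
  by (simp add: vimage_def Collect_conj_eq)

lemma holo_map_affine_line: "holo_map (\<lambda>x. x + c *s w) U"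
  unfolding holo_map_def by auto

text \<open>Complex linearity of \<open>D\<close> is what makes the restriction to a complex line
  complex differentiable; this reduces the later estimates to one variable.\<close>

lemma has_derivative_line:
  fixes f :: "complex ^ 'n \<Rightarrow> complex"
  assumes "(f has_derivative D) (at (x + t *s v))" and "\<And>c v. D (c *s v) = c * D v"
  shows "((\<lambda>s. f (x + s *s v)) has_field_derivative D v) (at t)"
proof -
  have "bounded_linear (\<lambda>s::complex. s *s v)"
    by (intro linear_conv_bounded_linear [THEN iffD1] linearI) (auto simp: vec_eq_iff algebra_simps)
  then have "((\<lambda>s. x + s *s v) has_derivative (\<lambda>s. s *s v)) (at t)"
    by (auto intro!: derivative_eq_intros bounded_linear_imp_has_derivative)
  from diff_chain_at [OF this assms(1)]
  have "((\<lambda>s. f (x + s *s v)) has_derivative (\<lambda>s. D (s *s v))) (at t)"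
    by (simp add: o_def)
  moreover have "(\<lambda>s. D (s *s v)) = (*) (D v)"
    by (simp add: assms(2) fun_eq_iff)
  ultimately show ?thesis
    by (simp add: has_field_derivative_def)
qed

lemma holomorphic_on_line:
  assumes "holo_on f U" and "\<And>t. t \<in> T \<Longrightarrow> x + t *s v \<in> U"
  shows "(\<lambda>t. f (x + t *s v)) holomorphic_on T"
  unfolding holomorphic_on_def
proof
  fix t assume "t \<in> T"
  then obtain D where "(f has_derivative D) (at (x + t *s v))" "\<And>c v. D (c *s v) = c * D v"
    using assms unfolding holo_on_def by blast
  then show "(\<lambda>t. f (x + t *s v)) field_differentiable at t within T"
    using has_derivative_line field_differentiable_def field_differentiable_at_within by blast
qed

section \<open>Partial derivatives, Cauchy estimates and uniform limits\<close>

definition pd :: "'n \<Rightarrow> (complex ^ 'n \<Rightarrow> complex) \<Rightarrow> complex ^ 'n \<Rightarrow> complex" where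
  "pd i f x = deriv (\<lambda>t. f (x + t *s axis i 1)) 0"

lemma norm_smult_vec: "norm (t *s v) = norm (t::complex) * norm v"
proof -
  have "(\<Sum>j\<in>UNIV. (norm ((t *s v) $ j))\<^sup>2) = (norm t)\<^sup>2 * (\<Sum>j\<in>UNIV. (norm (v $ j))\<^sup>2)"
    by (simp add: norm_mult power_mult_distrib sum_distrib_left)
  then show ?thesis
    by (simp add: norm_vec_def L2_set_def real_sqrt_mult)
qed

lemma norm_smult_axis [simp]: "norm (t *s axis i (1::complex)) = norm t"
proof -
  have "(\<Sum>j\<in>UNIV. (norm (axis i (1::complex) $ j))\<^sup>2) = (\<Sum>j\<in>UNIV. if j = i then 1 else 0)"
    by (intro sum.cong) (auto simp: axis_def)
  then have "norm (axis i (1::complex)) = 1"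
    by (simp add: norm_vec_def L2_set_def)
  then show ?thesis
    by (simp add: norm_smult_vec)
qed

lemma pd_eq:
  assumes "(f has_derivative D) (at x)" and "\<And>c v. D (c *s v) = c * D v"
  shows "pd i f x = D (axis i 1)"
  unfolding pd_def
  by (rule DERIV_imp_deriv) (use has_derivative_line [of f D x 0 "axis i 1"] assms in simp)

lemma holo_on_pd_line:
  assumes "holo_on f U" "x + t *s axis i 1 \<in> U"
  shows "((\<lambda>s. f (x + s *s axis i 1)) has_field_derivative pd i f (x + t *s axis i 1)) (at t)"
proof -
  obtain D where D: "(f has_derivative D) (at (x + t *s axis i 1))" "\<And>c v. D (c *s v) = c * D v"
    using assms unfolding holo_on_def by blast
  from has_derivative_line [OF this] pd_eq [OF this] show ?thesis by simp
qed

lemma Cauchy_derivative_bound: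
  assumes "\<phi> holomorphic_on ball 0 R" and "\<And>t. norm t < R \<Longrightarrow> norm (\<phi> t) \<le> M"
    and "0 < r" and "norm t + r < R"
  shows "norm ((deriv ^^ k) \<phi> t) \<le> fact k * M / r ^ k"
proof (rule Cauchy_inequality)
  have sub: "cball t r \<subseteq> ball 0 R"
  proof
    fix s assume "s \<in> cball t r"
    then have "norm (s - t) \<le> r" by (simp add: dist_norm norm_minus_commute)
    then show "s \<in> ball 0 R" using assms(4) norm_triangle_ineq [of "s - t" t] by simp
  qed
  show "\<phi> holomorphic_on ball t r"
    using assms(1) by (rule holomorphic_on_subset) (use sub in auto)
  show "continuous_on (cball t r) \<phi>"
    using assms(1) sub by (meson continuous_on_subset holomorphic_on_imp_continuous_on)
  show "norm (\<phi> s) \<le> M" if "norm (t - s) = r" for s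
    using sub that assms(2) by (auto simp: dist_norm subset_iff)
qed (use assms in auto)

text \<open>Cauchy's inequality on discs of radius r/2 bounds the derivative of order n + 1. The
  factor \<open>Suc n\<close> remains because \<open>complex_Taylor\<close> divides by n! and not by
  (n + 1)!.\<close>

lemma Taylor_remainder_bound:
  assumes hol: "\<phi> holomorphic_on ball 0 (2 * r)" and M: "\<And>t. norm t < 2 * r \<Longrightarrow> norm (\<phi> t) \<le> M"
    and "0 < r" and t: "norm t < r"
  shows "norm (\<phi> t - (\<Sum>k\<le>n. (deriv ^^ k) \<phi> 0 * t ^ k / fact k))
           \<le> (real (Suc n) * 2 ^ Suc n * M / r ^ Suc n) * norm t ^ Suc n"
proof -
  have B: "norm ((deriv ^^ Suc n) \<phi> x) \<le> fact (Suc n) * M / (r/2) ^ Suc n" if "x \<in> ball 0 r" for x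
    by (rule Cauchy_derivative_bound [OF hol M]) (use that \<open>0 < r\<close> in auto)
  have "norm ((deriv ^^ 0) \<phi> t - (\<Sum>k\<le>n. (deriv ^^ k) \<phi> 0 * (t - 0) ^ k / fact k))
      \<le> (fact (Suc n) * M / (r/2) ^ Suc n) * norm (t - 0) ^ Suc n / fact n"
  proof (rule complex_Taylor [of "ball 0 r"])
    show "((deriv ^^ i) \<phi> has_field_derivative (deriv ^^ Suc i) \<phi> x) (at x within ball 0 r)"
      if "x \<in> ball 0 r" for i x
    proof -
      have "(deriv ^^ i) \<phi> holomorphic_on ball 0 (2 * r)"
        by (rule holomorphic_higher_deriv [OF hol]) auto
      then show ?thesis
        using that \<open>0 < r\<close> holomorphic_derivI [of _ "ball 0 (2 * r)" x] by (auto intro: has_field_derivative_at_within)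
    qed
  qed (use B assms in auto)
  also have "\<dots> = (real (Suc n) * 2 ^ Suc n * M / r ^ Suc n) * norm t ^ Suc n"
    using \<open>0 < r\<close> by (simp add: power_divide power_mult_distrib divide_simps)
  finally show ?thesis by simp
qed

text \<open>Weierstrass's theorem: along complex lines Cauchy's inequality bounds the difference of
  two derivatives by the difference of the functions, so the derivatives converge uniformly in
  operator norm on a smaller ball and \<open>has_derivative_sequence\<close> applies.\<close>

lemma holo_on_uniform_limit:
  assumes hol: "\<And>n. holo_on (f n) U" and U: "open U"
    and lim: "uniform_limit U f g sequentially"
  shows "holo_on g U"
proof (rule holo_onI)
  fix x0 assume "x0 \<in> U"
  then obtain R where R: "R > 0" "ball x0 R \<subseteq> U"
    using U openE by blast
  \<comment> \<open>A point at distance less than \<open>r\<close> may be moved by less than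
    \<open>2 * r\<close> without leaving the ball of radius \<open>R\<close>.\<close>
  define r where "r = R / 4"
  define S where "S = ball x0 r"
  have r: "r > 0" using R r_def by simp
  obtain D where D: "\<And>n x. x \<in> U \<Longrightarrow> (f n has_derivative D n x) (at x)"
      "\<And>n x c v. x \<in> U \<Longrightarrow> D n x (c *s v) = c * D n x v"
    using hol unfolding holo_on_def by metis
  have inU: "x + t *s h \<in> U" if "x \<in> S" "norm (t *s h) < 2 * r" for x t h
  proof -
    have "dist x0 (x + t *s h) \<le> dist x0 x + norm (t *s h)"
      by (metis add_diff_cancel_left' dist_norm dist_commute dist_triangle)
    with that R show ?thesis
      by (auto simp: S_def r_def subset_iff)
  qed
  have SU: "x \<in> U" if "x \<in> S" for x
    using inU [OF that, of 0 0] r by simp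
  have bound: "norm (D n x h - D m x h) \<le> B / r * norm h"
    if x: "x \<in> S" and B: "\<And>y. y \<in> U \<Longrightarrow> norm (f n y - f m y) \<le> B" for x n m h B
  proof (cases "h = 0")
    case True
    have "D k x 0 = 0" for k
      using D(2) [OF SU [OF x], of k 0 0] by simp
    then show ?thesis using True by simp
  next
    case False
    \<comment> \<open>The difference restricted to the line through \<open>x\<close> in direction
      \<open>h\<close>; in the parameter \<open>t\<close> the admissible distance
      \<open>2 * r\<close> becomes \<open>2 * r / norm h\<close>.\<close>
    define \<phi> where "\<phi> = (\<lambda>t. f n (x + t *s h) - f m (x + t *s h))"
    have in2: "x + t *s h \<in> U" if "norm t < 2 * r / norm h" for t
      using inU [OF x] that False by (simp add: norm_smult_vec field_simps)
    have "\<phi> holomorphic_on ball 0 (2 * r / norm h)"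
      unfolding \<phi>_def by (intro holomorphic_on_diff holomorphic_on_line [OF hol]) (auto intro: in2)
    moreover have "norm (\<phi> t) \<le> B" if "norm t < 2 * r / norm h" for t
      using B in2 [OF that] \<phi>_def by simp
    ultimately have "norm ((deriv ^^ 1) \<phi> 0) \<le> fact 1 * B / (r / norm h) ^ 1"
      by (rule Cauchy_derivative_bound) (use r False in \<open>auto simp: field_simps\<close>)
    moreover have "((\<lambda>s. f k (x + s *s h)) has_field_derivative D k x h) (at 0)" for k
      using has_derivative_line [of "f k" "D k x" x 0 h] D SU [OF x] by simp
    then have "(\<phi> has_field_derivative (D n x h - D m x h)) (at 0)"
      unfolding \<phi>_def by (intro DERIV_diff)
    then have "deriv \<phi> 0 = D n x h - D m x h"
      by (rule DERIV_imp_deriv)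
    ultimately show ?thesis by simp
  qed
  have unif: "\<exists>N. \<forall>n\<ge>N. \<forall>m\<ge>N. \<forall>x\<in>S. \<forall>h. norm (D n x h - D m x h) \<le> e * norm h" if e: "e > 0" for e
  proof -
    have "e * r / 2 > 0" using e r by simp
    with lim obtain N where N: "\<And>n x. n \<ge> N \<Longrightarrow> x \<in> U \<Longrightarrow> dist (f n x) (g x) < e * r / 2"
      unfolding uniform_limit_iff eventually_sequentially by meson
    have "norm (f n y - f m y) \<le> e * r" if "n \<ge> N" "m \<ge> N" "y \<in> U" for n m y
      using N [OF that(1,3)] N [OF that(2,3)] dist_triangle_half_l [of "f n y" "g y" "e * r" "f m y"]
      by (simp add: dist_norm norm_minus_commute less_imp_le)
    then show ?thesis
      using bound [of _ _ _ "e * r"] r by (intro exI [of _ N]) auto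
  qed
  have conv: "\<exists>L. (\<lambda>n. D n x h) \<longlonglongrightarrow> L" if x: "x \<in> S" for x h
  proof -
    have "Cauchy (\<lambda>n. D n x h)"
    proof (rule CauchyI)
      fix e :: real assume e: "e > 0"
      have "e / (norm h + 1) > 0" using e by (simp add: add_nonneg_pos)
      from unif [OF this] obtain N where N:
        "\<And>n m. n \<ge> N \<Longrightarrow> m \<ge> N \<Longrightarrow> norm (D n x h - D m x h) \<le> e / (norm h + 1) * norm h"
        using x by blast
      have "e / (norm h + 1) * norm h < e"
        using e by (simp add: divide_less_eq add_nonneg_pos)
      with N show "\<exists>N. \<forall>m\<ge>N. \<forall>n\<ge>N. norm (D m x h - D n x h) < e"
        by (intro exI [of _ N]) (auto intro: le_less_trans)
    qed
    then show ?thesis using Cauchy_convergent_iff convergent_def by blast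
  qed
  define D' where "D' = (\<lambda>x h. lim (\<lambda>n. D n x h))"
  have D': "(\<lambda>n. D n x h) \<longlonglongrightarrow> D' x h" if "x \<in> S" for x h
    using conv [OF that] unfolding D'_def by (metis limI)
  have "\<exists>g'. \<forall>x\<in>S. (\<lambda>n. f n x) \<longlonglongrightarrow> g' x \<and> (g' has_derivative D' x) (at x within S)"
  proof (rule has_derivative_sequence)
    show "convex S" by (simp add: S_def)
    show "(f n has_derivative D n x) (at x within S)" if "x \<in> S" for n x
      using D(1) SU that has_derivative_at_withinI by blast
    show "\<forall>\<^sub>F n in sequentially. \<forall>x\<in>S. \<forall>h. norm (D n x h - D' x h) \<le> e * norm h" if e: "e > 0" for e
    proof -
      obtain N where N: "\<And>n m x h. n \<ge> N \<Longrightarrow> m \<ge> N \<Longrightarrow> x \<in> S \<Longrightarrow> norm (D n x h - D m x h) \<le> e * norm h"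
        using unif [OF e] by blast
      have "norm (D n x h - D' x h) \<le> e * norm h" if "n \<ge> N" "x \<in> S" for n x h
      proof (rule tendsto_upperbound)
        show "(\<lambda>m. norm (D n x h - D m x h)) \<longlonglongrightarrow> norm (D n x h - D' x h)"
          by (intro tendsto_intros D' that)
        show "\<forall>\<^sub>F m in sequentially. norm (D n x h - D m x h) \<le> e * norm h"
          using N that eventually_sequentially by blast
      qed auto
      then show ?thesis using eventually_sequentially by blast
    qed
    show "x0 \<in> S" using r by (simp add: S_def)
    show "(\<lambda>n. f n x0) \<longlonglongrightarrow> g x0"
      using tendsto_uniform_limitI [OF lim \<open>x0 \<in> U\<close>] .
  qed
  then obtain g' where g': "\<And>x. x \<in> S \<Longrightarrow> (\<lambda>n. f n x) \<longlonglongrightarrow> g' x"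
      "\<And>x. x \<in> S \<Longrightarrow> (g' has_derivative D' x) (at x within S)" by blast
  have eq: "g' x = g x" if "x \<in> S" for x
    using g'(1) [OF that] tendsto_uniform_limitI [OF lim SU [OF that]] LIMSEQ_unique by blast
  have x0: "x0 \<in> S" "open S" using r by (auto simp: S_def)
  have "(g' has_derivative D' x0) (at x0)"
    using g'(2) x0 by (metis at_within_open)
  then have "(g has_derivative D' x0) (at x0)"
    using eq x0 by (metis has_derivative_transform_within_open)
  moreover have "D' x0 (c *s v) = c * D' x0 v" for c v
  proof (rule LIMSEQ_unique)
    show "(\<lambda>n. D n x0 (c *s v)) \<longlonglongrightarrow> D' x0 (c *s v)" by (rule D' [OF x0(1)])
    show "(\<lambda>n. D n x0 (c *s v)) \<longlonglongrightarrow> c * D' x0 v"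
      unfolding D(2) [OF \<open>x0 \<in> U\<close>] by (intro tendsto_intros D' x0(1))
  qed
  ultimately show "\<exists>D. (g has_derivative D) (at x0) \<and> (\<forall>c v. D (c *s v) = c * D v)"
    by blast
qed

lemma holo_on_bounded_nbhd:
  assumes f: "holo_on f U" and U: "open U" and x: "x \<in> U"
  obtains r M where "r > 0" "ball x (4 * r) \<subseteq> U" "\<And>y. y \<in> ball x (4 * r) \<Longrightarrow> norm (f y) \<le> M"
proof -
  obtain R where R: "R > 0" "ball x R \<subseteq> U" using U x openE by blast
  have "continuous_on U f" by (rule holo_on_imp_continuous_on [OF f])
  then obtain d where d: "d > 0" "\<And>y. y \<in> U \<Longrightarrow> dist y x < d \<Longrightarrow> dist (f y) (f x) < 1"
    using x unfolding continuous_on_iff by (metis zero_less_one)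
  define r where "r = min R d / 4"
  have r: "r > 0" "4 * r \<le> R" "4 * r \<le> d" using R d by (auto simp: r_def)
  show ?thesis
  proof (rule that [of r "norm (f x) + 1"])
    show "r > 0" "ball x (4 * r) \<subseteq> U" using r R by auto
    fix y assume y: "y \<in> ball x (4 * r)"
    then have "y \<in> ball x R" "dist y x < d" using r by (auto simp: dist_commute)
    then have "dist (f y) (f x) < 1" using d R by blast
    then show "norm (f y) \<le> norm (f x) + 1"
      using norm_triangle_ineq2 [of "f y" "f x"] by (simp add: dist_norm)
  qed
qed

lemma ball_line:
  fixes x y :: "complex ^ 'n"
  assumes "y \<in> ball x r" "norm t \<le> s"
  shows "y + t *s axis i 1 \<in> ball x (r + s)"
proof -
  have "dist x (y + t *s axis i 1) \<le> dist x y + norm (t *s axis i (1::complex))"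
    by (metis add_diff_cancel_left' dist_norm dist_commute dist_triangle)
  then show ?thesis using assms by simp
qed

text \<open>The difference quotients are holomorphic, and by the first-order Taylor remainder they
  converge uniformly, with an error proportional to the step.\<close>

lemma holo_on_pd:
  assumes f: "holo_on f U" and U: "open U"
  shows "holo_on (pd i f) U"
proof (rule holo_on_local)
  fix x assume "x \<in> U"
  then obtain r M where r: "r > 0" "ball x (4 * r) \<subseteq> U"
      and M: "\<And>y. y \<in> ball x (4 * r) \<Longrightarrow> norm (f y) \<le> M"
    using holo_on_bounded_nbhd [OF f U] by blast
  \<comment> \<open>The denominator \<open>n + 2\<close> keeps the step nonzero and smaller than
    \<open>r\<close>, so that shifted points stay in the ball where \<open>f\<close> is
    bounded.\<close>
  define g where "g = (\<lambda>n y. (f (y + of_real (r / real (n + 2)) *s axis i 1) - f y) / of_real (r / real (n + 2)))"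
  define C where "C = 2 * 2\<^sup>2 * M / r\<^sup>2"
  have nz: "complex_of_real (r / real (n + 2)) \<noteq> 0" for n
    unfolding of_real_eq_0_iff using r by simp
  have small: "norm (complex_of_real (r / real (n + 2))) < r" for n
    unfolding norm_of_real using r by (simp add: divide_less_eq)
  have in2: "y + t *s axis i 1 \<in> ball x (4 * r)" if "y \<in> ball x r" "norm t \<le> 2 * r" for y t
    using ball_line [OF that, of i] r by auto
  have "holo_on (g n) (ball x r)" for n
    unfolding g_def
  proof (intro holo_on_divide holo_on_diff holo_on_const)
    show "holo_on (\<lambda>y. f (y + of_real (r / real (n + 2)) *s axis i 1)) (ball x r)"
      by (rule holo_on_compose [OF f holo_map_affine_line]) (use in2 small [of n] r in fastforce)
    show "holo_on f (ball x r)"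
      by (rule holo_on_subset [OF f]) (use r in auto)
  qed (rule nz)
  moreover have "uniform_limit (ball x r) g (pd i f) sequentially"
  proof (rule uniform_limitI)
    fix e :: real assume e: "e > 0"
    have est: "dist (g n y) (pd i f y) \<le> C * (r / real (n + 2))" if y: "y \<in> ball x r" for n y
    proof -
      define t where "t = complex_of_real (r / real (n + 2))"
      define \<phi> where "\<phi> = (\<lambda>t. f (y + t *s axis i 1))"
      have t: "t \<noteq> 0" "norm t < r" "norm t = r / real (n + 2)"
        using r small [of n] nz [of n] unfolding t_def norm_of_real by (simp_all del: of_real_eq_0_iff of_real_divide of_real_of_nat_eq)
      have "\<phi> holomorphic_on ball 0 (2 * r)"
        unfolding \<phi>_def by (rule holomorphic_on_line [OF f]) (use in2 [OF y] r in auto)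
      moreover have "norm (\<phi> t) \<le> M" if "norm t < 2 * r" for t
        unfolding \<phi>_def using in2 [OF y] that by (auto intro!: M)
      ultimately have "norm (\<phi> t - (\<Sum>k\<le>1. (deriv ^^ k) \<phi> 0 * t ^ k / fact k))
          \<le> (real (Suc 1) * 2 ^ Suc 1 * M / r ^ Suc 1) * norm t ^ Suc 1"
        by (rule Taylor_remainder_bound) (use r t in auto)
      then have "norm (\<phi> t - (\<phi> 0 + deriv \<phi> 0 * t)) \<le> C * (norm t)\<^sup>2"
        by (simp add: C_def power2_eq_square)
      moreover have "deriv \<phi> 0 = pd i f y"
        by (simp add: \<phi>_def pd_def)
      moreover have "\<phi> t - (\<phi> 0 + deriv \<phi> 0 * t) = t * (g n y - pd i f y)"
      proof -
        have "g n y = (f (y + t *s axis i 1) - f y) / t"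
          by (simp only: g_def t_def)
        then show ?thesis
          using t(1) by (simp add: \<phi>_def pd_def field_simps)
      qed
      ultimately have "norm t * norm (g n y - pd i f y) \<le> norm t * (C * norm t)"
        by (simp add: norm_mult power2_eq_square mult_ac)
      then have "norm (g n y - pd i f y) \<le> C * norm t"
        using t(1) by simp
      then show ?thesis
        by (simp only: t(3) dist_norm)
    qed
    have "(\<lambda>n. C * (r / real (n + 2))) \<longlonglongrightarrow> 0"
      by real_asymp
    then have "\<forall>\<^sub>F n in sequentially. C * (r / real (n + 2)) < e"
      using e by (rule order_tendstoD)
    then show "\<forall>\<^sub>F n in sequentially. \<forall>y\<in>ball x r. dist (g n y) (pd i f y) < e"
    proof eventually_elim
      case (elim n)
      then show ?case using est [of _ n] by (meson le_less_trans)
    qed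
  qed
  ultimately have "holo_on (pd i f) (ball x r)"
    using holo_on_uniform_limit [of g "ball x r" "pd i f"] by simp
  then show "\<exists>V. x \<in> V \<and> holo_on (pd i f) V"
    using r by (intro exI [of _ "ball x r"]) auto
qed

text \<open>Serves to compare a divided function with a holomorphic one: an error of second order
  does not affect the derivative at the point.\<close>

lemma has_derivative_zero_if_quadratic:
  fixes f :: "'a::real_normed_vector \<Rightarrow> 'b::real_normed_vector"
  assumes "r > 0" and "\<And>y. dist y x < r \<Longrightarrow> norm (f y) \<le> C * (norm (y - x))\<^sup>2"
  shows "(f has_derivative (\<lambda>v. 0)) (at x)"
proof -
  have fx: "f x = 0" using assms(2)[of x] \<open>r > 0\<close> by simp
  have "((\<lambda>y. norm (f y) / norm (y - x)) \<longlongrightarrow> 0) (at x)"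
  proof (rule tendsto_sandwich [where f = "\<lambda>_. 0"])
    show "\<forall>\<^sub>F y in at x. norm (f y) / norm (y - x) \<le> C * norm (y - x)"
      unfolding eventually_at
    proof (intro exI conjI ballI impI)
      fix y assume "y \<noteq> x \<and> dist y x < r"
      then show "norm (f y) / norm (y - x) \<le> C * norm (y - x)"
        using assms(2)[of y] by (simp add: divide_le_eq power2_eq_square mult.assoc)
    qed (rule \<open>r > 0\<close>)
    have "((\<lambda>y. C * norm (y - x)) \<longlongrightarrow> C * norm (x - x)) (at x)"
      by (intro tendsto_intros)
    then show "((\<lambda>y. C * norm (y - x)) \<longlongrightarrow> 0) (at x)" by simp
  qed auto
  then show ?thesis
    by (simp add: has_derivative_iff_norm fx)
qed

text \<open>At a point of the hyperplane, the Taylor expansion of \<open>g\<close> to second order along the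
  \<open>i\<close>-th axis shows that the quotient agrees up to \<open>O(\<bar>x $ i - E0\<bar>\<^sup>2)\<close> with a holomorphic
  function.\<close>

lemma holo_on_divide_coordinate:
  fixes g :: "complex ^ 'n \<Rightarrow> complex"
  assumes g: "holo_on g U" and U: "open U" and zero: "\<And>x. x \<in> U \<Longrightarrow> x $ i = E0 \<Longrightarrow> g x = 0"
  shows "holo_on (\<lambda>x. if x $ i = E0 then pd i g x else g x / (x $ i - E0)) U" (is "holo_on ?h U")
proof (rule holo_onI)
  fix x assume x: "x \<in> U"
  show "\<exists>D. (?h has_derivative D) (at x) \<and> (\<forall>c v. D (c *s v) = c * D v)"
  proof (cases "x $ i = E0")
    case False
    define V where "V = {y \<in> U. y $ i \<in> - {E0}}"
    have "open V"
      unfolding V_def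
      using continuous_open_preimage [OF holo_on_imp_continuous_on [OF holo_on_component], of U "- {E0}" i] U
      by (simp add: vimage_def Int_def open_Compl)
    have "holo_on (\<lambda>y. g y / (y $ i - E0)) V"
      by (intro holo_on_divide holo_on_diff holo_on_component holo_on_const holo_on_subset [OF g])
         (auto simp: V_def)
    then have "holo_on ?h V"
      by (rule holo_on_cong_open [OF _ \<open>open V\<close>]) (auto simp: V_def)
    then show ?thesis
      using x False unfolding holo_on_def by (auto simp: V_def)
  next
    case True
    obtain r M where r: "r > 0" "ball x (4 * r) \<subseteq> U"
      and M: "\<And>y. y \<in> ball x (4 * r) \<Longrightarrow> norm (g y) \<le> M"
      using holo_on_bounded_nbhd [OF g U x] by blast
    \<comment> \<open>\<open>P\<close> projects along the axis to the hyperplane. \<open>h0\<close>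
      below is the second-order Taylor polynomial of \<open>g\<close> at \<open>P y\<close>, divided
      by \<open>y $ i - E0\<close>; the constant term is missing because \<open>g\<close> vanishes
      at \<open>P y\<close>.\<close>
    define P where "P = (\<lambda>y. y + (E0 - y $ i) *s axis i 1 :: complex ^ 'n)"
    define W where "W = ball x r"
    define h0 where "h0 = (\<lambda>y. pd i g (P y) + (y $ i - E0) / 2 * pd i (pd i g) (P y))"
    have small: "norm (y $ i - E0) \<le> norm (y - x)" for y
      using Finite_Cartesian_Product.norm_nth_le [of "y - x" i] True by simp
    have PW: "P y \<in> ball x (2 * r)" "norm (y $ i - E0) < r" if "y \<in> W" for y
    proof -
      have *: "norm (y $ i - E0) < r"
        using small [of y] that by (simp add: W_def dist_norm norm_minus_commute)
      then show "norm (y $ i - E0) < r" .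
      show "P y \<in> ball x (2 * r)"
        using ball_line [of y x r "E0 - y $ i" r i] that * by (simp add: P_def W_def norm_minus_commute)
    qed
    have P: "holo_map P W"
      unfolding P_def holo_map_def by (auto intro!: holo_on_add holo_on_mult holo_on_diff)
    have PU: "P ` W \<subseteq> U" using PW r by (force simp: subset_iff)
    have pd1: "holo_on (pd i g) U" by (rule holo_on_pd [OF g U])
    have pd2: "holo_on (pd i (pd i g)) U" by (rule holo_on_pd [OF pd1 U])
    have "holo_on h0 W"
      unfolding h0_def
      by (intro holo_on_add holo_on_mult holo_on_divide holo_on_diff holo_on_component holo_on_const
          holo_on_compose [OF pd1 P PU] holo_on_compose [OF pd2 P PU]) auto
    moreover have "x \<in> W" using r by (simp add: W_def)
    ultimately obtain D where D: "(h0 has_derivative D) (at x)" "\<And>c v. D (c *s v) = c * D v"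
      unfolding holo_on_def by blast
    have "((\<lambda>y. ?h y - h0 y) has_derivative (\<lambda>v. 0)) (at x)"
    proof (rule has_derivative_zero_if_quadratic [OF r(1)])
      fix y assume "dist y x < r"
      then have y: "y \<in> W" by (simp add: W_def dist_commute)
      define \<phi> where "\<phi> = (\<lambda>t. g (P y + t *s axis i 1))"
      define t where "t = y $ i - E0"
      \<comment> \<open>The constant of \<open>Taylor_remainder_bound\<close> for n = 2.\<close>
      define C where "C = 3 * 2 ^ 3 * M / r ^ 3"
      have C: "C \<ge> 0"
      proof -
        have "norm (g x) \<le> M" using M r by simp
        then have "0 \<le> M" using norm_ge_zero [of "g x"] by linarith
        then show ?thesis using r by (simp add: C_def)
      qed
      have Py: "P y $ i = E0" "P y + t *s axis i 1 = y"
        by (auto simp: P_def t_def vec_eq_iff axis_def)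
      have in4: "P y + s *s axis i 1 \<in> ball x (4 * r)" if "norm s \<le> 2 * r" for s
        using ball_line [OF PW(1)[OF y] that, of i] by simp
      have hol: "\<phi> holomorphic_on ball 0 (2 * r)"
        unfolding \<phi>_def by (rule holomorphic_on_line [OF g]) (use in4 r in auto)
      moreover have "norm (\<phi> s) \<le> M" if "norm s < 2 * r" for s
        unfolding \<phi>_def using in4 that by (auto intro!: M)
      ultimately have T: "norm (\<phi> t - (\<Sum>k\<le>2. (deriv ^^ k) \<phi> 0 * t ^ k / fact k))
          \<le> (real (Suc 2) * 2 ^ Suc 2 * M / r ^ Suc 2) * norm t ^ Suc 2"
        by (rule Taylor_remainder_bound) (use r PW(2)[OF y] t_def in auto)
      have d1: "deriv \<phi> s = pd i g (P y + s *s axis i 1)" if "norm s \<le> 2 * r" for s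
        unfolding \<phi>_def by (rule DERIV_imp_deriv, rule holo_on_pd_line [OF g])
           (use in4 [OF that] r in auto)
      have "((\<lambda>s. pd i g (P y + s *s axis i 1)) has_field_derivative pd i (pd i g) (P y)) (at 0)"
        using holo_on_pd_line [OF pd1, of "P y" 0 i] PU y by auto
      then have "(deriv \<phi> has_field_derivative pd i (pd i g) (P y)) (at 0)"
        by (rule has_field_derivative_transform_within_open [of _ _ _ "ball 0 r"]) (use r d1 in auto)
      then have d2: "deriv (deriv \<phi>) 0 = pd i (pd i g) (P y)"
        by (rule DERIV_imp_deriv)
      have \<phi>0: "\<phi> 0 = 0" unfolding \<phi>_def using zero PU y Py by auto
      have "h0 y = pd i g (P y) + t / 2 * pd i (pd i g) (P y)"
        by (simp only: h0_def t_def)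
      then have "(\<Sum>k\<le>2. (deriv ^^ k) \<phi> 0 * t ^ k / fact k) = t * h0 y"
        using d1 [of 0] r \<phi>0 d2
        by (simp add: numeral_2_eq_2 field_simps)
      then have T': "norm (g y - t * h0 y) \<le> C * norm t ^ 3"
        using T Py(2) by (simp add: \<phi>_def C_def)
      show "norm (?h y - h0 y) \<le> C * (norm (y - x))\<^sup>2"
      proof (cases "t = 0")
        case True
        then have "y $ i = E0" "P y = y" using Py by (auto simp: t_def)
        then have "?h y = h0 y" by (simp add: h0_def)
        then show ?thesis using C by simp
      next
        case False
        then have "g y - t * h0 y = t * (?h y - h0 y)"
          by (simp add: t_def field_simps)
        then have "norm t * norm (?h y - h0 y) \<le> norm t * (C * (norm t)\<^sup>2)"
          using T' by (simp add: norm_mult power3_eq_cube power2_eq_square mult_ac)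
        then have "norm (?h y - h0 y) \<le> C * (norm t)\<^sup>2"
          using False by simp
        also have "\<dots> \<le> C * (norm (y - x))\<^sup>2"
          using small [of y] C by (intro mult_left_mono power_mono) (auto simp: t_def)
        finally show ?thesis .
      qed
    qed
    from has_derivative_add [OF this D(1)] have "(?h has_derivative D) (at x)"
      by simp
    then show ?thesis using D(2) by blast
  qed
qed

section \<open>Charts of product type and normal bundles\<close>

lemma opens_induced [simp]: "opens (induced X A) = subtopology (opens X) A"
  by (simp add: induced_def)

lemma hol_induced_iff:
  "f \<in> hol (induced X A) W \<longleftrightarrow> openin (subtopology (opens X) A) W \<and>
     (\<forall>p\<in>W. \<exists>V F. openin (opens X) V \<and> p \<in> V \<and> F \<in> hol X V \<and> (\<forall>q\<in>V \<inter> W. f q = F q))"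
  by (simp add: induced_def)

lemma hol_induced_restrict:
  assumes "f \<in> hol (induced X A) W" "openin (opens (induced X A)) V" "V \<subseteq> W"
  shows "f \<in> hol (induced X A) V"
  unfolding hol_induced_iff
proof (intro conjI ballI)
  show "openin (subtopology (opens X) A) V" using assms(2) by simp
  fix p assume "p \<in> V"
  then have "p \<in> W" using assms(3) by blast
  then obtain V' F where "openin (opens X) V'" "p \<in> V'" "F \<in> hol X V'" "\<forall>q\<in>V' \<inter> W. f q = F q"
    using assms(1) unfolding hol_induced_iff by blast
  then show "\<exists>V' F. openin (opens X) V' \<and> p \<in> V' \<and> F \<in> hol X V' \<and> (\<forall>q\<in>V' \<inter> V. f q = F q)"
    using assms(3) by blast
qed

lemma hol_induced_openin: "f \<in> hol (induced X A) W \<Longrightarrow> openin (opens (induced X A)) W"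
  by (simp add: hol_induced_iff)

lemma hol_quotient_iff:
  "f \<in> hol (quotient_space M \<pi>) U \<longleftrightarrow>
     openin (opens (quotient_space M \<pi>)) U \<and> holo_on (\<lambda>x. f (\<pi> x)) {x \<in> M. \<pi> x \<in> U}"
  unfolding openin_quotient_space by (simp add: quotient_space_def)

lemma points_quotient [simp]: "open M \<Longrightarrow> points (quotient_space M \<pi>) = \<pi> ` M"
proof
  assume M: "open M"
  show "points (quotient_space M \<pi>) \<subseteq> \<pi> ` M"
    unfolding topspace_def openin_quotient_space by blast
  have "{x \<in> M. \<pi> x \<in> \<pi> ` M} = M" by blast
  then have "openin (opens (quotient_space M \<pi>)) (\<pi> ` M)"
    using M by (simp add: openin_quotient_space)
  then show "\<pi> ` M \<subseteq> points (quotient_space M \<pi>)"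
    by (rule openin_subset)
qed

section \<open>Rules for partial derivatives and for tangent vectors\<close>

lemma pd_add:
  assumes "holo_on f U" "holo_on g U" "x \<in> U"
  shows "pd i (\<lambda>x. f x + g x) x = pd i f x + pd i g x"
  unfolding pd_def [of i "\<lambda>x. f x + g x"]
  using DERIV_add [OF holo_on_pd_line [OF assms(1), of x 0 i] holo_on_pd_line [OF assms(2), of x 0 i]] assms(3)
  by (intro DERIV_imp_deriv) simp

lemma pd_mult:
  assumes "holo_on f U" "holo_on g U" "x \<in> U"
  shows "pd i (\<lambda>x. f x * g x) x = pd i f x * g x + f x * pd i g x"
  unfolding pd_def [of i "\<lambda>x. f x * g x"]
  using DERIV_mult [OF holo_on_pd_line [OF assms(1), of x 0 i] holo_on_pd_line [OF assms(2), of x 0 i]] assms(3)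
  by (intro DERIV_imp_deriv) (simp add: mult.commute)

lemma eventually_line_in_open:
  fixes U :: "(complex ^ 'n) set"
  assumes "open U" "x \<in> U"
  shows "\<forall>\<^sub>F t in nhds (0::complex). x + t *s axis i 1 \<in> U"
proof -
  obtain r where r: "r > 0" "ball x r \<subseteq> U" using assms openE by blast
  have "\<forall>\<^sub>F t in nhds (0::complex). norm t < r"
    using eventually_nhds_in_open [of "ball 0 r" "0::complex"] r by simp
  then show ?thesis
    by eventually_elim (use r in \<open>auto simp: dist_norm\<close>)
qed

lemma pd_cong:
  assumes "open U" "x \<in> U" "\<And>y. y \<in> U \<Longrightarrow> f y = g y"
  shows "pd i f x = pd i g x"
  unfolding pd_def
proof (rule deriv_cong_ev [OF _ refl])
  show "\<forall>\<^sub>F t in nhds 0. f (x + t *s axis i 1) = g (x + t *s axis i 1)"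
    using eventually_line_in_open [OF assms(1,2), of i] by eventually_elim (rule assms(3))
qed

lemma pd_component: "pd i (\<lambda>x. x $ i - c) x = 1"
  unfolding pd_def
  by (rule DERIV_imp_deriv) (auto simp: axis_def intro!: derivative_eq_intros)

lemma tangent_cong:
  assumes "D \<in> tangent_space X p" "f \<in> germs X p" "g \<in> germs X p"
    and "openin (opens X) U" "p \<in> U" "\<And>q. q \<in> U \<Longrightarrow> f q = g q"
  shows "D f = D g"
proof -
  have "\<forall>f\<in>germs X p. \<forall>g\<in>germs X p. (\<exists>U. openin (opens X) U \<and> p \<in> U \<and> (\<forall>q\<in>U. f q = g q)) \<longrightarrow> D f = D g"
    using assms(1) by (simp add: tangent_space_def)
  then show ?thesis using assms(2-) by blast
qed

lemma tangent_add:
  "D \<in> tangent_space X p \<Longrightarrow> f \<in> germs X p \<Longrightarrow> g \<in> germs X p \<Longrightarrow> D (\<lambda>q. f q + g q) = D f + D g"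
  by (simp add: tangent_space_def)

lemma tangent_cmult:
  "D \<in> tangent_space X p \<Longrightarrow> f \<in> germs X p \<Longrightarrow> D (\<lambda>q. c * f q) = c * D f"
  by (simp add: tangent_space_def)

lemma tangent_mult:
  "D \<in> tangent_space X p \<Longrightarrow> f \<in> germs X p \<Longrightarrow> g \<in> germs X p \<Longrightarrow>
    D (\<lambda>q. f q * g q) = D f * g p + f p * D g"
  by (simp add: tangent_space_def)

lemma tangent_no_germ: "D \<in> tangent_space X p \<Longrightarrow> f \<notin> germs X p \<Longrightarrow> D f = 0"
  by (simp add: tangent_space_def)

text \<open>A product-like chart: an open part of \<open>X\<close> is the quotient of \<open>M\<close> by the fibres of \<open>\<pi>\<close>,
  and the \<open>i\<close>-th coordinate of \<open>M\<close>, together with translation along it, descends to the quotient.\<close>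

locale fibred_chart =
  fixes X :: "'a cspace" and M :: "(complex ^ 'n) set" and \<pi> :: "complex ^ 'n \<Rightarrow> 'a" and i :: 'n
  assumes hol_openin: "f \<in> hol X U \<Longrightarrow> openin (opens X) U"
    and hol_restrict: "f \<in> hol X U \<Longrightarrow> openin (opens X) V \<Longrightarrow> V \<subseteq> U \<Longrightarrow> f \<in> hol X V"
    and open_M: "open M"
    and open_image: "openin (opens X) (\<pi> ` M)"
    and openin_iff: "V \<subseteq> \<pi> ` M \<Longrightarrow> openin (opens X) V \<longleftrightarrow> open {x \<in> M. \<pi> x \<in> V}"
    and hol_iff: "V \<subseteq> \<pi> ` M \<Longrightarrow>
      f \<in> hol X V \<longleftrightarrow> open {x \<in> M. \<pi> x \<in> V} \<and> holo_on (\<lambda>x. f (\<pi> x)) {x \<in> M. \<pi> x \<in> V}"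
    and coordinate: "x \<in> M \<Longrightarrow> y \<in> M \<Longrightarrow> \<pi> x = \<pi> y \<Longrightarrow> x $ i = y $ i"
    and shift: "x \<in> M \<Longrightarrow> y \<in> M \<Longrightarrow> \<pi> x = \<pi> y \<Longrightarrow>
      x + t *s axis i 1 \<in> M \<Longrightarrow> y + t *s axis i 1 \<in> M \<Longrightarrow> \<pi> (x + t *s axis i 1) = \<pi> (y + t *s axis i 1)"
begin

definition rep :: "'a \<Rightarrow> complex ^ 'n" where
  "rep q = (SOME x. x \<in> M \<and> \<pi> x = q)"

definition coord :: "'a \<Rightarrow> complex" where
  "coord q = rep q $ i"

definition dcoord :: "('a \<Rightarrow> complex) \<Rightarrow> 'a \<Rightarrow> complex" where
  "dcoord f q = pd i (\<lambda>x. f (\<pi> x)) (rep q)"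

definition fibre :: "complex \<Rightarrow> 'a set" where
  "fibre c = \<pi> ` {x \<in> M. x $ i = c}"

lemma rep:
  assumes "x \<in> M" shows "rep (\<pi> x) \<in> M" "\<pi> (rep (\<pi> x)) = \<pi> x"
  using someI [of "\<lambda>y. y \<in> M \<and> \<pi> y = \<pi> x" x] assms unfolding rep_def by auto

lemma coord_eq: "x \<in> M \<Longrightarrow> coord (\<pi> x) = x $ i"
  unfolding coord_def using coordinate rep by blast

lemma fibre_iff: "q \<in> fibre c \<longleftrightarrow> q \<in> \<pi> ` M \<and> coord q = c"
  unfolding fibre_def by (auto simp: coord_eq)

lemma fibre_iff': "x \<in> M \<Longrightarrow> \<pi> x \<in> fibre c \<longleftrightarrow> x $ i = c"
  by (simp add: fibre_iff coord_eq)

text \<open>By \<open>shift\<close>, moving two representatives of a point along the axis gives the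
  same points of \<open>X\<close>, so the two one-variable germs agree and the choice made in
  \<open>rep\<close> is immaterial.\<close>

lemma dcoord_eq:
  assumes x: "x \<in> M" shows "dcoord f (\<pi> x) = pd i (\<lambda>x. f (\<pi> x)) x"
  unfolding dcoord_def pd_def
proof (rule deriv_cong_ev [OF _ refl])
  show "\<forall>\<^sub>F t in nhds 0. f (\<pi> (rep (\<pi> x) + t *s axis i 1)) = f (\<pi> (x + t *s axis i 1))"
    using eventually_line_in_open [OF open_M x, of i] eventually_line_in_open [OF open_M rep(1)[OF x], of i]
    by eventually_elim (use shift [OF rep(1)[OF x] x rep(2)[OF x]] in simp)
qed

lemma hol_dcoord:
  assumes "f \<in> hol X V" "V \<subseteq> \<pi> ` M" shows "dcoord f \<in> hol X V"
proof -
  have V: "open {x \<in> M. \<pi> x \<in> V}" "holo_on (\<lambda>x. f (\<pi> x)) {x \<in> M. \<pi> x \<in> V}"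
    using assms hol_iff by auto
  have "holo_on (\<lambda>x. dcoord f (\<pi> x)) {x \<in> M. \<pi> x \<in> V}"
    by (rule holo_on_cong_open [OF holo_on_pd [OF V(2,1)] V(1)]) (simp add: dcoord_eq)
  then show ?thesis using V assms(2) hol_iff by blast
qed

lemma hol_coord: "openin (opens X) V \<Longrightarrow> V \<subseteq> \<pi> ` M \<Longrightarrow> (\<lambda>q. coord q - c) \<in> hol X V"
  by (simp add: hol_iff openin_iff)
     (rule holo_on_cong_open [where f = "\<lambda>x. x $ i - c"], auto simp: coord_eq)

lemma hol_const: "openin (opens X) V \<Longrightarrow> V \<subseteq> \<pi> ` M \<Longrightarrow> (\<lambda>q. c) \<in> hol X V"
  by (auto simp: hol_iff openin_iff)

lemma hol_add: "f \<in> hol X V \<Longrightarrow> g \<in> hol X V \<Longrightarrow> V \<subseteq> \<pi> ` M \<Longrightarrow> (\<lambda>q. f q + g q) \<in> hol X V"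
  by (auto simp: hol_iff)

lemma hol_mult: "f \<in> hol X V \<Longrightarrow> g \<in> hol X V \<Longrightarrow> V \<subseteq> \<pi> ` M \<Longrightarrow> (\<lambda>q. f q * g q) \<in> hol X V"
  by (auto simp: hol_iff)

text \<open>Division by the coordinate is done on \<open>M\<close>; the quotient descends because
  its value on the fibre is \<open>dcoord g\<close>, which does not depend on the
  representative.\<close>

lemma hol_division:
  assumes g: "g \<in> hol X V" and V: "V \<subseteq> \<pi> ` M" and zero: "\<And>q. q \<in> V \<Longrightarrow> q \<in> fibre c \<Longrightarrow> g q = 0"
  obtains h where "h \<in> hol X V" "\<And>q. q \<in> V \<Longrightarrow> g q = (coord q - c) * h q"
proof -
  define h where "h = (\<lambda>q. if coord q = c then dcoord g q else g q / (coord q - c))"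
  have o: "open {x \<in> M. \<pi> x \<in> V}" and gV: "holo_on (\<lambda>x. g (\<pi> x)) {x \<in> M. \<pi> x \<in> V}"
    using g V hol_iff by auto
  have "holo_on (\<lambda>x. if x $ i = c then pd i (\<lambda>x. g (\<pi> x)) x else g (\<pi> x) / (x $ i - c)) {x \<in> M. \<pi> x \<in> V}"
    by (rule holo_on_divide_coordinate [OF gV o]) (auto simp: fibre_iff' intro!: zero)
  then have "holo_on (\<lambda>x. h (\<pi> x)) {x \<in> M. \<pi> x \<in> V}"
    by (rule holo_on_cong_open [OF _ o]) (auto simp: h_def coord_eq dcoord_eq)
  then have "h \<in> hol X V" using o V hol_iff by blast
  moreover have "g q = (coord q - c) * h q" if "q \<in> V" for q
    using zero [OF that] that V by (auto simp: h_def fibre_iff)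
  ultimately show ?thesis by (rule that)
qed

text \<open>That the coordinate generates the ideal is \<open>hol_division\<close>. It is not
  identically zero on a nonempty open set because every point can be moved a little along the
  \<open>i\<close>-th axis.\<close>

lemma local_equation_fibre:
  "local_equation X (divisor_of X (fibre c)) (\<pi> ` M) (\<lambda>q. coord q - c)"
  unfolding local_equation_def
proof (intro conjI allI impI open_image hol_coord subset_refl)
  fix V assume "openin (opens X) V \<and> V \<subseteq> \<pi> ` M \<and> V \<noteq> {}"
  then have o: "open {x \<in> M. \<pi> x \<in> V}" and V: "V \<subseteq> \<pi> ` M" and "V \<noteq> {}"
    using openin_iff by auto
  then obtain x where x: "x \<in> {x \<in> M. \<pi> x \<in> V}" by blast
  have "\<forall>\<^sub>F t in at (0::complex). x + t *s axis i 1 \<in> {x \<in> M. \<pi> x \<in> V}"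
    using eventually_line_in_open [OF o x, of i] by (auto simp: eventually_at_filter elim: eventually_mono)
  moreover have "\<forall>\<^sub>F t in at (0::complex). t \<noteq> c - x $ i"
  proof (cases "c = x $ i")
    case True
    then show ?thesis by (auto simp: eventually_at_filter)
  next
    case False
    have "\<forall>\<^sub>F t in nhds (0::complex). t \<in> - {c - x $ i}"
      by (rule eventually_nhds_in_open) (use False in auto)
    then show ?thesis by (auto simp: eventually_at_filter elim: eventually_mono)
  qed
  ultimately have "\<forall>\<^sub>F t in at (0::complex). x + t *s axis i 1 \<in> {x \<in> M. \<pi> x \<in> V} \<and> t \<noteq> c - x $ i"
    by (rule eventually_conj)
  from eventually_happens' [OF _ this]
  obtain t where t: "x + t *s axis i 1 \<in> {x \<in> M. \<pi> x \<in> V}" "t \<noteq> c - x $ i"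
    by auto
  have "coord (\<pi> (x + t *s axis i 1)) = x $ i + t"
    using t coord_eq by (simp add: axis_def)
  then show "\<exists>q\<in>V. coord q - c \<noteq> 0"
    using t by (intro bexI [of _ "\<pi> (x + t *s axis i 1)"]) (auto simp: algebra_simps)
next
  fix V assume V: "openin (opens X) V \<and> V \<subseteq> \<pi> ` M"
  show "divisor_of X (fibre c) V = {g \<in> hol X V. \<exists>h\<in>hol X V. \<forall>q\<in>V. g q = (coord q - c) * h q}"
  proof (intro subset_antisym subsetI)
    fix g assume "g \<in> divisor_of X (fibre c) V"
    then have g: "g \<in> hol X V" and zero: "\<And>q. q \<in> V \<Longrightarrow> q \<in> fibre c \<Longrightarrow> g q = 0"
      by (auto simp: divisor_of_def)
    obtain h where "h \<in> hol X V" "\<And>q. q \<in> V \<Longrightarrow> g q = (coord q - c) * h q"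
      using hol_division [OF g conjunct2 [OF V] zero] by metis
    then show "g \<in> {g \<in> hol X V. \<exists>h\<in>hol X V. \<forall>q\<in>V. g q = (coord q - c) * h q}"
      using g by blast
  qed (auto simp: divisor_of_def fibre_iff)
qed

lemma germsD:
  assumes "f \<in> germs X p" "p \<in> \<pi> ` M" "openin (opens X) W" "p \<in> W"
  obtains V where "openin (opens X) V" "p \<in> V" "V \<subseteq> \<pi> ` M" "V \<subseteq> W" "f \<in> hol X V"
proof -
  obtain U where U: "openin (opens X) U" "p \<in> U" "f \<in> hol X U"
    using assms(1) by (auto simp: germs_def)
  have o: "openin (opens X) (U \<inter> \<pi> ` M \<inter> W)"
    using U assms open_image by blast
  show ?thesis
    by (rule that [OF o]) (use U assms hol_restrict [OF U(3) o] in auto)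
qed

lemma germs2D:
  assumes "f \<in> germs X p" "g \<in> germs X p" "p \<in> \<pi> ` M" "openin (opens X) W" "p \<in> W"
  obtains V where "openin (opens X) V" "p \<in> V" "V \<subseteq> \<pi> ` M" "V \<subseteq> W" "f \<in> hol X V" "g \<in> hol X V"
proof -
  obtain V where V: "openin (opens X) V" "p \<in> V" "V \<subseteq> \<pi> ` M" "V \<subseteq> W" "f \<in> hol X V"
    by (rule germsD [OF assms(1,3,4,5)])
  obtain V' where V': "openin (opens X) V'" "p \<in> V'" "V' \<subseteq> \<pi> ` M" "V' \<subseteq> V" "g \<in> hol X V'"
    by (rule germsD [OF assms(2,3) V(1,2)])
  show ?thesis
    by (rule that [OF V'(1-3) _ hol_restrict [OF V(5) V'(1,4)] V'(5)]) (use V V' in blast)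
qed

lemma germsI: "f \<in> hol X V \<Longrightarrow> p \<in> V \<Longrightarrow> f \<in> germs X p"
  unfolding germs_def using hol_openin by blast

lemma germs_const: "p \<in> \<pi> ` M \<Longrightarrow> (\<lambda>q. c) \<in> germs X p"
  using hol_const [OF open_image] germsI by blast

lemma germs_coord: "p \<in> \<pi> ` M \<Longrightarrow> (\<lambda>q. coord q - c) \<in> germs X p"
  using hol_coord [OF open_image] germsI by blast

lemma germs_add: "p \<in> \<pi> ` M \<Longrightarrow> f \<in> germs X p \<Longrightarrow> g \<in> germs X p \<Longrightarrow> (\<lambda>q. f q + g q) \<in> germs X p"
  by (rule germs2D [of f p g "\<pi> ` M"]) (auto intro: open_image germsI [OF hol_add])

lemma germs_mult: "p \<in> \<pi> ` M \<Longrightarrow> f \<in> germs X p \<Longrightarrow> g \<in> germs X p \<Longrightarrow> (\<lambda>q. f q * g q) \<in> germs X p"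
  by (rule germs2D [of f p g "\<pi> ` M"]) (auto intro: open_image germsI [OF hol_mult])

lemma germs_cmult: "p \<in> \<pi> ` M \<Longrightarrow> f \<in> germs X p \<Longrightarrow> (\<lambda>q. c * f q) \<in> germs X p"
  by (intro germs_mult germs_const)

text \<open>The tangent vector along the \<open>i\<close>-th axis; the value 0 off the germs is the
  convention built into \<open>tangent_space\<close>.\<close>

definition vertical :: "'a \<Rightarrow> ('a \<Rightarrow> complex) \<Rightarrow> complex" where
  "vertical p f = (if f \<in> germs X p then dcoord f p else 0)"

lemma vertical_tangent:
  assumes p: "p \<in> \<pi> ` M" shows "vertical p \<in> tangent_space X p"
proof -
  obtain x where x: "x \<in> M" "p = \<pi> x" using p by blast
  have holo: "\<exists>U. open U \<and> x \<in> U \<and> holo_on (\<lambda>x. f (\<pi> x)) U \<and> holo_on (\<lambda>x. g (\<pi> x)) U"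
    if fg: "f \<in> germs X p" "g \<in> germs X p" for f g
  proof -
    obtain V where "openin (opens X) V" "p \<in> V" "V \<subseteq> \<pi> ` M" "V \<subseteq> \<pi> ` M" "f \<in> hol X V" "g \<in> hol X V"
      by (rule germs2D [OF fg p open_image p])
    then show ?thesis
      using x hol_iff by (intro exI [of _ "{x \<in> M. \<pi> x \<in> V}"]) auto
  qed
  have cong: "dcoord f p = dcoord g p" if "openin (opens X) U" "p \<in> U" "\<And>q. q \<in> U \<Longrightarrow> f q = g q" for f g U
  proof -
    have "openin (opens X) (U \<inter> \<pi> ` M)" using that open_image by blast
    then have "open {x \<in> M. \<pi> x \<in> U \<inter> \<pi> ` M}" using openin_iff by blast
    then show ?thesis
      unfolding x(2) dcoord_eq [OF x(1)] by (rule pd_cong) (use x that in auto)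
  qed
  have add: "dcoord (\<lambda>q. f q + g q) p = dcoord f p + dcoord g p" if "f \<in> germs X p" "g \<in> germs X p" for f g
    using holo [OF that] x by (auto simp: dcoord_eq pd_add)
  have mult: "dcoord (\<lambda>q. f q * g q) p = dcoord f p * g p + f p * dcoord g p"
    if "f \<in> germs X p" "g \<in> germs X p" for f g
    using holo [OF that] x by (auto simp: dcoord_eq pd_mult)
  have const: "dcoord (\<lambda>q. c) p = 0" for c
    using x by (simp add: dcoord_eq pd_def)
  have cmult: "dcoord (\<lambda>q. c * f q) p = c * dcoord f p" if "f \<in> germs X p" for f c
    using mult [OF germs_const [OF p] that, of c] const by simp
  show ?thesis
    unfolding tangent_space_def mem_Collect_eq
  proof (intro conjI allI ballI impI)
    show "vertical p f = 0" if "f \<notin> germs X p" for f using that by (simp add: vertical_def)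
    fix f assume f: "f \<in> germs X p"
    show "vertical p (\<lambda>q. c * f q) = c * vertical p f" for c
      by (simp add: vertical_def f germs_cmult [OF p] cmult)
    fix g assume g: "g \<in> germs X p"
    show "vertical p f = vertical p g" if "\<exists>U. openin (opens X) U \<and> p \<in> U \<and> (\<forall>q\<in>U. f q = g q)"
      using that cong by (auto simp: vertical_def f g)
    show "vertical p (\<lambda>q. f q + g q) = vertical p f + vertical p g"
      by (simp add: vertical_def f g germs_add [OF p] add)
    show "vertical p (\<lambda>q. f q * g q) = vertical p f * g p + f p * vertical p g"
      by (simp add: vertical_def f g germs_mult [OF p] mult)
  qed
qed

lemma vertical_coord: "p \<in> \<pi> ` M \<Longrightarrow> vertical p (\<lambda>q. coord q - c) = 1"
proof -
  assume p: "p \<in> \<pi> ` M"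
  then obtain x where x: "x \<in> M" "p = \<pi> x" by blast
  have "dcoord (\<lambda>q. coord q - c) p = pd i (\<lambda>x. x $ i - c) x"
    unfolding x(2) dcoord_eq [OF x(1)] by (rule pd_cong [OF open_M x(1)]) (simp add: coord_eq)
  then show ?thesis
    using p by (simp add: vertical_def germs_coord pd_component)
qed

lemma tangent_space_comb:
  assumes p: "p \<in> \<pi> ` M" and "D \<in> tangent_space X p" "D' \<in> tangent_space X p"
  shows "(\<lambda>f. D f - c * D' f) \<in> tangent_space X p"
proof -
  note D = assms(2,3)
  show ?thesis
    unfolding tangent_space_def mem_Collect_eq
  proof (intro conjI allI ballI impI)
    show "D f - c * D' f = 0" if "f \<notin> germs X p" for f
      using tangent_no_germ [OF D(1) that] tangent_no_germ [OF D(2) that] by simp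
    fix f g assume fg: "f \<in> germs X p" "g \<in> germs X p"
    show "D f - c * D' f = D g - c * D' g"
      if eq: "\<exists>U. openin (opens X) U \<and> p \<in> U \<and> (\<forall>q\<in>U. f q = g q)"
    proof -
      obtain U where U: "openin (opens X) U" "p \<in> U" "\<And>q. q \<in> U \<Longrightarrow> f q = g q" using eq by blast
      have "D f = D g" by (rule tangent_cong [OF D(1) fg U])
      moreover have "D' f = D' g" by (rule tangent_cong [OF D(2) fg U])
      ultimately show ?thesis by simp
    qed
    show "D (\<lambda>q. f q + g q) - c * D' (\<lambda>q. f q + g q) = D f - c * D' f + (D g - c * D' g)"
      by (simp add: tangent_add [OF D(1) fg] tangent_add [OF D(2) fg] algebra_simps)
    show "D (\<lambda>q. a * f q) - c * D' (\<lambda>q. a * f q) = a * (D f - c * D' f)" for a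
      by (simp add: tangent_cmult [OF D(1) fg(1)] tangent_cmult [OF D(2) fg(1)] algebra_simps)
    show "D (\<lambda>q. f q * g q) - c * D' (\<lambda>q. f q * g q) = (D f - c * D' f) * g p + f p * (D g - c * D' g)"
      by (simp add: tangent_mult [OF D(1) fg] tangent_mult [OF D(2) fg] algebra_simps)
  qed
qed

text \<open>A germ on the fibre is the restriction of some germ of \<open>X\<close>. The relation
  keeps this extension explicit, so that a derivation of \<open>X\<close> can be passed to the fibre
  by evaluating it on extensions.\<close>

definition extends :: "complex \<Rightarrow> 'a \<Rightarrow> ('a \<Rightarrow> complex) \<Rightarrow> ('a \<Rightarrow> complex) \<Rightarrow> bool" where
  "extends c p f F \<longleftrightarrow> F \<in> germs X p \<and> (\<exists>U. openin (opens X) U \<and> p \<in> U \<and> (\<forall>q\<in>U \<inter> fibre c. f q = F q))"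

lemma extends_imp_germ:
  assumes "extends c p f F" "p \<in> fibre c" shows "f \<in> germs (induced X (fibre c)) p"
proof -
  obtain U V where "openin (opens X) U" "p \<in> U" "\<forall>q\<in>U \<inter> fibre c. f q = F q"
    "openin (opens X) V" "p \<in> V" "F \<in> hol X V"
    using assms by (auto simp: extends_def germs_def)
  then have "f \<in> hol (induced X (fibre c)) (U \<inter> V \<inter> fibre c)"
      "openin (opens (induced X (fibre c))) (U \<inter> V \<inter> fibre c)" "p \<in> U \<inter> V \<inter> fibre c"
    using assms(2) unfolding hol_induced_iff opens_induced openin_subtopology by blast+
  then show ?thesis
    unfolding germs_def by blast
qed

lemma germ_imp_extends:
  assumes "f \<in> germs (induced X (fibre c)) p"
  obtains F where "extends c p f F"
proof -
  obtain W where W: "openin (subtopology (opens X) (fibre c)) W" "p \<in> W" "f \<in> hol (induced X (fibre c)) W"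
    using assms by (auto simp: germs_def)
  then obtain V F where V: "openin (opens X) V" "p \<in> V" "F \<in> hol X V" "\<forall>q\<in>V \<inter> W. f q = F q"
    unfolding hol_induced_iff by blast
  obtain T where T: "openin (opens X) T" "W = T \<inter> fibre c"
    using W(1) by (auto simp: openin_subtopology)
  show ?thesis
    using V T W germsI
    by (intro that [of F]) (auto simp: extends_def intro!: exI [of _ "V \<inter> T"])
qed

lemma extends_self: "f \<in> germs X p \<Longrightarrow> p \<in> \<pi> ` M \<Longrightarrow> extends c p f f"
  unfolding extends_def using open_image by blast

lemma extends_cong:
  assumes "extends c p f F" "openin (opens X) U" "p \<in> U" "\<And>q. q \<in> U \<inter> fibre c \<Longrightarrow> g q = f q"
  shows "extends c p g F"
proof -
  obtain U' where "openin (opens X) U'" "p \<in> U'" "\<forall>q\<in>U' \<inter> fibre c. f q = F q"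
    using assms(1) by (auto simp: extends_def)
  then show ?thesis
    using assms by (auto simp: extends_def intro!: exI [of _ "U \<inter> U'"])
qed

lemma extends_combine:
  assumes "extends c p f F" "extends c p g G" "(\<lambda>q. h (F q) (G q)) \<in> germs X p"
  shows "extends c p (\<lambda>q. h (f q) (g q)) (\<lambda>q. h (F q) (G q))"
proof -
  obtain U U' where "openin (opens X) U" "p \<in> U" "\<forall>q\<in>U \<inter> fibre c. f q = F q"
     "openin (opens X) U'" "p \<in> U'" "\<forall>q\<in>U' \<inter> fibre c. g q = G q"
    using assms(1,2) by (auto simp: extends_def)
  then show ?thesis
    using assms(3) by (auto simp: extends_def intro!: exI [of _ "U \<inter> U'"])
qed

text \<open>Two extensions differ near \<open>p\<close> by a multiple of the equation of the fibre.
  By the Leibniz rule \<open>D\<close> kills this multiple: \<open>D\<close> vanishes on the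
  equation, and the equation vanishes at \<open>p\<close>.\<close>

lemma extends_unique:
  assumes D: "D \<in> tangent_space X p" "D (\<lambda>q. coord q - c) = 0" and p: "p \<in> fibre c"
    and F: "extends c p f F" and G: "extends c p f G"
  shows "D F = D G"
proof -
  have pM: "p \<in> \<pi> ` M" and pc: "coord p = c" using p by (auto simp: fibre_iff)
  obtain U U' where U: "openin (opens X) U" "p \<in> U" "\<forall>q\<in>U \<inter> fibre c. f q = F q"
     "openin (opens X) U'" "p \<in> U'" "\<forall>q\<in>U' \<inter> fibre c. f q = G q"
    using F G by (auto simp: extends_def)
  have FG: "F \<in> germs X p" "G \<in> germs X p" using F G by (auto simp: extends_def)
  have "openin (opens X) (U \<inter> U')" "p \<in> U \<inter> U'" using U by auto
  then obtain V where
    V: "openin (opens X) V" "p \<in> V" "V \<subseteq> \<pi> ` M" "V \<subseteq> U \<inter> U'" "F \<in> hol X V" "G \<in> hol X V"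
    by (rule germs2D [OF FG pM])
  have "(\<lambda>q. F q + (-1) * G q) \<in> hol X V"
    using V by (intro hol_add hol_mult hol_const) auto
  moreover have "F q + (-1) * G q = 0" if "q \<in> V" "q \<in> fibre c" for q
  proof -
    have "f q = F q" "f q = G q" using that U V by blast+
    then show ?thesis by simp
  qed
  ultimately obtain h where h: "h \<in> hol X V" "\<And>q. q \<in> V \<Longrightarrow> F q + (-1) * G q = (coord q - c) * h q"
    using hol_division [OF _ V(3), of "\<lambda>q. F q + (-1) * G q" c] by metis
  have hg: "h \<in> germs X p" using h V germsI by blast
  define e where "e = (\<lambda>q. coord q - c)"
  have e: "e \<in> germs X p" unfolding e_def using germs_coord pM by blast
  have eh: "(\<lambda>q. e q * h q) \<in> germs X p" using germs_mult [OF pM e hg] .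
  have sum: "(\<lambda>q. G q + e q * h q) \<in> germs X p" using germs_add [OF pM FG(2) eh] .
  have "F q = G q + e q * h q" if "q \<in> V" for q
    using h(2) [OF that] by (simp add: e_def algebra_simps)
  then have "D F = D (\<lambda>q. G q + e q * h q)"
    by (rule tangent_cong [OF D(1) FG(1) sum V(1,2)])
  also have "\<dots> = D G + D (\<lambda>q. e q * h q)"
    by (rule tangent_add [OF D(1) FG(2) eh])
  also have "D (\<lambda>q. e q * h q) = D e * h p + e p * D h"
    by (rule tangent_mult [OF D(1) e hg])
  also have "\<dots> = 0" using D(2) pc by (simp add: e_def)
  finally show ?thesis by simp
qed

text \<open>A derivation of the fibre kills the coordinate function because that function restricts
  to zero; conversely, a derivation of \<open>X\<close> that kills it is well defined on
  restrictions by \<open>extends_unique\<close>.\<close>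

lemma tangent_to_fibre_iff:
  assumes p: "p \<in> fibre c" and D: "D \<in> tangent_space X p"
  shows "D \<in> tangent_to X (fibre c) p \<longleftrightarrow> D (\<lambda>q. coord q - c) = 0"
proof
  have pM: "p \<in> \<pi> ` M" using p by (simp add: fibre_iff)
  define e where "e = (\<lambda>q. coord q - c)"
  have e: "e \<in> germs X p" unfolding e_def using germs_coord pM by blast
  let ?Y = "induced X (fibre c)"
  {
    assume "D \<in> tangent_to X (fibre c) p"
    then obtain D' where D': "D' \<in> tangent_space ?Y p" "\<And>f. f \<in> germs X p \<Longrightarrow> D f = D' f"
      by (auto simp: tangent_to_def)
    \<comment> \<open>The zero germ is written as \<open>0 * e q\<close>, so that homogeneity gives
      the value of the derivation on it.\<close>
    have g: "e \<in> germs ?Y p" "(\<lambda>q. 0 * e q) \<in> germs ?Y p"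
      using extends_imp_germ [OF extends_self [OF e pM] p]
        extends_imp_germ [OF extends_self [OF germs_cmult [OF pM e, of 0] pM] p] by auto
    have "openin (opens ?Y) (\<pi> ` M \<inter> fibre c)"
      using open_image by (auto simp: openin_subtopology)
    moreover have "p \<in> \<pi> ` M \<inter> fibre c" "\<And>q. q \<in> \<pi> ` M \<inter> fibre c \<Longrightarrow> e q = 0 * e q"
      using p by (auto simp: e_def fibre_iff)
    ultimately have "D' e = D' (\<lambda>q. 0 * e q)"
      by (rule tangent_cong [OF D'(1) g])
    also have "\<dots> = 0 * D' e"
      by (rule tangent_cmult [OF D'(1) g(1)])
    finally show "D (\<lambda>q. coord q - c) = 0"
      using D'(2) [OF e] by (simp add: e_def)
  }
  {
    assume De: "D (\<lambda>q. coord q - c) = 0"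
    \<comment> \<open>The choice of the extension does not matter by \<open>extends_unique\<close>;
      the value 0 elsewhere is the convention of \<open>tangent_space\<close>.\<close>
    define D' where "D' = (\<lambda>f. if f \<in> germs ?Y p then D (SOME F. extends c p f F) else 0)"
    have D'eq: "D' f = D F" if "extends c p f F" for f F
    proof -
      have "extends c p f (SOME F. extends c p f F)" using that by (metis someI)
      then have "D (SOME F. extends c p f F) = D F"
        using extends_unique [OF D De p _ that] by blast
      then show ?thesis
        using extends_imp_germ [OF that p] by (simp add: D'_def)
    qed
    have "D' \<in> tangent_space ?Y p"
      unfolding tangent_space_def mem_Collect_eq
    proof (intro conjI allI ballI impI)
      show "D' f = 0" if "f \<notin> germs ?Y p" for f using that by (simp add: D'_def)
      fix f assume "f \<in> germs ?Y p"
      then obtain F where F: "extends c p f F" using germ_imp_extends by blast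
      then have Fg: "F \<in> germs X p" by (simp add: extends_def)
      show "D' (\<lambda>q. a * f q) = a * D' f" for a
      proof -
        have "extends c p (\<lambda>q. a * f q) (\<lambda>q. a * F q)"
          by (rule extends_combine [where h = "\<lambda>x y. a * x", OF F F germs_cmult [OF pM Fg]])
        then show ?thesis
          using tangent_cmult [OF D Fg] by (simp add: D'eq [OF F] D'eq)
      qed
      fix g assume g: "g \<in> germs ?Y p"
      then obtain G where G: "extends c p g G" using germ_imp_extends by blast
      then have Gg: "G \<in> germs X p" by (simp add: extends_def)
      show "D' f = D' g" if eq: "\<exists>U. openin (opens ?Y) U \<and> p \<in> U \<and> (\<forall>q\<in>U. f q = g q)"
      proof -
        obtain U where U: "openin (opens ?Y) U" "p \<in> U" "\<forall>q\<in>U. f q = g q" using eq by blast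
        then obtain T where T: "openin (opens X) T" "U = T \<inter> fibre c"
          by (auto simp: openin_subtopology)
        have "openin (opens X) T" "p \<in> T" "\<And>q. q \<in> T \<inter> fibre c \<Longrightarrow> g q = f q"
          using T U by auto
        then have "extends c p g F" by (rule extends_cong [OF F])
        then show ?thesis using D'eq F by metis
      qed
      show "D' (\<lambda>q. f q + g q) = D' f + D' g"
      proof -
        have "extends c p (\<lambda>q. f q + g q) (\<lambda>q. F q + G q)"
          by (rule extends_combine [where h = "(+)", OF F G germs_add [OF pM Fg Gg]])
        then show ?thesis
          using tangent_add [OF D Fg Gg] by (simp add: D'eq [OF F] D'eq [OF G] D'eq)
      qed
      show "D' (\<lambda>q. f q * g q) = D' f * g p + f p * D' g"
      proof -
        have "extends c p (\<lambda>q. f q * g q) (\<lambda>q. F q * G q)"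
          by (rule extends_combine [where h = "(*)", OF F G germs_mult [OF pM Fg Gg]])
        moreover have "f p = F p" "g p = G p" using F G p by (auto simp: extends_def)
        ultimately show ?thesis
          using tangent_mult [OF D Fg Gg] by (simp add: D'eq [OF F] D'eq [OF G] D'eq)
      qed
    qed
    moreover have "D f = D' f" if "f \<in> germs X p" for f
      using D'eq [OF extends_self [OF that pM]] by simp
    ultimately show "D \<in> tangent_to X (fibre c) p"
      using D by (auto simp: tangent_to_def)
  }
qed

text \<open>The field \<open>vertical\<close> is its own holomorphic representative: applied to a
  holomorphic \<open>f\<close> it gives \<open>dcoord f\<close>, which is holomorphic.\<close>

lemma vertical_normal_section: "holomorphic_normal_section X (fibre c) vertical"
  unfolding holomorphic_normal_section_def
proof (intro conjI ballI)
  fix p assume p: "p \<in> fibre c"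
  then have pM: "p \<in> \<pi> ` M" by (simp add: fibre_iff)
  then show "vertical p \<in> tangent_space X p" by (rule vertical_tangent)
  have 1: "vertical q \<in> tangent_space X q \<and> (\<lambda>f. vertical q f - vertical q f) \<in> tangent_to X (fibre c) q"
    if "q \<in> \<pi> ` M \<inter> fibre c" for q
  proof -
    have q: "q \<in> \<pi> ` M" "q \<in> fibre c" using that by auto
    \<comment> \<open>The zero vector, written with the coefficient 1 so that
      \<open>tangent_space_comb\<close> shows it to be a tangent vector.\<close>
    have "(\<lambda>f. vertical q f - 1 * vertical q f) \<in> tangent_space X q"
      by (intro tangent_space_comb vertical_tangent q)
    then show ?thesis
      using tangent_to_fibre_iff [OF q(2)] vertical_tangent [OF q(1)] by simp
  qed
  have 2: "(\<lambda>q. vertical q f) \<in> hol (induced X (fibre c)) (V \<inter> fibre c)"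
    if V: "V \<subseteq> \<pi> ` M" and f: "f \<in> hol X V" for V f
  proof -
    have "dcoord f \<in> hol X V" "openin (opens X) V"
      using hol_dcoord [OF f V] hol_openin [OF f] by auto
    moreover have "vertical q f = dcoord f q" if "q \<in> V" for q
      using germsI [OF f that] by (simp add: vertical_def)
    ultimately show ?thesis
      unfolding hol_induced_iff openin_subtopology by blast
  qed
  show "\<exists>U w. openin (opens X) U \<and> p \<in> U \<and>
        (\<forall>q\<in>U \<inter> fibre c. w q \<in> tangent_space X q \<and> (\<lambda>f. w q f - vertical q f) \<in> tangent_to X (fibre c) q) \<and>
        (\<forall>V. V \<subseteq> U \<longrightarrow> (\<forall>f\<in>hol X V. (\<lambda>q. w q f) \<in> hol (induced X (fibre c)) (V \<inter> fibre c)))"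
    using open_image pM 1 2 by (intro exI [of _ "\<pi> ` M"] exI [of _ vertical]) blast
qed

text \<open>A frame of rank one: \<open>vertical\<close> takes the value 1 on the coordinate and
  tangency to the fibre means the value 0, so the coefficient of \<open>D\<close> is forced to be
  the value of \<open>D\<close> on the coordinate.\<close>

lemma trivial_normal_bundle_fibre: "trivial_normal_bundle X (fibre c)"
  unfolding trivial_normal_bundle_def
proof (intro exI conjI allI impI ballI)
  show "holomorphic_normal_section X (fibre c) ((\<lambda>j::nat. vertical) j)" for j
    using vertical_normal_section by simp
  fix p D assume p: "p \<in> fibre c" and D: "D \<in> tangent_space X p"
  have pM: "p \<in> \<pi> ` M" using p by (simp add: fibre_iff)
  define d where "d = D (\<lambda>q. coord q - c)"
  have iff: "(\<lambda>f. D f - (\<Sum>j<(1::nat). a j * vertical p f)) \<in> tangent_to X (fibre c) p \<longleftrightarrow> a 0 = d" for a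
    using tangent_to_fibre_iff [OF p tangent_space_comb [OF pM D vertical_tangent [OF pM], of "a 0"]]
    by (auto simp: vertical_coord [OF pM] d_def)
  show "\<exists>!a :: nat \<Rightarrow> complex. (\<forall>i\<ge>1. a i = 0) \<and>
             (\<lambda>f. D f - (\<Sum>i<1. a i * vertical p f)) \<in> tangent_to X (fibre c) p"
    unfolding iff
  proof (rule ex1I [of _ "\<lambda>j. if j = 0 then d else 0"])
    fix a :: "nat \<Rightarrow> complex" assume "(\<forall>i\<ge>1. a i = 0) \<and> a 0 = d"
    then show "a = (\<lambda>j. if j = 0 then d else 0)"
      by (intro ext) (auto simp: Suc_le_eq)
  qed auto
qed

end

section \<open>Holomorphic maps between quotients\<close>

lemma holomorphic_mapI:
  assumes "\<And>x. x \<in> points X \<Longrightarrow> f x \<in> points Y"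
    and "\<And>U. openin (opens Y) U \<Longrightarrow> openin (opens X) {x \<in> points X. f x \<in> U}"
    and "\<And>U g. g \<in> hol Y U \<Longrightarrow> (\<lambda>x. g (f x)) \<in> hol X {x \<in> points X. f x \<in> U}"
  shows "holomorphic_map X Y f"
  using assms unfolding holomorphic_map_def continuous_map_def by auto

lemma holomorphic_mapD:
  assumes "holomorphic_map X Y f"
  shows "x \<in> points X \<Longrightarrow> f x \<in> points Y"
    and "openin (opens Y) U \<Longrightarrow> openin (opens X) {x \<in> points X. f x \<in> U}"
    and "g \<in> hol Y U \<Longrightarrow> (\<lambda>x. g (f x)) \<in> hol X {x \<in> points X. f x \<in> U}"
  using assms unfolding holomorphic_map_def continuous_map_def by auto

lemma holomorphic_map_compose:
  assumes f: "holomorphic_map X Y f" and g: "holomorphic_map Y W g"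
  shows "holomorphic_map X W (\<lambda>x. g (f x))"
proof (rule holomorphic_mapI)
  show "g (f x) \<in> points W" if "x \<in> points X" for x
    using that holomorphic_mapD(1)[OF f] holomorphic_mapD(1)[OF g] by blast
  have eq: "{x \<in> points X. f x \<in> {y \<in> points Y. g y \<in> U}} = {x \<in> points X. g (f x) \<in> U}" for U
    using holomorphic_mapD(1)[OF f] by blast
  show "openin (opens X) {x \<in> points X. g (f x) \<in> U}" if "openin (opens W) U" for U
    using holomorphic_mapD(2)[OF f holomorphic_mapD(2)[OF g that]] by (simp only: eq)
  show "(\<lambda>x. h (g (f x))) \<in> hol X {x \<in> points X. g (f x) \<in> U}" if "h \<in> hol W U" for U h
    using holomorphic_mapD(3)[OF f holomorphic_mapD(3)[OF g that]] by (simp only: eq)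
qed

definition hol_opens :: "'a cspace \<Rightarrow> bool" where
  "hol_opens X \<longleftrightarrow> (\<forall>U f. f \<in> hol X U \<longrightarrow> openin (opens X) U)"

lemma hol_opens_quotient [simp]: "hol_opens (quotient_space M \<pi>)"
  by (simp add: hol_opens_def hol_quotient_iff)

lemma hol_opens_function_sheaf:
  assumes "function_sheaf X" shows "hol_opens X"
  unfolding hol_opens_def
proof (intro allI impI)
  fix U f assume "f \<in> hol X U"
  with spec [OF spec [OF conjunct1 [OF assms [unfolded function_sheaf_def]], of U], of f]
  show "openin (opens X) U" by (rule iffD1 [THEN conjunct1])
qed

lemma holomorphic_map_restrict:
  assumes f: "holomorphic_map X Y f" and B: "\<And>x. x \<in> points X \<Longrightarrow> x \<in> A \<Longrightarrow> f x \<in> B"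
  shows "holomorphic_map (induced X A) (induced Y B) f"
proof (rule holomorphic_mapI)
  show "f x \<in> points (induced Y B)" if "x \<in> points (induced X A)" for x
    using that B holomorphic_mapD(1)[OF f] by auto
  show o: "openin (opens (induced X A)) {x \<in> points (induced X A). f x \<in> U}"
    if U: "openin (opens (induced Y B)) U" for U
  proof -
    obtain T where T: "openin (opens Y) T" "U = T \<inter> B"
      using U by (auto simp: openin_subtopology)
    have "{x \<in> points (induced X A). f x \<in> U} = {x \<in> points X. f x \<in> T} \<inter> A"
      using T B by auto
    then show ?thesis
      using holomorphic_mapD(2)[OF f T(1)] by (auto simp: openin_subtopology)
  qed
  show "(\<lambda>x. g (f x)) \<in> hol (induced X A) {x \<in> points (induced X A). f x \<in> U}"
    if g: "g \<in> hol (induced Y B) U" for U g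
    unfolding hol_induced_iff
  proof (intro conjI ballI)
    show "openin (subtopology (opens X) A) {x \<in> points (induced X A). f x \<in> U}"
      using o [OF hol_induced_openin [OF g]] by simp
    fix x assume x: "x \<in> {x \<in> points (induced X A). f x \<in> U}"
    then obtain V G where V: "openin (opens Y) V" "f x \<in> V" "G \<in> hol Y V" "\<forall>q\<in>V \<inter> U. g q = G q"
      using g unfolding hol_induced_iff by blast
    show "\<exists>V F. openin (opens X) V \<and> x \<in> V \<and> F \<in> hol X V \<and>
        (\<forall>q\<in>V \<inter> {x \<in> points (induced X A). f x \<in> U}. g (f q) = F q)"
      using holomorphic_mapD(2)[OF f V(1)] holomorphic_mapD(3)[OF f V(3)] x V
      by (intro exI [of _ "{x \<in> points X. f x \<in> V}"] exI [of _ "\<lambda>x. G (f x)"]) auto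
  qed
qed

text \<open>Only locality of the holomorphic functions of the source is needed to pull back functions on
  a subspace of the target.\<close>

definition hol_local :: "'a cspace \<Rightarrow> bool" where
  "hol_local X \<longleftrightarrow> (\<forall>U f. openin (opens X) U \<longrightarrow>
     (\<forall>p\<in>U. \<exists>V F. openin (opens X) V \<and> p \<in> V \<and> F \<in> hol X V \<and> (\<forall>q\<in>V \<inter> U. f q = F q)) \<longrightarrow> f \<in> hol X U)"

lemma hol_localD:
  assumes "hol_local X" "openin (opens X) U"
    and "\<And>p. p \<in> U \<Longrightarrow> \<exists>V F. openin (opens X) V \<and> p \<in> V \<and> F \<in> hol X V \<and> (\<forall>q\<in>V \<inter> U. f q = F q)"
  shows "f \<in> hol X U"
  using assms by (simp add: hol_local_def)

lemma hol_local_quotient: "hol_local (quotient_space M \<pi>)"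
  unfolding hol_local_def
proof (intro allI impI)
  fix U f
  assume U: "openin (opens (quotient_space M \<pi>)) U"
    and ex: "\<forall>p\<in>U. \<exists>V F. openin (opens (quotient_space M \<pi>)) V \<and> p \<in> V \<and>
              F \<in> hol (quotient_space M \<pi>) V \<and> (\<forall>q\<in>V \<inter> U. f q = F q)"
  have "holo_on (\<lambda>x. f (\<pi> x)) {x \<in> M. \<pi> x \<in> U}"
  proof (rule holo_on_local)
    fix x assume x: "x \<in> {x \<in> M. \<pi> x \<in> U}"
    then obtain V F where V: "openin (opens (quotient_space M \<pi>)) V" "\<pi> x \<in> V"
        "F \<in> hol (quotient_space M \<pi>) V" "\<forall>q\<in>V \<inter> U. f q = F q"
      using ex by blast
    have o: "open ({x \<in> M. \<pi> x \<in> V} \<inter> {x \<in> M. \<pi> x \<in> U})"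
      using U V(1) unfolding openin_quotient_space by (auto intro: open_Int)
    have "holo_on (\<lambda>x. F (\<pi> x)) ({x \<in> M. \<pi> x \<in> V} \<inter> {x \<in> M. \<pi> x \<in> U})"
      using V(3) unfolding hol_quotient_iff by (auto intro: holo_on_subset)
    then have "holo_on (\<lambda>x. f (\<pi> x)) ({x \<in> M. \<pi> x \<in> V} \<inter> {x \<in> M. \<pi> x \<in> U})"
      by (rule holo_on_cong_open [OF _ o]) (use V(4) in auto)
    then show "\<exists>W. x \<in> W \<and> holo_on (\<lambda>x. f (\<pi> x)) W"
      using x V(2) by (intro exI [of _ "{x \<in> M. \<pi> x \<in> V} \<inter> {x \<in> M. \<pi> x \<in> U}"]) auto
  qed
  then show "f \<in> hol (quotient_space M \<pi>) U"
    using U by (simp add: hol_quotient_iff)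
qed

lemma holomorphic_map_into_induced:
  assumes f: "holomorphic_map X Y f" and B: "\<And>x. x \<in> points X \<Longrightarrow> f x \<in> B"
    and X: "hol_local X"
  shows "holomorphic_map X (induced Y B) f"
proof (rule holomorphic_mapI)
  show "f x \<in> points (induced Y B)" if "x \<in> points X" for x
    using that B holomorphic_mapD(1)[OF f] by auto
  show o: "openin (opens X) {x \<in> points X. f x \<in> U}"
    if U: "openin (opens (induced Y B)) U" for U
  proof -
    obtain T where T: "openin (opens Y) T" "U = T \<inter> B"
      using U by (auto simp: openin_subtopology)
    have "{x \<in> points X. f x \<in> U} = {x \<in> points X. f x \<in> T}"
      using T B by auto
    then show ?thesis
      using holomorphic_mapD(2)[OF f T(1)] by simp
  qed
  fix U g assume g: "g \<in> hol (induced Y B) U"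
  show "(\<lambda>x. g (f x)) \<in> hol X {x \<in> points X. f x \<in> U}"
  proof (rule hol_localD [OF X o [OF hol_induced_openin [OF g]]])
    fix x assume x: "x \<in> {x \<in> points X. f x \<in> U}"
    obtain V G where V: "openin (opens Y) V" "f x \<in> V" "G \<in> hol Y V" "\<forall>q\<in>V \<inter> U. g q = G q"
      using g x unfolding hol_induced_iff by blast
    then show "\<exists>V F. openin (opens X) V \<and> x \<in> V \<and> F \<in> hol X V \<and>
        (\<forall>q\<in>V \<inter> {x \<in> points X. f x \<in> U}. g (f q) = F q)"
      using holomorphic_mapD(2)[OF f V(1)] holomorphic_mapD(3)[OF f V(3)] x
      by (intro exI [of _ "{x \<in> points X. f x \<in> V}"] exI [of _ "\<lambda>x. G (f x)"]) auto
  qed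
qed

lemma holomorphic_map_inclusion:
  assumes "hol_opens X"
  shows "holomorphic_map (induced X A) X (\<lambda>x. x)"
proof (rule holomorphic_mapI)
  show o: "openin (opens (induced X A)) {x \<in> points (induced X A). x \<in> U}" if "openin (opens X) U" for U
  proof -
    have "{x \<in> points (induced X A). x \<in> U} = U \<inter> A"
      using openin_subset [OF that] by auto
    then show ?thesis using that by (auto simp: openin_subtopology)
  qed
  show "g \<in> hol (induced X A) {x \<in> points (induced X A). x \<in> U}" if "g \<in> hol X U" for U g
    using that assms o [of U] unfolding hol_induced_iff hol_opens_def by auto
qed auto

text \<open>\<open>inv_into\<close> agrees with \<open>g\<close> only on the points of
  \<open>Y\<close>; the last premise allows a holomorphic function to be changed outside its
  domain.\<close>

lemma biholomorphic_mapI: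
  assumes f: "holomorphic_map X Y f" and g: "holomorphic_map Y X g"
    and gf: "\<And>x. x \<in> points X \<Longrightarrow> g (f x) = x" and fg: "\<And>y. y \<in> points Y \<Longrightarrow> f (g y) = y"
    and Y: "\<And>U h h'. h \<in> hol Y U \<Longrightarrow> (\<And>y. y \<in> U \<Longrightarrow> h y = h' y) \<Longrightarrow> h' \<in> hol Y U"
  shows "biholomorphic_map X Y f"
proof -
  have bij: "bij_betw f (points X) (points Y)"
    by (rule bij_betw_byWitness [where f' = g])
       (use gf fg holomorphic_mapD(1)[OF f] holomorphic_mapD(1)[OF g] in auto)
  have inv: "inv_into (points X) f y = g y" if "y \<in> points Y" for y
    using bij fg holomorphic_mapD(1)[OF g that] gf that
    by (metis bij_betw_imp_inj_on inv_into_f_f)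
  have "holomorphic_map Y X (inv_into (points X) f)"
  proof (rule holomorphic_mapI)
    have eq: "{y \<in> points Y. inv_into (points X) f y \<in> U} = {y \<in> points Y. g y \<in> U}" for U
      using inv by auto
    show "inv_into (points X) f y \<in> points X" if "y \<in> points Y" for y
      using holomorphic_mapD(1)[OF g that] inv [OF that] by simp
    show "openin (opens Y) {y \<in> points Y. inv_into (points X) f y \<in> U}" if "openin (opens X) U" for U
      using holomorphic_mapD(2)[OF g that] by (simp only: eq)
    show "(\<lambda>y. h (inv_into (points X) f y)) \<in> hol Y {y \<in> points Y. inv_into (points X) f y \<in> U}"
      if "h \<in> hol X U" for U h
      unfolding eq by (rule Y [OF holomorphic_mapD(3)[OF g that]]) (simp add: inv)
  qed
  then show ?thesis using bij f by (simp add: biholomorphic_map_def)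
qed

lemma hol_induced_cong:
  assumes "f \<in> hol (induced X A) U" "\<And>x. x \<in> U \<Longrightarrow> f x = g x"
  shows "g \<in> hol (induced X A) U"
  unfolding hol_induced_iff
proof (intro conjI ballI)
  show "openin (subtopology (opens X) A) U"
    using hol_induced_openin [OF assms(1)] by simp
  fix p assume "p \<in> U"
  then obtain V F where "openin (opens X) V" "p \<in> V" "F \<in> hol X V" "\<forall>q\<in>V \<inter> U. f q = F q"
    using assms(1) unfolding hol_induced_iff by blast
  then show "\<exists>V F. openin (opens X) V \<and> p \<in> V \<and> F \<in> hol X V \<and> (\<forall>q\<in>V \<inter> U. g q = F q)"
    using assms(2) by (intro exI [of _ V] exI [of _ F]) auto
qed

lemma hol_quotient_const: "openin (opens (quotient_space M \<pi>)) U \<Longrightarrow> (\<lambda>x. c) \<in> hol (quotient_space M \<pi>) U"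
  by (auto simp: hol_quotient_iff)

text \<open>Functions on a subspace are local restrictions, so a pulled-back function must be
  extended to an open set of the whole quotient. The lift \<open>\<Lambda>\<close> achieves this: it
  represents \<open>f\<close> only over \<open>A\<close>, but it respects the fibres of
  \<open>\<pi>\<close> on all of a saturated open set \<open>N\<close>.\<close>

lemma holomorphic_map_lift:
  assumes M: "open M" and M': "open M'"
    and lift: "\<And>x. x \<in> M \<Longrightarrow> \<pi> x \<in> A \<Longrightarrow> \<exists>N \<Lambda>. open N \<and> N \<subseteq> M \<and> x \<in> N \<and>
       (\<forall>y\<in>N. \<forall>z\<in>M. \<pi> y = \<pi> z \<longrightarrow> z \<in> N \<and> \<pi>' (\<Lambda> y) = \<pi>' (\<Lambda> z)) \<and>
       holo_map \<Lambda> N \<and> \<Lambda> ` N \<subseteq> M' \<and> (\<forall>y\<in>N. \<pi> y \<in> A \<longrightarrow> f (\<pi> y) = \<pi>' (\<Lambda> y))"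
  shows "holomorphic_map (induced (quotient_space M \<pi>) A) (quotient_space M' \<pi>') f"
proof -
  let ?X = "quotient_space M \<pi>" and ?Y = "quotient_space M' \<pi>'"
  have pts: "points (induced ?X A) = \<pi> ` M \<inter> A" using M by simp
  have into: "f p \<in> points ?Y" if p: "p \<in> points (induced ?X A)" for p
  proof -
    obtain x where x: "x \<in> M" "p = \<pi> x" "\<pi> x \<in> A" using p unfolding pts by auto
    obtain N \<Lambda> where N: "x \<in> N" "\<Lambda> ` N \<subseteq> M'" "\<forall>y\<in>N. \<pi> y \<in> A \<longrightarrow> f (\<pi> y) = \<pi>' (\<Lambda> y)"
      using lift [OF x(1,3)] by blast
    then have "f p = \<pi>' (\<Lambda> x)" "\<Lambda> x \<in> M'" using x by auto
    then show ?thesis using M' by simp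
  qed
  have key: "\<exists>T G. openin (opens ?X) T \<and> p \<in> T \<and> G \<in> hol ?X T \<and> (\<forall>q\<in>T \<inter> A. f q \<in> U \<and> g (f q) = G q)"
    if g: "g \<in> hol ?Y U" and p: "p \<in> points (induced ?X A)" "f p \<in> U" for g U p
  proof -
    obtain x where x: "x \<in> M" "p = \<pi> x" "\<pi> x \<in> A" using p unfolding pts by auto
    obtain N \<Lambda> where N: "open N" "N \<subseteq> M" "x \<in> N"
       "\<And>y z. y \<in> N \<Longrightarrow> z \<in> M \<Longrightarrow> \<pi> y = \<pi> z \<Longrightarrow> z \<in> N \<and> \<pi>' (\<Lambda> y) = \<pi>' (\<Lambda> z)"
       "holo_map \<Lambda> N" "\<Lambda> ` N \<subseteq> M'" "\<And>y. y \<in> N \<Longrightarrow> \<pi> y \<in> A \<Longrightarrow> f (\<pi> y) = \<pi>' (\<Lambda> y)"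
      using lift [OF x(1,3)] by metis
    \<comment> \<open>Shrinking to the points whose lift lies over \<open>U\<close> keeps the set
      saturated, because \<open>\<pi>' (\<Lambda> y)\<close> depends only on
      \<open>\<pi> y\<close>.\<close>
    define N' where "N' = {y \<in> N. \<Lambda> y \<in> {x' \<in> M'. \<pi>' x' \<in> U}}"
    have U: "open {x' \<in> M'. \<pi>' x' \<in> U}" "holo_on (\<lambda>x'. g (\<pi>' x')) {x' \<in> M'. \<pi>' x' \<in> U}"
      using g unfolding hol_quotient_iff openin_quotient_space by auto
    have "open N'" unfolding N'_def by (rule open_holo_map_preimage [OF N(5,1) U(1)])
    have N'N: "N' \<subseteq> N" by (auto simp: N'_def)
    have pre: "{z \<in> M. \<pi> z \<in> \<pi> ` N'} = N'"
    proof
      show "N' \<subseteq> {z \<in> M. \<pi> z \<in> \<pi> ` N'}" using N'N N(2) by auto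
      show "{z \<in> M. \<pi> z \<in> \<pi> ` N'} \<subseteq> N'"
      proof
        fix z assume "z \<in> {z \<in> M. \<pi> z \<in> \<pi> ` N'}"
        then obtain y where y: "z \<in> M" "y \<in> N'" "\<pi> y = \<pi> z" by auto
        then have "z \<in> N" "\<pi>' (\<Lambda> y) = \<pi>' (\<Lambda> z)" using N(4)[of y z] N'N by blast+
        moreover have "\<Lambda> z \<in> M'" using N(6) \<open>z \<in> N\<close> by blast
        ultimately show "z \<in> N'" using y(2) by (simp add: N'_def)
      qed
    qed
    define r where "r = (\<lambda>q. SOME y. y \<in> N' \<and> \<pi> y = q)"
    have r: "r (\<pi> y) \<in> N'" "\<pi> (r (\<pi> y)) = \<pi> y" if "y \<in> N'" for y
      using someI [of "\<lambda>z. z \<in> N' \<and> \<pi> z = \<pi> y" y] that by (auto simp: r_def)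
    define G where "G = (\<lambda>q. g (\<pi>' (\<Lambda> (r q))))"
    have G: "G (\<pi> y) = g (\<pi>' (\<Lambda> y))" if "y \<in> N'" for y
      using N(4)[of y "r (\<pi> y)"] r [OF that] that N'N N(2) unfolding G_def by (metis subsetD)
    have open': "openin (opens ?X) (\<pi> ` N')"
      unfolding openin_quotient_space using pre \<open>open N'\<close> N'N N(2) by auto
    have "holo_map \<Lambda> N'" using N(5) N'N holo_on_subset unfolding holo_map_def by blast
    then have "holo_on (\<lambda>y. g (\<pi>' (\<Lambda> y))) N'"
      by (rule holo_on_compose [OF U(2)]) (auto simp: N'_def)
    then have "holo_on (\<lambda>y. G (\<pi> y)) N'"
      by (rule holo_on_cong_open [OF _ \<open>open N'\<close>]) (simp add: G)
    then have "G \<in> hol ?X (\<pi> ` N')"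
      unfolding hol_quotient_iff using open' pre by simp
    moreover have "f q \<in> U \<and> g (f q) = G q" if "q \<in> \<pi> ` N' \<inter> A" for q
    proof -
      obtain y where y: "y \<in> N'" "q = \<pi> y" using \<open>q \<in> \<pi> ` N' \<inter> A\<close> by auto
      then have "f q = \<pi>' (\<Lambda> y)" using N(7) N'N \<open>q \<in> \<pi> ` N' \<inter> A\<close> by auto
      then show ?thesis using G [OF y(1)] y by (simp add: N'_def)
    qed
    moreover have "p \<in> \<pi> ` N'"
    proof -
      have "f p = \<pi>' (\<Lambda> x)" "\<Lambda> x \<in> M'" using N(7)[OF N(3) x(3)] x(2) N(3,6) by auto
      then have "x \<in> N'" using p(2) N(3) by (simp add: N'_def)
      then show ?thesis using x(2) by blast
    qed
    ultimately show ?thesis using open' by blast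
  qed
  have open_pre: "openin (opens (induced ?X A)) {p \<in> points (induced ?X A). f p \<in> U}"
    if U: "openin (opens ?Y) U" for U
  proof (subst openin_subopen, intro ballI)
    fix p assume "p \<in> {p \<in> points (induced ?X A). f p \<in> U}"
    then have p: "p \<in> points (induced ?X A)" "f p \<in> U" and pA: "p \<in> A" by auto
    \<comment> \<open>For openness only the first half of the conclusion of \<open>key\<close>
      matters, so a constant function serves as \<open>g\<close>.\<close>
    obtain T where T: "openin (opens ?X) T" "p \<in> T" "\<forall>q\<in>T \<inter> A. f q \<in> U"
      using key [OF hol_quotient_const [OF U, of 0] p] by blast
    show "\<exists>W. openin (opens (induced ?X A)) W \<and> p \<in> W \<and> W \<subseteq> {p \<in> points (induced ?X A). f p \<in> U}"
      using T pA openin_subset [OF T(1)] by (intro exI [of _ "T \<inter> A"]) (auto simp: openin_subtopology)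
  qed
  show ?thesis
  proof (rule holomorphic_mapI)
    show "(\<lambda>x. g (f x)) \<in> hol (induced ?X A) {x \<in> points (induced ?X A). f x \<in> U}"
      if g: "g \<in> hol ?Y U" for U g
      unfolding hol_induced_iff
    proof (intro conjI ballI)
      have "openin (opens ?Y) U" using g by (simp add: hol_quotient_iff)
      then show "openin (subtopology (opens ?X) A) {x \<in> points (induced ?X A). f x \<in> U}"
        using open_pre by simp
      fix p assume "p \<in> {x \<in> points (induced ?X A). f x \<in> U}"
      then have p: "p \<in> points (induced ?X A)" "f p \<in> U" by auto
      obtain T G where "openin (opens ?X) T" "p \<in> T" "G \<in> hol ?X T" "\<forall>q\<in>T \<inter> A. f q \<in> U \<and> g (f q) = G q"
        using key [OF g p] by blast
      then show "\<exists>V F. openin (opens ?X) V \<and> p \<in> V \<and> F \<in> hol ?X V \<and>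
          (\<forall>q\<in>V \<inter> {x \<in> points (induced ?X A). f x \<in> U}. g (f q) = F q)"
        by (intro exI [of _ T] exI [of _ G]) auto
    qed
  qed (use into open_pre in auto)
qed

section \<open>The rational parametrization of the conic bundle\<close>

text \<open>The hypotheses are the formulas of the parametrization with denominators cleared, so
  that each conclusion follows by polynomial algebra and cancellation of E and d. Here t stands for
  i z, and the last four identities are those from which E will be recovered.\<close>

lemma rational_parametrization_relations:
  fixes r1 r2 c d E m n y1 y2 y3 t u v :: complex
  assumes nz: "E \<noteq> 0" "d \<noteq> 0" and c: "c\<^sup>2 * d\<^sup>2 = -2" and d: "d = r1\<^sup>2 - r2\<^sup>2"
    and y1: "y1 = c * m * n"
    and y2: "E * d * y2 = E * r1 * m\<^sup>2 - r2 * n\<^sup>2"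
    and y3: "d * y3 = r1 * n\<^sup>2 - E * r2 * m\<^sup>2"
    and t: "E * d\<^sup>2 * t = - (r1 * r2) * (E\<^sup>2 * m ^ 4 - n ^ 4)"
    and u: "2 * u = 2 * y2 * y3 + (r1\<^sup>2 + r2\<^sup>2) * y1\<^sup>2 + 2 * t"
    and v: "2 * v = 2 * y2 * y3 + (r1\<^sup>2 + r2\<^sup>2) * y1\<^sup>2 - 2 * t"
  shows "d\<^sup>2 * u = - 2 * r1 * r2 * E * m ^ 4"
    and "E * d\<^sup>2 * v = - 2 * r1 * r2 * n ^ 4"
    and "u * v = r1\<^sup>2 * r2\<^sup>2 * y1 ^ 4"
    and "r1 * E * y2 + r2 * y3 = E * m\<^sup>2"
    and "r2 * E * y2 + r1 * y3 = n\<^sup>2"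
    and "d * (u - r1\<^sup>2 * y1\<^sup>2) = 2 * r1 * m\<^sup>2 * y3"
    and "d * (u - r2\<^sup>2 * y1\<^sup>2) = - 2 * r2 * m\<^sup>2 * E * y2"
    and "E * d * (v - r2\<^sup>2 * y1\<^sup>2) = - 2 * r2 * n\<^sup>2 * y3"
    and "d * (v - r1\<^sup>2 * y1\<^sup>2) = 2 * r1 * n\<^sup>2 * y2"
proof -
  have y1s: "d\<^sup>2 * y1\<^sup>2 = - 2 * m\<^sup>2 * n\<^sup>2" using y1 c by algebra
  have y23: "E * d\<^sup>2 * (y2 * y3) = (E * r1 * m\<^sup>2 - r2 * n\<^sup>2) * (r1 * n\<^sup>2 - E * r2 * m\<^sup>2)"
    using y2 y3 by algebra
  have "2 * (E * (d\<^sup>2 * u)) = 2 * (E * (- 2 * r1 * r2 * E * m ^ 4))"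
  proof -
    have "2 * (E * (d\<^sup>2 * u)) = E * d\<^sup>2 * (2 * u)" by algebra
    also have "\<dots> = 2 * (E * d\<^sup>2 * (y2 * y3)) + (r1\<^sup>2 + r2\<^sup>2) * E * (d\<^sup>2 * y1\<^sup>2) + 2 * (E * d\<^sup>2 * t)"
      unfolding u by algebra
    also have "\<dots> = 2 * (E * (- 2 * r1 * r2 * E * m ^ 4))"
      unfolding y1s y23 t by algebra
    finally show ?thesis .
  qed
  with nz(1) show U: "d\<^sup>2 * u = - 2 * r1 * r2 * E * m ^ 4"
    by (simp only: mult_cancel_left) simp
  have "2 * (E * d\<^sup>2 * v) = 2 * (- 2 * r1 * r2 * n ^ 4)"
  proof -
    have "2 * (E * d\<^sup>2 * v) = E * d\<^sup>2 * (2 * v)" by algebra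
    also have "\<dots> = 2 * (E * d\<^sup>2 * (y2 * y3)) + (r1\<^sup>2 + r2\<^sup>2) * E * (d\<^sup>2 * y1\<^sup>2) - 2 * (E * d\<^sup>2 * t)"
      unfolding v by algebra
    also have "\<dots> = 2 * (- 2 * r1 * r2 * n ^ 4)"
      unfolding y1s y23 t by algebra
    finally show ?thesis .
  qed
  then show V: "E * d\<^sup>2 * v = - 2 * r1 * r2 * n ^ 4"
    by (simp only: mult_cancel_left) simp
  have "E * d ^ 4 * (u * v) = E * d ^ 4 * (r1\<^sup>2 * r2\<^sup>2 * y1 ^ 4)"
  proof -
    have "E * d ^ 4 * (u * v) = (d\<^sup>2 * u) * (E * d\<^sup>2 * v)" by algebra
    also have "\<dots> = E * (r1\<^sup>2 * r2\<^sup>2) * (- 2 * m\<^sup>2 * n\<^sup>2)\<^sup>2"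
      unfolding U V by algebra
    also have "\<dots> = E * (r1\<^sup>2 * r2\<^sup>2) * (d\<^sup>2 * y1\<^sup>2)\<^sup>2" unfolding y1s ..
    also have "\<dots> = E * d ^ 4 * (r1\<^sup>2 * r2\<^sup>2 * y1 ^ 4)" by algebra
    finally show ?thesis .
  qed
  with nz show "u * v = r1\<^sup>2 * r2\<^sup>2 * y1 ^ 4"
    by (simp only: mult_cancel_left) simp
  have "d * (r1 * E * y2 + r2 * y3) = d * (E * m\<^sup>2)"
    using y2 y3 d by algebra
  then show "r1 * E * y2 + r2 * y3 = E * m\<^sup>2"
    using nz by (simp only: mult_cancel_left) simp
  have "d * (r2 * E * y2 + r1 * y3) = d * n\<^sup>2"
    using y2 y3 d by algebra
  then show "r2 * E * y2 + r1 * y3 = n\<^sup>2"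
    using nz by (simp only: mult_cancel_left) simp
  have "d * (d * (u - r1\<^sup>2 * y1\<^sup>2)) = d * (2 * r1 * m\<^sup>2 * y3)"
    using U y1s y3 by algebra
  then show "d * (u - r1\<^sup>2 * y1\<^sup>2) = 2 * r1 * m\<^sup>2 * y3"
    using nz by (simp only: mult_cancel_left) simp
  have "d * (d * (u - r2\<^sup>2 * y1\<^sup>2)) = d * (- 2 * r2 * m\<^sup>2 * E * y2)"
    using U y1s y2 by algebra
  then show "d * (u - r2\<^sup>2 * y1\<^sup>2) = - 2 * r2 * m\<^sup>2 * E * y2"
    using nz by (simp only: mult_cancel_left) simp
  have "d * (E * d * (v - r2\<^sup>2 * y1\<^sup>2)) = d * (- 2 * r2 * n\<^sup>2 * y3)"
    using V y1s y3 by algebra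
  then show "E * d * (v - r2\<^sup>2 * y1\<^sup>2) = - 2 * r2 * n\<^sup>2 * y3"
    using nz by (simp only: mult_cancel_left) simp
  have "(E * d) * (d * (v - r1\<^sup>2 * y1\<^sup>2)) = (E * d) * (2 * r1 * n\<^sup>2 * y2)"
    using V y1s y2 by algebra
  then show "d * (v - r1\<^sup>2 * y1\<^sup>2) = 2 * r1 * n\<^sup>2 * y2"
    using nz by (simp only: mult_cancel_left) simp
qed

definition on_member :: "complex \<Rightarrow> complex \<Rightarrow> complex \<Rightarrow> complex \<Rightarrow> complex \<Rightarrow> complex \<Rightarrow> complex \<Rightarrow> complex \<Rightarrow> complex \<Rightarrow> bool" where
  "on_member r1 r2 c E y1 y2 y3 u v \<longleftrightarrow>
     c\<^sup>2 * (r1 * E * y2 + r2 * y3) * (r2 * E * y2 + r1 * y3) = E * y1\<^sup>2 \<and>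
     u * E = r1 * r2 * c\<^sup>2 * (r1 * E * y2 + r2 * y3)\<^sup>2 \<and>
     v * E = r1 * r2 * c\<^sup>2 * (r2 * E * y2 + r1 * y3)\<^sup>2"

text \<open>Exchanging r1 and r2 exchanges p with q and hence u with v; statements about v thus
  follow from those about u.\<close>

lemma on_member_swap:
  "on_member r1 r2 c E y1 y2 y3 u v \<longleftrightarrow> on_member r2 r1 c E y1 y2 y3 v u"
  by (auto simp: on_member_def mult_ac)

text \<open>On the parametrized surface d (u - r1^2 y1^2) = 2 r1 m^2 y3 and d^2 u = -2 r1 r2 E m^4;
  eliminating m gives the formula for E in the hypothesis. Here it is shown that, conversely, a
  point with this value of E lies on the corresponding member.\<close>

lemma on_member_first_chart:
  fixes r1 r2 c d E y1 y2 y3 u v :: complex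
  assumes nz: "r1 \<noteq> 0" "r2 \<noteq> 0" "d \<noteq> 0" and c: "c\<^sup>2 * d\<^sup>2 = -2" and d: "d = r1\<^sup>2 - r2\<^sup>2"
    and uv: "u * v = r1\<^sup>2 * r2\<^sup>2 * y1 ^ 4"
    and y23: "2 * y2 * y3 = u + v - (r1\<^sup>2 + r2\<^sup>2) * y1\<^sup>2"
    and A: "u - r1\<^sup>2 * y1\<^sup>2 \<noteq> 0"
    and E: "E * (r2 * (u - r1\<^sup>2 * y1\<^sup>2)\<^sup>2) = - 2 * r1 * u * y3\<^sup>2" "E \<noteq> 0"
  shows "on_member r1 r2 c E y1 y2 y3 u v"
proof -
  define a where "a = u - r1\<^sup>2 * y1\<^sup>2"
  have a: "a \<noteq> 0" using A a_def by simp
  have Ea: "E * r2 * a\<^sup>2 = - 2 * r1 * u * y3\<^sup>2" using E(1) by (simp add: a_def mult.assoc)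
  \<comment> \<open>Multiplying the expression for 2 y2 y3 by u and replacing u v gives a quadratic
    polynomial in u with the roots r1^2 y1^2 and r2^2 y1^2.\<close>
  have key: "2 * u * y2 * y3 = a * (u - r2\<^sup>2 * y1\<^sup>2)"
    unfolding a_def using uv y23 by algebra
  have "a * (E * r2 * y2 * a) = a * (- r1 * y3 * (u - r2\<^sup>2 * y1\<^sup>2))"
    using Ea key by algebra
  then have lin: "E * r2 * y2 * a = - r1 * y3 * (u - r2\<^sup>2 * y1\<^sup>2)"
    using a by (simp only: mult_cancel_left) simp
  have pa: "r2 * (r1 * E * y2 + r2 * y3) * a = - d * u * y3"
    using lin unfolding a_def d by algebra
  have qa: "(r2 * E * y2 + r1 * y3) * a = - d * r1 * y1\<^sup>2 * y3"
    using lin unfolding a_def d by algebra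
  have "r2 * a\<^sup>2 * d\<^sup>2 * (c\<^sup>2 * (r1 * E * y2 + r2 * y3) * (r2 * E * y2 + r1 * y3)) = r2 * a\<^sup>2 * d\<^sup>2 * (E * y1\<^sup>2)"
    using pa qa Ea c by algebra
  then have 1: "c\<^sup>2 * (r1 * E * y2 + r2 * y3) * (r2 * E * y2 + r1 * y3) = E * y1\<^sup>2"
    using nz a by (simp only: mult_cancel_left) simp
  have "r2\<^sup>2 * a\<^sup>2 * d\<^sup>2 * (u * E) = r2\<^sup>2 * a\<^sup>2 * d\<^sup>2 * (r1 * r2 * c\<^sup>2 * (r1 * E * y2 + r2 * y3)\<^sup>2)"
    using pa Ea c by algebra
  then have 2: "u * E = r1 * r2 * c\<^sup>2 * (r1 * E * y2 + r2 * y3)\<^sup>2"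
    using nz a by (simp only: mult_cancel_left) simp
  have "r2 * a\<^sup>2 * d\<^sup>2 * (v * E) = r2 * a\<^sup>2 * d\<^sup>2 * (r1 * r2 * c\<^sup>2 * (r2 * E * y2 + r1 * y3)\<^sup>2)"
    using qa Ea c uv by algebra
  then have 3: "v * E = r1 * r2 * c\<^sup>2 * (r2 * E * y2 + r1 * y3)\<^sup>2"
    using nz a by (simp only: mult_cancel_left) simp
  show ?thesis using 1 2 3 by (simp add: on_member_def)
qed

text \<open>The same elimination, starting from d (u - r2^2 y1^2) = -2 r2 m^2 E y2, expresses E by
  y2 instead of y3.\<close>

lemma on_member_second_chart:
  fixes r1 r2 c d E y1 y2 y3 u v :: complex
  assumes nz: "r1 \<noteq> 0" "r2 \<noteq> 0" "d \<noteq> 0" and c: "c\<^sup>2 * d\<^sup>2 = -2" and d: "d = r1\<^sup>2 - r2\<^sup>2"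
    and uv: "u * v = r1\<^sup>2 * r2\<^sup>2 * y1 ^ 4"
    and y23: "2 * y2 * y3 = u + v - (r1\<^sup>2 + r2\<^sup>2) * y1\<^sup>2"
    and A: "u \<noteq> 0" "y2 \<noteq> 0"
    and E: "E * (2 * r2 * u * y2\<^sup>2) = - r1 * (u - r2\<^sup>2 * y1\<^sup>2)\<^sup>2" "E \<noteq> 0"
  shows "on_member r1 r2 c E y1 y2 y3 u v"
proof -
  define b where "b = u - r2\<^sup>2 * y1\<^sup>2"
  have Eb: "E * 2 * r2 * u * y2\<^sup>2 = - r1 * b\<^sup>2" using E(1) by (simp add: b_def mult_ac)
  have key: "2 * u * y2 * y3 = (u - r1\<^sup>2 * y1\<^sup>2) * b"
    unfolding b_def using uv y23 by algebra
  have pa: "2 * u * y2 * (r2 * (r1 * E * y2 + r2 * y3)) = - d * u * b"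
    using Eb key unfolding b_def d by algebra
  have qa: "2 * u * y2 * (r2 * E * y2 + r1 * y3) = - r1 * d * y1\<^sup>2 * b"
    using Eb key unfolding b_def d by algebra
  have pa': "2 * y2 * (r2 * (r1 * E * y2 + r2 * y3)) = - d * b"
  proof -
    have "u * (2 * y2 * (r2 * (r1 * E * y2 + r2 * y3))) = u * (- d * b)" using pa by algebra
    then show ?thesis using A(1) by (simp only: mult_cancel_left) simp
  qed
  have "4 * r2 * u * y2\<^sup>2 * d\<^sup>2 * (c\<^sup>2 * (r1 * E * y2 + r2 * y3) * (r2 * E * y2 + r1 * y3)) = 4 * r2 * u * y2\<^sup>2 * d\<^sup>2 * (E * y1\<^sup>2)"
    using pa' qa Eb c by algebra
  then have 1: "c\<^sup>2 * (r1 * E * y2 + r2 * y3) * (r2 * E * y2 + r1 * y3) = E * y1\<^sup>2"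
    using nz A by (simp only: mult_cancel_left) simp
  have "4 * r2\<^sup>2 * y2\<^sup>2 * d\<^sup>2 * (u * E) = 4 * r2\<^sup>2 * y2\<^sup>2 * d\<^sup>2 * (r1 * r2 * c\<^sup>2 * (r1 * E * y2 + r2 * y3)\<^sup>2)"
    using pa' Eb c by algebra
  then have 2: "u * E = r1 * r2 * c\<^sup>2 * (r1 * E * y2 + r2 * y3)\<^sup>2"
    using nz A by (simp only: mult_cancel_left) simp
  have "4 * u\<^sup>2 * y2\<^sup>2 * d\<^sup>2 * (r2 * (v * E)) = 4 * u\<^sup>2 * y2\<^sup>2 * d\<^sup>2 * (r2 * (r1 * r2 * c\<^sup>2 * (r2 * E * y2 + r1 * y3)\<^sup>2))"
    using qa Eb c uv by algebra
  then have 3: "v * E = r1 * r2 * c\<^sup>2 * (r2 * E * y2 + r1 * y3)\<^sup>2"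
    using nz A by (simp only: mult_cancel_left) simp
  show ?thesis using 1 2 3 by (simp add: on_member_def)
qed

text \<open>The forms p and q determine only m^2 and n^2; the two signs are tied together by y1 = c
  m n.\<close>

lemma on_member_parametrized:
  fixes r1 r2 c d E y1 y2 y3 t u v :: complex
  assumes nz: "E \<noteq> 0" "d \<noteq> 0" and c: "c\<^sup>2 * d\<^sup>2 = -2" and d: "d = r1\<^sup>2 - r2\<^sup>2"
    and u: "2 * u = 2 * y2 * y3 + (r1\<^sup>2 + r2\<^sup>2) * y1\<^sup>2 + 2 * t"
    and v: "2 * v = 2 * y2 * y3 + (r1\<^sup>2 + r2\<^sup>2) * y1\<^sup>2 - 2 * t"
    and mem: "on_member r1 r2 c E y1 y2 y3 u v"
  obtains m n where "y1 = c * m * n" "E * d * y2 = E * r1 * m\<^sup>2 - r2 * n\<^sup>2"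
    "d * y3 = r1 * n\<^sup>2 - E * r2 * m\<^sup>2" "E * d\<^sup>2 * t = - (r1 * r2) * (E\<^sup>2 * m ^ 4 - n ^ 4)"
    "r1 * E * y2 + r2 * y3 = E * m\<^sup>2" "r2 * E * y2 + r1 * y3 = n\<^sup>2"
proof -
  define p q where "p = r1 * E * y2 + r2 * y3" and "q = r2 * E * y2 + r1 * y3"
  have R: "c\<^sup>2 * p * q = E * y1\<^sup>2" "u * E = r1 * r2 * c\<^sup>2 * p\<^sup>2" "v * E = r1 * r2 * c\<^sup>2 * q\<^sup>2"
    using mem by (auto simp: on_member_def p_def q_def)
  have c0: "c \<noteq> 0" using c by auto
  obtain m n where mn: "E * m\<^sup>2 = p" "n\<^sup>2 = q" "y1 = c * m * n"
  proof (cases "p = 0")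
    case True
    then have "y1 = 0" using R(1) nz by simp
    then show ?thesis using that [of 0 "csqrt q"] True by simp
  next
    case False
    define m where "m = csqrt (p / E)"
    have m: "E * m\<^sup>2 = p" "m \<noteq> 0" using nz False by (auto simp: m_def)
    \<comment> \<open>Not a square root of q: this choice has the sign required by y1 = c m n, and
      n^2 = q then follows from the equation of the conic.\<close>
    define n where "n = y1 / (c * m)"
    have "p * (c\<^sup>2 * n\<^sup>2) = p * (c\<^sup>2 * q)"
    proof -
      have n: "c * m * n = y1" using c0 m by (simp add: n_def)
      have "E * m\<^sup>2 * (c\<^sup>2 * n\<^sup>2) = E * y1\<^sup>2" by (simp add: n [symmetric] power_mult_distrib)
      then show ?thesis using m R(1) by algebra
    qed
    with False c0 have n: "n\<^sup>2 = q" by (simp only: mult_cancel_left) simp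
    show ?thesis by (rule that [OF m(1) n]) (use m c0 in \<open>simp add: n_def\<close>)
  qed
  have y23: "E * d * y2 = E * r1 * m\<^sup>2 - r2 * n\<^sup>2" "d * y3 = r1 * n\<^sup>2 - E * r2 * m\<^sup>2"
    using mn(1,2) unfolding p_def q_def d by (algebra, algebra)
  have "2 * (E * d\<^sup>2 * t) = 2 * (- (r1 * r2) * (E\<^sup>2 * m ^ 4 - n ^ 4))"
  proof -
    have "E * (2 * t) = r1 * r2 * c\<^sup>2 * (p\<^sup>2 - q\<^sup>2)" using R(2,3) u v by algebra
    then have "E * d\<^sup>2 * (2 * t) = - 2 * (r1 * r2) * (p\<^sup>2 - q\<^sup>2)" using c by algebra
    then show ?thesis using mn(1,2) by algebra
  qed
  then have t: "E * d\<^sup>2 * t = - (r1 * r2) * (E\<^sup>2 * m ^ 4 - n ^ 4)"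
    by (simp only: mult_cancel_left) simp
  show ?thesis
    by (rule that [OF mn(3) y23 t]) (simp_all only: mn(1,2) p_def q_def)
qed

section \<open>Homogeneous vectors for projective space and for the total space of O(2)\<close>

lemma four_eq_zero: "(4::4) = 0" by simp

lemma all_4_iff: "(\<forall>i::4. P i) \<longleftrightarrow> P 0 \<and> P 1 \<and> P 2 \<and> P 3"
  using forall_4 [of P] by (auto simp: four_eq_zero)

lemma vec4_nth [simp]:
  "vec4 a b c d $ 0 = a" "vec4 a b c d $ 1 = b" "vec4 a b c d $ 2 = c" "vec4 a b c d $ 3 = d"
  by (simp_all add: vec4_def)

lemma pack_nth [simp]: "pack y z $ None = z" "pack y z $ Some i = y $ i"
  by (simp_all add: pack_def)

lemma base_nth [simp]: "base w $ i = w $ Some i"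
  by (simp add: base_def)

lemma base_pack [simp]: "base (pack y z) = y"
  by (simp add: vec_eq_iff)

lemma vec4_eq_iff: "(y::complex ^ 4) = y' \<longleftrightarrow> y $ 0 = y' $ 0 \<and> y $ 1 = y' $ 1 \<and> y $ 2 = y' $ 2 \<and> y $ 3 = y' $ 3"
  by (simp add: vec_eq_iff all_4_iff)

lemma all_4_option: "(\<forall>j::4 option. P j) \<longleftrightarrow> P None \<and> P (Some 0) \<and> P (Some 1) \<and> P (Some 2) \<and> P (Some 3)"
  using all_4_iff [of "\<lambda>i. P (Some i)"] by (metis option.exhaust)

lemma vec5_eq_iff: "(w::complex ^ (4 option)) = w' \<longleftrightarrow> w $ None = w' $ None \<and> w $ Some 0 = w' $ Some 0 \<and>
    w $ Some 1 = w' $ Some 1 \<and> w $ Some 2 = w' $ Some 2 \<and> w $ Some 3 = w' $ Some 3"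
  by (simp add: vec_eq_iff all_4_option)

text \<open>The action with weights 1 and 2 whose orbits of nonzero scalars are the points of the
  total space of O(2).\<close>

definition scl :: "complex \<Rightarrow> complex ^ (4 option) \<Rightarrow> complex ^ (4 option)" where
  "scl t w = pack (t *s base w) (t\<^sup>2 * w $ None)"

lemma scl_nth [simp]: "scl t w $ None = t\<^sup>2 * w $ None" "scl t w $ Some i = t * w $ Some i"
  by (simp_all add: scl_def)

lemma base_scl [simp]: "base (scl t w) = t *s base w"
  by (simp add: scl_def)

lemma scl_1 [simp]: "scl 1 w = w"
  by (simp add: vec5_eq_iff)

lemma scl_scl [simp]: "scl s (scl t w) = scl (s * t) w"
  by (simp add: vec5_eq_iff power_mult_distrib)

lemma O2_pt_scl: "O2_pt w = {scl t w | t. t \<noteq> 0}"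
  by (simp add: O2_pt_def scl_def)

lemma O2_pt_eq_iff: "O2_pt w = O2_pt w' \<longleftrightarrow> (\<exists>t. t \<noteq> 0 \<and> w' = scl t w)"
proof
  assume "O2_pt w = O2_pt w'"
  moreover have "w' \<in> O2_pt w'" unfolding O2_pt_scl by (intro CollectI exI [of _ 1]) simp
  ultimately show "\<exists>t. t \<noteq> 0 \<and> w' = scl t w" unfolding O2_pt_scl by auto
next
  assume "\<exists>t. t \<noteq> 0 \<and> w' = scl t w"
  then obtain t where t: "t \<noteq> 0" "w' = scl t w" by blast
  show "O2_pt w = O2_pt w'"
    unfolding O2_pt_scl t(2)
  proof (intro set_eqI iffI)
    fix v assume "v \<in> {scl s w |s. s \<noteq> 0}"
    then obtain s where "s \<noteq> 0" "v = scl s w" by blast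
    then have "v = scl (s / t) (scl t w)" "s / t \<noteq> 0" using t(1) by (simp_all)
    then show "v \<in> {scl s (scl t w) |s. s \<noteq> 0}" by blast
  next
    fix v assume "v \<in> {scl s (scl t w) |s. s \<noteq> 0}"
    then obtain s where "s \<noteq> 0" "v = scl s (scl t w)" by blast
    then have "v = scl (s * t) w" "s * t \<noteq> 0" using t(1) by (simp_all)
    then show "v \<in> {scl s w |s. s \<noteq> 0}" by blast
  qed
qed

lemma proj_pt_eq_iff: "proj_pt y = proj_pt y' \<longleftrightarrow> (\<exists>t. t \<noteq> 0 \<and> y' = t *s y)"
proof
  assume "proj_pt y = proj_pt y'"
  moreover have "y' \<in> proj_pt y'" unfolding proj_pt_def by (intro CollectI exI [of _ 1]) simp
  ultimately show "\<exists>t. t \<noteq> 0 \<and> y' = t *s y" unfolding proj_pt_def by auto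
next
  assume "\<exists>t. t \<noteq> 0 \<and> y' = t *s y"
  then obtain t where t: "t \<noteq> 0" "y' = t *s y" by blast
  show "proj_pt y = proj_pt y'"
    unfolding proj_pt_def t(2)
  proof (intro set_eqI iffI)
    fix v assume "v \<in> {s *s y |s. s \<noteq> 0}"
    then obtain s where "s \<noteq> 0" "v = s *s y" by blast
    then have "v = (s / t) *s (t *s y)" "s / t \<noteq> 0" using t(1) by (simp_all add: vector_smult_assoc)
    then show "v \<in> {s *s (t *s y) |s. s \<noteq> 0}" by blast
  next
    fix v assume "v \<in> {s *s (t *s y) |s. s \<noteq> 0}"
    then obtain s where "s \<noteq> 0" "v = s *s (t *s y)" by blast
    then have "v = (s * t) *s y" "s * t \<noteq> 0" using t(1) by (simp_all add: vector_smult_assoc)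
    then show "v \<in> {s *s y |s. s \<noteq> 0}" by blast
  qed
qed

lemma \<Phi>0_O2_pt: "\<Phi>0 (O2_pt w) = proj_pt (base w)"
proof -
  have "base ` {scl t w |t. t \<noteq> 0} = {base (scl t w) |t. t \<noteq> 0}" by blast
  then show ?thesis by (simp add: \<Phi>0_def O2_pt_scl proj_pt_def)
qed

lemma open_component_ne: "open {w :: complex ^ 'n. w $ i \<noteq> 0}"
  by (intro open_Collect_neq continuous_intros)

lemma open_base_nonzero: "open {w. base w \<noteq> 0}"
proof -
  have "{w. base w \<noteq> 0} = {w. w $ Some 0 \<noteq> 0} \<union> {w. w $ Some 1 \<noteq> 0} \<union> {w. w $ Some 2 \<noteq> 0} \<union> {w. w $ Some 3 \<noteq> 0}"
    by (auto simp: vec4_eq_iff)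
  then show ?thesis using open_component_ne by (metis open_Un)
qed

lemma open_holo_nonzero:
  assumes "holo_on f U" "open U" shows "open {x \<in> U. f x \<noteq> 0}"
  using continuous_open_preimage [OF holo_on_imp_continuous_on [OF assms(1)] assms(2), of "- {0}"]
  by (simp add: vimage_def Int_def open_Compl)

text \<open>The action on parameters (E, m, n): E is fixed and (m, n) is scaled, so the quotient is
  a product with a projective line.\<close>

definition scl3 :: "complex \<Rightarrow> complex ^ 3 \<Rightarrow> complex ^ 3" where
  "scl3 s x = vector [x $ 1, s * x $ 2, s * x $ 3]"

lemma scl3_nth [simp]: "scl3 s x $ 1 = x $ 1" "scl3 s x $ 2 = s * x $ 2" "scl3 s x $ 3 = s * x $ 3"
  by (simp_all add: scl3_def)

lemma vec3_eq_iff: "(x::complex ^ 3) = y \<longleftrightarrow> x $ 1 = y $ 1 \<and> x $ 2 = y $ 2 \<and> x $ 3 = y $ 3"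
  by (simp add: vec_eq_iff forall_3)

lemma holo_map_vector_3:
  assumes "holo_on f U" "holo_on g U" "holo_on h U"
  shows "holo_map (\<lambda>x. vector [f x, g x, h x] :: complex ^ 3) U"
  using assms unfolding holo_map_def forall_3 by simp

section \<open>The conic bundle in homogeneous coordinates: parametrization and local
  inverse\<close>

locale conic_family =
  fixes r1 r2 c d l :: complex
  assumes nz: "r1 \<noteq> 0" "r2 \<noteq> 0" "d \<noteq> 0" and cd: "c\<^sup>2 * d\<^sup>2 = -2" and d: "d = r1\<^sup>2 - r2\<^sup>2"
begin

text \<open>The linear system p = E m^2, q = n^2 for y2, y3 has the determinant E d, and Cramer's
  rule gives the two fractions. The last entry is z = (u - v) / (2 i) with E u = s c^2 p^2 and E v =
  s c^2 q^2.\<close>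

definition psi :: "complex ^ 3 \<Rightarrow> complex ^ (4 option)" where
  "psi x = pack (vec4 (l * (c * x $ 2 * x $ 3)) (c * x $ 2 * x $ 3)
       ((x $ 1 * r1 * (x $ 2)\<^sup>2 - r2 * (x $ 3)\<^sup>2) / (x $ 1 * d))
       ((r1 * (x $ 3)\<^sup>2 - x $ 1 * r2 * (x $ 2)\<^sup>2) / d))
     (\<i> * (r1 * r2) * ((x $ 1)\<^sup>2 * x $ 2 ^ 4 - x $ 3 ^ 4) / (x $ 1 * d\<^sup>2))"

definition uf :: "complex ^ (4 option) \<Rightarrow> complex" where
  "uf w = w $ Some 2 * w $ Some 3 + (r1\<^sup>2 + r2\<^sup>2) / 2 * (w $ Some 1)\<^sup>2 + \<i> * w $ None"

definition vf :: "complex ^ (4 option) \<Rightarrow> complex" where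
  "vf w = w $ Some 2 * w $ Some 3 + (r1\<^sup>2 + r2\<^sup>2) / 2 * (w $ Some 1)\<^sup>2 - \<i> * w $ None"

definition cone :: "(complex ^ (4 option)) set" where
  "cone = {w. base w \<noteq> 0 \<and> w $ Some 0 = l * w $ Some 1 \<and> uf w * vf w = r1\<^sup>2 * r2\<^sup>2 * w $ Some 1 ^ 4}"

definition params :: "(complex ^ 3) set" where
  "params = {x. x $ 1 \<noteq> 0 \<and> (x $ 2 \<noteq> 0 \<or> x $ 3 \<noteq> 0)}"

definition pf :: "complex \<Rightarrow> complex ^ (4 option) \<Rightarrow> complex" where
  "pf E w = r1 * E * w $ Some 2 + r2 * w $ Some 3"

definition qf :: "complex \<Rightarrow> complex ^ (4 option) \<Rightarrow> complex" where
  "qf E w = r2 * E * w $ Some 2 + r1 * w $ Some 3"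

definition member :: "complex \<Rightarrow> complex ^ (4 option) \<Rightarrow> bool" where
  "member E w \<longleftrightarrow> on_member r1 r2 c E (w $ Some 1) (w $ Some 2) (w $ Some 3) (uf w) (vf w)"

lemma c_nz: "c \<noteq> 0" using cd by auto

lemma open_params: "open params"
proof -
  have "params = {x. x $ 1 \<noteq> 0} \<inter> ({x. x $ 2 \<noteq> 0} \<union> {x. x $ 3 \<noteq> 0})"
    by (auto simp: params_def)
  then show ?thesis using open_component_ne by (metis open_Int open_Un)
qed

lemma holo_map_psi: "holo_map psi params"
  unfolding holo_map_def all_4_option psi_def pack_nth vec4_nth
  by (intro conjI holo_on_divide holo_on_diff holo_on_mult holo_on_power holo_on_const holo_on_component)
     (use nz in \<open>auto simp: params_def\<close>)

lemma psi_components: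
  assumes "x $ 1 \<noteq> 0"
  shows "psi x $ Some 0 = l * psi x $ Some 1" "psi x $ Some 1 = c * x $ 2 * x $ 3"
    "x $ 1 * d * psi x $ Some 2 = x $ 1 * r1 * (x $ 2)\<^sup>2 - r2 * (x $ 3)\<^sup>2"
    "d * psi x $ Some 3 = r1 * (x $ 3)\<^sup>2 - x $ 1 * r2 * (x $ 2)\<^sup>2"
    "x $ 1 * d\<^sup>2 * (\<i> * psi x $ None) = - (r1 * r2) * ((x $ 1)\<^sup>2 * x $ 2 ^ 4 - x $ 3 ^ 4)"
  using nz assms by (simp_all add: psi_def mult.assoc)

lemma psi_eqI:
  assumes "x $ 1 \<noteq> 0" "w $ Some 0 = l * w $ Some 1" "w $ Some 1 = c * x $ 2 * x $ 3"
    "x $ 1 * d * w $ Some 2 = x $ 1 * r1 * (x $ 2)\<^sup>2 - r2 * (x $ 3)\<^sup>2"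
    "d * w $ Some 3 = r1 * (x $ 3)\<^sup>2 - x $ 1 * r2 * (x $ 2)\<^sup>2"
    "x $ 1 * d\<^sup>2 * (\<i> * w $ None) = - (r1 * r2) * ((x $ 1)\<^sup>2 * x $ 2 ^ 4 - x $ 3 ^ 4)"
  shows "w = psi x"
proof -
  note p = psi_components [OF assms(1)]
  have "x $ 1 * d * w $ Some 2 = x $ 1 * d * psi x $ Some 2" unfolding p assms ..
  moreover have "d * w $ Some 3 = d * psi x $ Some 3" unfolding p assms ..
  moreover have "x $ 1 * d\<^sup>2 * (\<i> * w $ None) = x $ 1 * d\<^sup>2 * (\<i> * psi x $ None)" unfolding p assms ..
  ultimately show ?thesis
    using nz assms(1-3) p(1,2) by (simp add: vec5_eq_iff)
qed

lemma two_uf: "2 * uf w = 2 * w $ Some 2 * w $ Some 3 + (r1\<^sup>2 + r2\<^sup>2) * (w $ Some 1)\<^sup>2 + 2 * (\<i> * w $ None)"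
  and two_vf: "2 * vf w = 2 * w $ Some 2 * w $ Some 3 + (r1\<^sup>2 + r2\<^sup>2) * (w $ Some 1)\<^sup>2 - 2 * (\<i> * w $ None)"
  by (simp_all add: uf_def vf_def algebra_simps)

lemma uv_sum: "2 * w $ Some 2 * w $ Some 3 = uf w + vf w - (r1\<^sup>2 + r2\<^sup>2) * (w $ Some 1)\<^sup>2"
  by (simp add: uf_def vf_def)

lemmas psi_relations = rational_parametrization_relations
  [OF _ nz(3) cd d psi_components(2-5) two_uf two_vf, folded pf_def qf_def]

lemma psi_coordinate_nonzero:
  assumes "x \<in> params" shows "psi x $ Some 2 \<noteq> 0 \<or> psi x $ Some 3 \<noteq> 0"
proof (rule ccontr)
  assume "\<not> ?thesis"
  then have z: "psi x $ Some 2 = 0" "psi x $ Some 3 = 0" by auto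
  have x1: "x $ 1 \<noteq> 0" using assms by (simp add: params_def)
  have "x $ 1 * (x $ 2)\<^sup>2 = 0" "(x $ 3)\<^sup>2 = 0"
    using psi_relations(4,5)[OF x1 x1 x1 x1 x1] z by (auto simp: pf_def qf_def)
  then show False using assms by (auto simp: params_def)
qed

lemma psi_in_cone: "x \<in> params \<Longrightarrow> psi x \<in> cone"
proof -
  assume x: "x \<in> params"
  then have x1: "x $ 1 \<noteq> 0" by (simp add: params_def)
  have "base (psi x) \<noteq> 0"
    using psi_coordinate_nonzero [OF x] by (auto simp: vec4_eq_iff)
  then show ?thesis
    using psi_relations(3)[OF x1 x1 x1 x1 x1] psi_components(1)[OF x1] by (simp add: cone_def)
qed

text \<open>The base coordinates are quadratic in (m, n) and z is quartic, which matches the weights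
  1 and 2 for the factor s^2.\<close>

lemma psi_scl3: "x $ 1 \<noteq> 0 \<Longrightarrow> psi (scl3 s x) = scl (s\<^sup>2) (psi x)"
  using nz by (simp add: vec5_eq_iff psi_def power_mult_distrib power2_eq_square power4_eq_xxxx field_simps)

end

context conic_family
begin

lemma uf_scl [simp]: "uf (scl t w) = t\<^sup>2 * uf w" and vf_scl [simp]: "vf (scl t w) = t\<^sup>2 * vf w"
  by (simp_all add: uf_def vf_def algebra_simps power2_eq_square)

lemma pf_scl [simp]: "pf E (scl t w) = t * pf E w" and qf_scl [simp]: "qf E (scl t w) = t * qf E w"
  by (simp_all add: pf_def qf_def algebra_simps)

lemma holo_on_uf [intro!]: "holo_on uf U" and holo_on_vf [intro!]: "holo_on vf U"
  unfolding uf_def[abs_def] vf_def[abs_def] by auto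

text \<open>A quotient \<open>B / A\<close> of quartic forms recovering the parameter of the pencil.\<close>

definition slope :: "(complex ^ (4 option) \<Rightarrow> complex) \<Rightarrow> (complex ^ (4 option) \<Rightarrow> complex) \<Rightarrow> bool" where
  "slope A B \<longleftrightarrow> holo_on A UNIV \<and> holo_on B UNIV \<and>
     (\<forall>t w. A (scl t w) = t ^ 4 * A w \<and> B (scl t w) = t ^ 4 * B w) \<and>
     (\<forall>x\<in>params. x $ 1 * A (psi x) = B (psi x)) \<and>
     (\<forall>w\<in>cone. \<forall>E. A w \<noteq> 0 \<longrightarrow> E \<noteq> 0 \<longrightarrow> E * A w = B w \<longrightarrow> member E w)"

text \<open>E is recovered by two formulas in u and two in v; the latter arise by exchanging r1 with
  r2 and d with -d. Each denominator vanishes somewhere on every member, so one formula would not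
  suffice.\<close>

lemma
  shows slope1: "slope (\<lambda>w. r2 * (uf w - r1\<^sup>2 * (w $ Some 1)\<^sup>2)\<^sup>2) (\<lambda>w. - 2 * r1 * uf w * (w $ Some 3)\<^sup>2)"
    and slope2: "slope (\<lambda>w. 2 * r2 * uf w * (w $ Some 2)\<^sup>2) (\<lambda>w. - r1 * (uf w - r2\<^sup>2 * (w $ Some 1)\<^sup>2)\<^sup>2)"
    and slope3: "slope (\<lambda>w. r1 * (vf w - r2\<^sup>2 * (w $ Some 1)\<^sup>2)\<^sup>2) (\<lambda>w. - 2 * r2 * vf w * (w $ Some 3)\<^sup>2)"
    and slope4: "slope (\<lambda>w. 2 * r1 * vf w * (w $ Some 2)\<^sup>2) (\<lambda>w. - r2 * (vf w - r1\<^sup>2 * (w $ Some 1)\<^sup>2)\<^sup>2)"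
proof -
  have cd': "c\<^sup>2 * (- d)\<^sup>2 = -2" using cd by simp
  have d': "- d = r2\<^sup>2 - r1\<^sup>2" using d by simp
  have uv: "uf w * vf w = r1\<^sup>2 * r2\<^sup>2 * w $ Some 1 ^ 4" if "w \<in> cone" for w
    using that by (simp add: cone_def)
  have vu: "vf w * uf w = r2\<^sup>2 * r1\<^sup>2 * w $ Some 1 ^ 4" if "w \<in> cone" for w
    using uv [OF that] by (simp add: mult_ac)
  have vu_sum: "2 * w $ Some 2 * w $ Some 3 = vf w + uf w - (r2\<^sup>2 + r1\<^sup>2) * (w $ Some 1)\<^sup>2" for w
    using uv_sum [of w] by (simp add: add.commute)
  {
    fix x :: "complex ^ 3" assume "x \<in> params"
    then have x1: "x $ 1 \<noteq> 0" by (simp add: params_def)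
    define u v y1 y2 y3 where "u = uf (psi x)" and "v = vf (psi x)" and "y1 = psi x $ Some 1"
      and "y2 = psi x $ Some 2" and "y3 = psi x $ Some 3"
    note R = psi_relations [OF x1 x1 x1 x1 x1, folded u_def v_def y1_def y2_def y3_def]
    have "d\<^sup>2 * (x $ 1 * (r2 * (u - r1\<^sup>2 * y1\<^sup>2)\<^sup>2)) = d\<^sup>2 * (- 2 * r1 * u * y3\<^sup>2)"
    proof -
      have "d\<^sup>2 * (x $ 1 * (r2 * (u - r1\<^sup>2 * y1\<^sup>2)\<^sup>2)) = x $ 1 * r2 * (d * (u - r1\<^sup>2 * y1\<^sup>2))\<^sup>2" by algebra
      also have "\<dots> = - 2 * r1 * y3\<^sup>2 * (- 2 * r1 * r2 * x $ 1 * x $ 2 ^ 4)" unfolding R(6) by algebra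
      also have "\<dots> = d\<^sup>2 * (- 2 * r1 * u * y3\<^sup>2)" unfolding R(1)[symmetric] by algebra
      finally show ?thesis .
    qed
    with nz have 1: "x $ 1 * (r2 * (u - r1\<^sup>2 * y1\<^sup>2)\<^sup>2) = - 2 * r1 * u * y3\<^sup>2"
      by (simp only: mult_cancel_left) simp
    have "d\<^sup>2 * (x $ 1 * (2 * r2 * u * y2\<^sup>2)) = d\<^sup>2 * (- r1 * (u - r2\<^sup>2 * y1\<^sup>2)\<^sup>2)"
    proof -
      have "d\<^sup>2 * (x $ 1 * (2 * r2 * u * y2\<^sup>2)) = x $ 1 * 2 * r2 * y2\<^sup>2 * (d\<^sup>2 * u)" by algebra
      also have "\<dots> = - r1 * (- 2 * r2 * (x $ 2)\<^sup>2 * x $ 1 * y2)\<^sup>2" unfolding R(1) by algebra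
      also have "\<dots> = d\<^sup>2 * (- r1 * (u - r2\<^sup>2 * y1\<^sup>2)\<^sup>2)" unfolding R(7)[symmetric] by algebra
      finally show ?thesis .
    qed
    with nz have 2: "x $ 1 * (2 * r2 * u * y2\<^sup>2) = - r1 * (u - r2\<^sup>2 * y1\<^sup>2)\<^sup>2"
      by (simp only: mult_cancel_left) simp
    have "x $ 1 * d\<^sup>2 * (x $ 1 * (r1 * (v - r2\<^sup>2 * y1\<^sup>2)\<^sup>2)) = x $ 1 * d\<^sup>2 * (- 2 * r2 * v * y3\<^sup>2)"
    proof -
      have "x $ 1 * d\<^sup>2 * (x $ 1 * (r1 * (v - r2\<^sup>2 * y1\<^sup>2)\<^sup>2)) = r1 * (x $ 1 * d * (v - r2\<^sup>2 * y1\<^sup>2))\<^sup>2" by algebra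
      also have "\<dots> = - 2 * r2 * y3\<^sup>2 * (- 2 * r1 * r2 * x $ 3 ^ 4)" unfolding R(8) by algebra
      also have "\<dots> = x $ 1 * d\<^sup>2 * (- 2 * r2 * v * y3\<^sup>2)" unfolding R(2)[symmetric] by algebra
      finally show ?thesis .
    qed
    with nz x1 have 3: "x $ 1 * (r1 * (v - r2\<^sup>2 * y1\<^sup>2)\<^sup>2) = - 2 * r2 * v * y3\<^sup>2"
      by (simp only: mult_cancel_left) simp
    have "d\<^sup>2 * (x $ 1 * (2 * r1 * v * y2\<^sup>2)) = d\<^sup>2 * (- r2 * (v - r1\<^sup>2 * y1\<^sup>2)\<^sup>2)"
    proof -
      have "d\<^sup>2 * (x $ 1 * (2 * r1 * v * y2\<^sup>2)) = 2 * r1 * y2\<^sup>2 * (x $ 1 * d\<^sup>2 * v)" by algebra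
      also have "\<dots> = - r2 * (2 * r1 * (x $ 3)\<^sup>2 * y2)\<^sup>2" unfolding R(2) by algebra
      also have "\<dots> = d\<^sup>2 * (- r2 * (v - r1\<^sup>2 * y1\<^sup>2)\<^sup>2)" unfolding R(9)[symmetric] by algebra
      finally show ?thesis .
    qed
    with nz have 4: "x $ 1 * (2 * r1 * v * y2\<^sup>2) = - r2 * (v - r1\<^sup>2 * y1\<^sup>2)\<^sup>2"
      by (simp only: mult_cancel_left) simp
    note 1 [unfolded u_def v_def y1_def y2_def y3_def] 2 [unfolded u_def v_def y1_def y2_def y3_def]
      3 [unfolded u_def v_def y1_def y2_def y3_def] 4 [unfolded u_def v_def y1_def y2_def y3_def]
  } note rel = this
  show "slope (\<lambda>w. r2 * (uf w - r1\<^sup>2 * (w $ Some 1)\<^sup>2)\<^sup>2) (\<lambda>w. - 2 * r1 * uf w * (w $ Some 3)\<^sup>2)"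
    unfolding slope_def
  proof (intro conjI ballI allI impI)
    show "member E w" if "w \<in> cone" "r2 * (uf w - r1\<^sup>2 * (w $ Some 1)\<^sup>2)\<^sup>2 \<noteq> 0" "E \<noteq> 0"
        "E * (r2 * (uf w - r1\<^sup>2 * (w $ Some 1)\<^sup>2)\<^sup>2) = - 2 * r1 * uf w * (w $ Some 3)\<^sup>2" for E w
      unfolding member_def
      by (rule on_member_first_chart [OF nz cd d uv [OF that(1)] uv_sum _ that(4,3)]) (use that(2) in auto)
  qed (erule rel(1) | force simp: algebra_simps power2_eq_square power4_eq_xxxx)+
  show "slope (\<lambda>w. 2 * r2 * uf w * (w $ Some 2)\<^sup>2) (\<lambda>w. - r1 * (uf w - r2\<^sup>2 * (w $ Some 1)\<^sup>2)\<^sup>2)"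
    unfolding slope_def
  proof (intro conjI ballI allI impI)
    show "member E w" if "w \<in> cone" "2 * r2 * uf w * (w $ Some 2)\<^sup>2 \<noteq> 0" "E \<noteq> 0"
        "E * (2 * r2 * uf w * (w $ Some 2)\<^sup>2) = - r1 * (uf w - r2\<^sup>2 * (w $ Some 1)\<^sup>2)\<^sup>2" for E w
      unfolding member_def
      by (rule on_member_second_chart [OF nz cd d uv [OF that(1)] uv_sum _ _ that(4,3)]) (use that(2) in auto)
  qed (erule rel(2) | force simp: algebra_simps power2_eq_square power4_eq_xxxx)+
  show "slope (\<lambda>w. r1 * (vf w - r2\<^sup>2 * (w $ Some 1)\<^sup>2)\<^sup>2) (\<lambda>w. - 2 * r2 * vf w * (w $ Some 3)\<^sup>2)"
    unfolding slope_def
  proof (intro conjI ballI allI impI)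
    show "member E w" if "w \<in> cone" "r1 * (vf w - r2\<^sup>2 * (w $ Some 1)\<^sup>2)\<^sup>2 \<noteq> 0" "E \<noteq> 0"
        "E * (r1 * (vf w - r2\<^sup>2 * (w $ Some 1)\<^sup>2)\<^sup>2) = - 2 * r2 * vf w * (w $ Some 3)\<^sup>2" for E w
      unfolding member_def on_member_swap [of r1]
      by (rule on_member_first_chart [OF nz(2,1) _ cd' d' vu [OF that(1)] vu_sum _ that(4,3)])
         (use that(2) nz in auto)
  qed (erule rel(3) | force simp: algebra_simps power2_eq_square power4_eq_xxxx)+
  show "slope (\<lambda>w. 2 * r1 * vf w * (w $ Some 2)\<^sup>2) (\<lambda>w. - r2 * (vf w - r1\<^sup>2 * (w $ Some 1)\<^sup>2)\<^sup>2)"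
    unfolding slope_def
  proof (intro conjI ballI allI impI)
    show "member E w" if "w \<in> cone" "2 * r1 * vf w * (w $ Some 2)\<^sup>2 \<noteq> 0" "E \<noteq> 0"
        "E * (2 * r1 * vf w * (w $ Some 2)\<^sup>2) = - r2 * (vf w - r1\<^sup>2 * (w $ Some 1)\<^sup>2)\<^sup>2" for E w
      unfolding member_def on_member_swap [of r1]
      by (rule on_member_second_chart [OF nz(2,1) _ cd' d' vu [OF that(1)] vu_sum _ _ that(4,3)])
         (use that(2) nz in auto)
  qed (erule rel(4) | force simp: algebra_simps power2_eq_square power4_eq_xxxx)+
qed

text \<open>On the image of \<open>psi\<close> the four denominators vanish exactly where m y3, m
  y2, n y3 and n y2 vanish, respectively. Since (m, n) and (y2, y3) are both nonzero, one of the
  denominators survives.\<close>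

lemma slope_exists:
  assumes x: "x \<in> params"
  obtains A B where "slope A B" "A (psi x) \<noteq> 0" "B (psi x) \<noteq> 0"
proof -
  have x1: "x $ 1 \<noteq> 0" and mn: "x $ 2 \<noteq> 0 \<or> x $ 3 \<noteq> 0" using x by (auto simp: params_def)
  note R = psi_relations [OF x1 x1 x1 x1 x1]
  have "\<exists>A B. slope A B \<and> A (psi x) \<noteq> 0"
  proof (cases "psi x $ Some 3 = 0")
    case False
    show ?thesis
    proof (cases "x $ 2 = 0")
      case x2: False
      have "uf (psi x) - r1\<^sup>2 * (psi x $ Some 1)\<^sup>2 \<noteq> 0"
        using R(6) nz x2 False by auto
      then show ?thesis using slope1 nz by fastforce
    next
      case True
      then have "vf (psi x) - r2\<^sup>2 * (psi x $ Some 1)\<^sup>2 \<noteq> 0"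
        using R(8) nz mn False by auto
      then show ?thesis using slope3 nz by fastforce
    qed
  next
    case True
    then have y2: "psi x $ Some 2 \<noteq> 0" using psi_coordinate_nonzero [OF x] by blast
    show ?thesis
    proof (cases "x $ 2 = 0")
      case x2: False
      have "uf (psi x) \<noteq> 0"
        using R(1) nz x2 x1 by auto
      then show ?thesis using slope2 nz y2 by fastforce
    next
      case True
      then have "vf (psi x) \<noteq> 0"
        using R(2) nz mn by auto
      then show ?thesis using slope4 nz y2 by fastforce
    qed
  qed
  then obtain A B where AB: "slope A B" "A (psi x) \<noteq> 0" by blast
  then have "x $ 1 * A (psi x) = B (psi x)" using x by (auto simp: slope_def)
  then have "B (psi x) \<noteq> 0" using AB x1 by auto
  then show ?thesis using AB that by blast
qed

text \<open>E is a quotient of two forms of the same degree, hence unaffected by scaling. Then m^2,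
  n^2 and m n are all multiplied by t, so (m, n) is multiplied by a square root of t.\<close>

lemma psi_inj:
  assumes x: "x \<in> params" and y: "y \<in> params" and eq: "psi y = scl t (psi x)" and t: "t \<noteq> 0"
  shows "x $ 1 = y $ 1 \<and> (\<exists>s. s \<noteq> 0 \<and> y = scl3 s x)"
proof -
  have x1: "x $ 1 \<noteq> 0" and y1: "y $ 1 \<noteq> 0" using x y by (auto simp: params_def)
  obtain A B where AB: "slope A B" "A (psi x) \<noteq> 0" by (rule slope_exists [OF x])
  have ab: "x $ 1 * A (psi x) = B (psi x)" "y $ 1 * A (psi y) = B (psi y)"
    using AB x y by (auto simp: slope_def)
  have h: "A (psi y) = t ^ 4 * A (psi x)" "B (psi y) = t ^ 4 * B (psi x)"
    using AB(1) eq by (auto simp: slope_def)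
  have "t ^ 4 * A (psi x) * (y $ 1) = t ^ 4 * A (psi x) * (x $ 1)"
    using ab(2) unfolding h ab(1)[symmetric] by (simp only: mult_ac)
  then have E: "y $ 1 = x $ 1"
    using t AB(2) by (simp only: mult_cancel_left) simp
  note Rx = psi_relations(4,5) [OF x1 x1 x1 x1 x1]
  note Ry = psi_relations(4,5) [OF y1 y1 y1 y1 y1]
  have m: "(y $ 2)\<^sup>2 = t * (x $ 2)\<^sup>2"
    using Rx(1) Ry(1) eq E x1 by (simp add: mult_ac)
  have n: "(y $ 3)\<^sup>2 = t * (x $ 3)\<^sup>2"
    using Rx(2) Ry(2) eq E by simp
  have mn: "y $ 2 * y $ 3 = t * (x $ 2 * x $ 3)"
    using psi_components(2)[OF x1] psi_components(2)[OF y1] eq c_nz by (simp add: mult_ac)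
  have "\<exists>s. s \<noteq> 0 \<and> y $ 2 = s * x $ 2 \<and> y $ 3 = s * x $ 3"
  proof (cases "x $ 2 = 0")
    case False
    then have y2: "y $ 2 \<noteq> 0" using m t by auto
    have "(y $ 2) * (y $ 3 * x $ 2) = (y $ 2) * (y $ 2 * x $ 3)"
      using m mn by algebra
    then have "y $ 3 * x $ 2 = y $ 2 * x $ 3" using y2 by (simp only: mult_cancel_left) simp
    then show ?thesis
      using False y2 by (intro exI [of _ "y $ 2 / x $ 2"]) (simp add: field_simps)
  next
    case True
    then have "x $ 3 \<noteq> 0" "y $ 2 = 0" using x m by (auto simp: params_def)
    moreover have "y $ 3 \<noteq> 0" using n t \<open>x $ 3 \<noteq> 0\<close> by auto
    ultimately show ?thesis
      using True by (intro exI [of _ "y $ 3 / x $ 3"]) simp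
  qed
  then show ?thesis using E by (auto simp: vec3_eq_iff)
qed

lemma psi_eq_if_member:
  assumes "w $ Some 0 = l * w $ Some 1" "member E w" "E \<noteq> 0"
  obtains x where "x $ 1 = E" "w = psi x" "E * (x $ 2)\<^sup>2 = pf E w" "(x $ 3)\<^sup>2 = qf E w" "w $ Some 1 = c * x $ 2 * x $ 3"
proof -
  obtain m n where mn: "w $ Some 1 = c * m * n" "E * d * w $ Some 2 = E * r1 * m\<^sup>2 - r2 * n\<^sup>2"
    "d * w $ Some 3 = r1 * n\<^sup>2 - E * r2 * m\<^sup>2"
    "E * d\<^sup>2 * (\<i> * w $ None) = - (r1 * r2) * (E\<^sup>2 * m ^ 4 - n ^ 4)"
    "r1 * E * w $ Some 2 + r2 * w $ Some 3 = E * m\<^sup>2" "r2 * E * w $ Some 2 + r1 * w $ Some 3 = n\<^sup>2"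
    by (rule on_member_parametrized [OF assms(3) nz(3) cd d two_uf two_vf assms(2)[unfolded member_def]])
  define x :: "complex ^ 3" where "x = vector [E, m, n]"
  have x: "x $ 1 = E" "x $ 2 = m" "x $ 3 = n" by (simp_all add: x_def)
  have "w = psi x"
    by (rule psi_eqI) (simp_all only: x assms(1,3) mn not_False_eq_True)
  then show ?thesis
    using that [of x] mn x by (simp add: pf_def qf_def)
qed

text \<open>On the cone p, q and y1 / c are E m^2, n^2 and m n. Hence (E, p / E, y1 / c) is (E, m,
  n) scaled by m, and (E, y1 / c, q) is it scaled by n. Near each point one of these is a local
  section up to scaling, homogeneous of degree one in the last two entries.\<close>

lemma psi_section:
  assumes x0: "x0 \<in> params"
  obtains N \<Lambda> where "open N" "N \<subseteq> {w. base w \<noteq> 0}" "psi x0 \<in> N" "holo_map \<Lambda> N" "\<Lambda> ` N \<subseteq> params"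
    "\<And>w t. w \<in> N \<Longrightarrow> t \<noteq> 0 \<Longrightarrow> scl t w \<in> N \<and> \<Lambda> (scl t w) = scl3 t (\<Lambda> w)"
    "\<And>w. w \<in> N \<Longrightarrow> w \<in> cone \<Longrightarrow> \<exists>s. s \<noteq> 0 \<and> w = scl s (psi (\<Lambda> w))"
proof -
  have x1: "x0 $ 1 \<noteq> 0" and mn0: "x0 $ 2 \<noteq> 0 \<or> x0 $ 3 \<noteq> 0" using x0 by (auto simp: params_def)
  obtain A B where AB: "slope A B" "A (psi x0) \<noteq> 0" "B (psi x0) \<noteq> 0" by (rule slope_exists [OF x0])
  have hol: "holo_on A U" "holo_on B U" for U
    using AB(1) holo_on_subset [of _ UNIV U] by (auto simp: slope_def)
  have hom: "A (scl t w) = t ^ 4 * A w" "B (scl t w) = t ^ 4 * B w" for t w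
    using AB(1) by (auto simp: slope_def)
  have mem: "member E w" if "w \<in> cone" "A w \<noteq> 0" "E \<noteq> 0" "E * A w = B w" for E w
    using AB(1) that by (auto simp: slope_def)
  define e where "e = (\<lambda>w. B w / A w)"
  define N0 where "N0 = {w. base w \<noteq> 0} \<inter> {w \<in> UNIV. A w \<noteq> 0} \<inter> {w \<in> UNIV. B w \<noteq> 0}"
  have oN0: "open N0"
    unfolding N0_def by (intro open_Int open_base_nonzero open_holo_nonzero hol open_UNIV)
  have e_nz: "e w \<noteq> 0" if "w \<in> N0" for w using that by (simp add: e_def N0_def)
  have he: "holo_on e U" if "U \<subseteq> N0" for U
    unfolding e_def by (intro holo_on_divide hol) (use that in \<open>auto simp: N0_def\<close>)
  have e_scl: "e (scl t w) = e w" if "t \<noteq> 0" for t w using that by (simp add: e_def hom)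
  have N0_scl: "scl t w \<in> N0" if "t \<noteq> 0" "w \<in> N0" for t w
    using that by (simp add: N0_def hom vec4_eq_iff)
  have "x0 $ 1 * A (psi x0) = B (psi x0)" using AB x0 by (auto simp: slope_def)
  then have e0: "e (psi x0) = x0 $ 1" using AB(2) by (simp add: e_def divide_eq_eq)
  have psiN0: "psi x0 \<in> N0" using AB psi_in_cone [OF x0] by (auto simp: N0_def cone_def)
  note R0 = psi_relations(4,5) [OF x1 x1 x1 x1 x1]
  have hp: "holo_on (\<lambda>w. pf (e w) w) N0" and hq: "holo_on (\<lambda>w. qf (e w) w) N0"
    unfolding pf_def qf_def using he [of N0] by auto
  have recover: "\<exists>x. x $ 1 = e w \<and> w = psi x \<and> e w * (x $ 2)\<^sup>2 = pf (e w) w \<and> (x $ 3)\<^sup>2 = qf (e w) w \<and> w $ Some 1 = c * x $ 2 * x $ 3"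
    if w: "w \<in> N0" "w \<in> cone" for w
  proof -
    have "member (e w) w"
      by (rule mem) (use w e_nz in \<open>auto simp: e_def N0_def\<close>)
    then show ?thesis
      using psi_eq_if_member [of w "e w"] w(2) e_nz [OF w(1)] by (auto simp: cone_def)
  qed
  have unscale: "w = scl (1 / s\<^sup>2) (psi (scl3 s x))" if "w = psi x" "s \<noteq> 0" "x $ 1 \<noteq> 0" for w s x
    using that psi_scl3 [of x s] by simp
  show ?thesis
  proof (cases "x0 $ 2 = 0")
    case False
    define N where "N = {w \<in> N0. pf (e w) w \<noteq> 0}"
    define \<Lambda> :: "complex ^ (4 option) \<Rightarrow> complex ^ 3"
      where "\<Lambda> = (\<lambda>w. vector [e w, pf (e w) w / e w, w $ Some 1 / c])"
    have NN0: "N \<subseteq> N0" by (auto simp: N_def)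
    show ?thesis
    proof (rule that [of N \<Lambda>])
      show "open N" unfolding N_def by (rule open_holo_nonzero [OF hp oN0])
      show "N \<subseteq> {w. base w \<noteq> 0}" using NN0 by (auto simp: N0_def)
      show "psi x0 \<in> N" using psiN0 e0 R0(1) x1 False by (simp add: N_def)
      show "holo_map \<Lambda> N"
        unfolding \<Lambda>_def
        by (intro holo_map_vector_3 holo_on_divide holo_on_component holo_on_const he NN0 holo_on_subset [OF hp])
           (use e_nz NN0 c_nz in auto)
      show "\<Lambda> ` N \<subseteq> params" using e_nz by (auto simp: \<Lambda>_def params_def N_def)
      show "scl t w \<in> N \<and> \<Lambda> (scl t w) = scl3 t (\<Lambda> w)" if "w \<in> N" "t \<noteq> 0" for w t
        using that N0_scl by (simp add: N_def \<Lambda>_def e_scl vec3_eq_iff)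
      show "\<exists>s. s \<noteq> 0 \<and> w = scl s (psi (\<Lambda> w))" if w: "w \<in> N" "w \<in> cone" for w
      proof -
        have wN0: "w \<in> N0" using w NN0 by blast
        obtain x where x: "x $ 1 = e w" "w = psi x" "e w * (x $ 2)\<^sup>2 = pf (e w) w" "w $ Some 1 = c * x $ 2 * x $ 3"
          using recover [OF wN0 w(2)] by blast
        have x2: "x $ 2 \<noteq> 0" using x(3) w(1) by (auto simp: N_def)
        have "pf (e w) w / e w = x $ 2 * x $ 2"
          using x(3) e_nz [OF wN0] by (simp add: power2_eq_square divide_eq_eq mult_ac)
        then have "\<Lambda> w = scl3 (x $ 2) x"
          using x(1,4) c_nz by (simp add: \<Lambda>_def vec3_eq_iff mult_ac)
        then show ?thesis
          using unscale [OF x(2) x2] x(1) e_nz [OF wN0] x2 by (intro exI [of _ "1 / (x $ 2)\<^sup>2"]) simp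
      qed
    qed
  next
    case True
    then have n0: "x0 $ 3 \<noteq> 0" using mn0 by simp
    define N where "N = {w \<in> N0. qf (e w) w \<noteq> 0}"
    define \<Lambda> :: "complex ^ (4 option) \<Rightarrow> complex ^ 3"
      where "\<Lambda> = (\<lambda>w. vector [e w, w $ Some 1 / c, qf (e w) w])"
    have NN0: "N \<subseteq> N0" by (auto simp: N_def)
    show ?thesis
    proof (rule that [of N \<Lambda>])
      show "open N" unfolding N_def by (rule open_holo_nonzero [OF hq oN0])
      show "N \<subseteq> {w. base w \<noteq> 0}" using NN0 by (auto simp: N0_def)
      show "psi x0 \<in> N" using psiN0 e0 R0(2) n0 by (simp add: N_def)
      show "holo_map \<Lambda> N"
        unfolding \<Lambda>_def
        by (intro holo_map_vector_3 holo_on_divide holo_on_component holo_on_const he NN0 holo_on_subset [OF hq])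
           (use c_nz in auto)
      show "\<Lambda> ` N \<subseteq> params" using e_nz by (auto simp: \<Lambda>_def params_def N_def)
      show "scl t w \<in> N \<and> \<Lambda> (scl t w) = scl3 t (\<Lambda> w)" if "w \<in> N" "t \<noteq> 0" for w t
        using that N0_scl by (simp add: N_def \<Lambda>_def e_scl vec3_eq_iff)
      show "\<exists>s. s \<noteq> 0 \<and> w = scl s (psi (\<Lambda> w))" if w: "w \<in> N" "w \<in> cone" for w
      proof -
        have wN0: "w \<in> N0" using w NN0 by blast
        obtain x where x: "x $ 1 = e w" "w = psi x" "(x $ 3)\<^sup>2 = qf (e w) w" "w $ Some 1 = c * x $ 2 * x $ 3"
          using recover [OF wN0 w(2)] by blast
        have x3: "x $ 3 \<noteq> 0" using x(3) w(1) by (auto simp: N_def)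
        have "\<Lambda> w = scl3 (x $ 3) x"
          using x(1,3,4) c_nz by (simp add: \<Lambda>_def vec3_eq_iff power2_eq_square mult_ac)
        then show ?thesis
          using unscale [OF x(2) x3] x(1) e_nz [OF wN0] x3 by (intro exI [of _ "1 / (x $ 3)\<^sup>2"]) simp
      qed
    qed
  qed
qed

text \<open>Since p^2 - q^2 = d (E^2 y2^2 - y3^2), the difference of the equations for u and v
  becomes a single equation that is linear in z. One sheet is thus cut out by three forms of weights
  1, 2 and 2 in which m and n no longer occur.\<close>

lemma conic_iff_psi:
  assumes E: "E \<noteq> 0" and base: "base w \<noteq> 0"
  shows "w $ Some 0 = l * w $ Some 1 \<and> c\<^sup>2 * pf E w * qf E w = E * (w $ Some 1)\<^sup>2 \<and>
      E * d * w $ None = \<i> * (r1 * r2) * (E\<^sup>2 * (w $ Some 2)\<^sup>2 - (w $ Some 3)\<^sup>2) \<longleftrightarrow>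
    (\<exists>x\<in>params. x $ 1 = E \<and> w = psi x)" (is "?L \<longleftrightarrow> ?R")
proof
  assume L: ?L
  define y1 y2 y3 t where "y1 = w $ Some 1" and "y2 = w $ Some 2" and "y3 = w $ Some 3" and "t = \<i> * w $ None"
  define p q where "p = r1 * E * y2 + r2 * y3" and "q = r2 * E * y2 + r1 * y3"
  have R1: "c\<^sup>2 * p * q = E * y1\<^sup>2" using L by (simp add: p_def q_def pf_def qf_def y1_def y2_def y3_def)
  have "\<i> * (E * d * w $ None) = \<i> * (\<i> * (r1 * r2) * (E\<^sup>2 * (w $ Some 2)\<^sup>2 - (w $ Some 3)\<^sup>2))"
    using L by simp
  then have t: "E * d * t = - (r1 * r2) * (E\<^sup>2 * y2\<^sup>2 - y3\<^sup>2)"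
    by (simp add: t_def y2_def y3_def algebra_simps)
  have Ey: "E * d\<^sup>2 * y1\<^sup>2 = - 2 * p * q" using R1 cd by algebra
  have u: "2 * d\<^sup>2 * (uf w * E) = 2 * d\<^sup>2 * (r1 * r2 * c\<^sup>2 * p\<^sup>2)"
  proof -
    have "2 * d\<^sup>2 * (uf w * E) = E * d\<^sup>2 * (2 * uf w)" by algebra
    also have "\<dots> = 2 * E * d\<^sup>2 * (y2 * y3) + (r1\<^sup>2 + r2\<^sup>2) * (E * d\<^sup>2 * y1\<^sup>2) + 2 * d * (E * d * t)"
      unfolding two_uf y1_def y2_def y3_def t_def by algebra
    also have "\<dots> = - 4 * (r1 * r2) * p\<^sup>2"
      unfolding Ey t unfolding p_def q_def d by algebra
    also have "\<dots> = 2 * (c\<^sup>2 * d\<^sup>2) * (r1 * r2) * p\<^sup>2" unfolding cd by simp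
    also have "\<dots> = 2 * d\<^sup>2 * (r1 * r2 * c\<^sup>2 * p\<^sup>2)" by algebra
    finally show ?thesis .
  qed
  have v: "2 * d\<^sup>2 * (vf w * E) = 2 * d\<^sup>2 * (r1 * r2 * c\<^sup>2 * q\<^sup>2)"
  proof -
    have "2 * d\<^sup>2 * (vf w * E) = E * d\<^sup>2 * (2 * vf w)" by algebra
    also have "\<dots> = 2 * E * d\<^sup>2 * (y2 * y3) + (r1\<^sup>2 + r2\<^sup>2) * (E * d\<^sup>2 * y1\<^sup>2) - 2 * d * (E * d * t)"
      unfolding two_vf y1_def y2_def y3_def t_def by algebra
    also have "\<dots> = - 4 * (r1 * r2) * q\<^sup>2"
      unfolding Ey t unfolding p_def q_def d by algebra
    also have "\<dots> = 2 * (c\<^sup>2 * d\<^sup>2) * (r1 * r2) * q\<^sup>2" unfolding cd by simp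
    also have "\<dots> = 2 * d\<^sup>2 * (r1 * r2 * c\<^sup>2 * q\<^sup>2)" by algebra
    finally show ?thesis .
  qed
  have "uf w * E = r1 * r2 * c\<^sup>2 * p\<^sup>2" using u nz by (simp only: mult_cancel_left) simp
  moreover have "vf w * E = r1 * r2 * c\<^sup>2 * q\<^sup>2" using v nz by (simp only: mult_cancel_left) simp
  ultimately have "member E w"
    using R1 by (simp add: member_def on_member_def p_def q_def y1_def y2_def y3_def)
  then obtain x where x: "x $ 1 = E" "w = psi x" "E * (x $ 2)\<^sup>2 = pf E w" "(x $ 3)\<^sup>2 = qf E w"
    using psi_eq_if_member [of w E] L E by metis
  have "x $ 2 \<noteq> 0 \<or> x $ 3 \<noteq> 0"
  proof (rule ccontr)
    assume "\<not> ?thesis"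
    then have "psi x = 0" by (auto simp: vec5_eq_iff psi_def)
    then show False using x(2) base by (auto simp: vec4_eq_iff)
  qed
  then show ?R using x E by (auto simp: params_def)
next
  assume ?R
  then obtain x where x: "x \<in> params" "x $ 1 = E" "w = psi x" by blast
  then have x1: "x $ 1 \<noteq> 0" using E by simp
  note C = psi_components [OF x1]
  note R = psi_relations [OF x1 x1 x1 x1 x1]
  have 1: "c\<^sup>2 * pf E w * qf E w = E * (w $ Some 1)\<^sup>2"
    using R(4,5) x C(2) by (simp add: power_mult_distrib)
  define y2 y3 where "y2 = psi x $ Some 2" and "y3 = psi x $ Some 3"
  have p: "E * (x $ 2)\<^sup>2 = r1 * E * y2 + r2 * y3" and q: "(x $ 3)\<^sup>2 = r2 * E * y2 + r1 * y3"
    using R(4,5) x by (simp_all add: pf_def qf_def y2_def y3_def)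
  have "E * d\<^sup>2 * (\<i> * psi x $ None) = - (r1 * r2) * ((E * (x $ 2)\<^sup>2)\<^sup>2 - ((x $ 3)\<^sup>2)\<^sup>2)"
    using C(5) x(2) by (simp add: power_mult_distrib power_mult [symmetric])
  also have "\<dots> = d * (- (r1 * r2) * (E\<^sup>2 * y2\<^sup>2 - y3\<^sup>2))"
    unfolding p q d by algebra
  finally have "d * (E * d * (\<i> * psi x $ None)) = d * (- (r1 * r2) * (E\<^sup>2 * y2\<^sup>2 - y3\<^sup>2))"
    by (simp add: power2_eq_square mult_ac)
  then have "E * d * (\<i> * psi x $ None) = - (r1 * r2) * (E\<^sup>2 * y2\<^sup>2 - y3\<^sup>2)"
    using nz by (simp only: mult_cancel_left) simp
  then have "- \<i> * (E * d * (\<i> * psi x $ None)) = - \<i> * (- (r1 * r2) * (E\<^sup>2 * y2\<^sup>2 - y3\<^sup>2))"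
    by simp
  then have "E * d * w $ None = \<i> * (r1 * r2) * (E\<^sup>2 * (w $ Some 2)\<^sup>2 - (w $ Some 3)\<^sup>2)"
    using x(3) by (simp add: y2_def y3_def algebra_simps)
  then show ?L using 1 C(1) x(3) by simp
qed

end

section \<open>Analytic subsets and the identity theorem\<close>

lemma holomorphic_map_lift_global:
  assumes M: "open M" and M': "open M'" and \<Lambda>: "holo_map \<Lambda> M" "\<Lambda> ` M \<subseteq> M'"
    and f: "\<And>x. x \<in> M \<Longrightarrow> f (\<pi> x) = \<pi>' (\<Lambda> x)"
  shows "holomorphic_map (quotient_space M \<pi>) (quotient_space M' \<pi>') f"
proof -
  have *: "holomorphic_map (induced (quotient_space M \<pi>) UNIV) (quotient_space M' \<pi>') f"
  proof (rule holomorphic_map_lift [OF M M'])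
    fix x assume x: "x \<in> M"
    have eqs: "\<forall>y\<in>M. \<forall>z\<in>M. \<pi> y = \<pi> z \<longrightarrow> z \<in> M \<and> \<pi>' (\<Lambda> y) = \<pi>' (\<Lambda> z)"
      using f by metis
    show "\<exists>N \<Lambda>. open N \<and> N \<subseteq> M \<and> x \<in> N \<and>
       (\<forall>y\<in>N. \<forall>z\<in>M. \<pi> y = \<pi> z \<longrightarrow> z \<in> N \<and> \<pi>' (\<Lambda> y) = \<pi>' (\<Lambda> z)) \<and>
       holo_map \<Lambda> N \<and> \<Lambda> ` N \<subseteq> M' \<and> (\<forall>y\<in>N. \<pi> y \<in> UNIV \<longrightarrow> f (\<pi> y) = \<pi>' (\<Lambda> y))"
      by (intro exI [of _ M] exI [of _ \<Lambda>] conjI M subset_refl x eqs \<Lambda>) (use f in simp)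
  qed
  have id: "holomorphic_map (quotient_space M \<pi>) (quotient_space M \<pi>) (\<lambda>x. x)"
  proof (rule holomorphic_mapI)
    have eq: "{x \<in> points (quotient_space M \<pi>). x \<in> U} = U" if "openin (opens (quotient_space M \<pi>)) U" for U
      using openin_subset [OF that] by blast
    show "openin (opens (quotient_space M \<pi>)) {x \<in> points (quotient_space M \<pi>). x \<in> U}"
      if "openin (opens (quotient_space M \<pi>)) U" for U using eq that by simp
    show "g \<in> hol (quotient_space M \<pi>) {x \<in> points (quotient_space M \<pi>). x \<in> U}"
      if "g \<in> hol (quotient_space M \<pi>) U" for U g
      using eq that by (metis hol_quotient_iff)
  qed
  have "holomorphic_map (quotient_space M \<pi>) (induced (quotient_space M \<pi>) UNIV) (\<lambda>x. x)"
    by (rule holomorphic_map_into_induced [OF id _ hol_local_quotient]) simp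
  from holomorphic_map_compose [OF this *] show ?thesis .
qed

lemma hol_quotient_restrict:
  assumes "f \<in> hol (quotient_space M \<pi>) U" "openin (opens (quotient_space M \<pi>)) V" "V \<subseteq> U"
  shows "f \<in> hol (quotient_space M \<pi>) V"
  using assms unfolding hol_quotient_iff by (auto intro: holo_on_subset)

text \<open>A function on a subspace of a subspace is extended twice, and the two extensions live on
  different open sets; hence the premise that functions on \<open>X\<close> can be
  restricted.\<close>

lemma holomorphic_map_induced_induced:
  assumes X: "\<And>f U V. f \<in> hol X U \<Longrightarrow> openin (opens X) V \<Longrightarrow> V \<subseteq> U \<Longrightarrow> f \<in> hol X V" "hol_opens X"
    and BA: "B \<subseteq> A"
  shows "holomorphic_map (induced X B) (induced (induced X A) B) (\<lambda>x. x)"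
proof (rule holomorphic_mapI)
  have sub: "subtopology (subtopology (opens X) A) B = subtopology (opens X) B"
    using BA by (simp add: subtopology_subtopology Int_absorb1)
  show "x \<in> points (induced (induced X A) B)" if "x \<in> points (induced X B)" for x
    using that by (simp add: sub)
  have eq: "{x \<in> points (induced X B). x \<in> U} = U" if "openin (opens (induced X B)) U" for U
    using openin_subset [OF that] by blast
  show o: "openin (opens (induced X B)) {x \<in> points (induced X B). x \<in> U}"
    if "openin (opens (induced (induced X A) B)) U" for U
    using that eq [of U] by (simp add: sub)
  show "g \<in> hol (induced X B) {x \<in> points (induced X B). x \<in> U}"
    if g: "g \<in> hol (induced (induced X A) B) U" for U g
  proof -
    have U: "openin (subtopology (opens X) B) U" using hol_induced_openin [OF g] by (simp add: sub)
    have UB: "U \<subseteq> B" using openin_subset [OF U] by simp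
    have "g \<in> hol (induced X B) U"
      unfolding hol_induced_iff
    proof (intro conjI ballI U)
      fix p assume p: "p \<in> U"
      obtain V H where V: "openin (subtopology (opens X) A) V" "p \<in> V" "H \<in> hol (induced X A) V"
          "\<forall>q\<in>V \<inter> U. g q = H q"
        using g p unfolding hol_induced_iff [of g] opens_induced by blast
      obtain V' H' where V': "openin (opens X) V'" "p \<in> V'" "H' \<in> hol X V'" "\<forall>q\<in>V' \<inter> V. H q = H' q"
        using V(2,3) unfolding hol_induced_iff by blast
      obtain T where T: "openin (opens X) T" "V = T \<inter> A" using V(1) by (auto simp: openin_subtopology)
      have o: "openin (opens X) (V' \<inter> T)" using V'(1) T(1) by blast
      have h: "H' \<in> hol X (V' \<inter> T)" by (rule X(1)[OF V'(3) o]) simp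
      have pVT: "p \<in> V' \<inter> T" using V'(2) V(2) T(2) by simp
      have "g q = H' q" if q: "q \<in> (V' \<inter> T) \<inter> U" for q
      proof -
        have "q \<in> V" using q UB BA T(2) by auto
        then show ?thesis using q V(4) V'(4) by simp
      qed
      then show "\<exists>V F. openin (opens X) V \<and> p \<in> V \<and> F \<in> hol X V \<and> (\<forall>q\<in>V \<inter> U. g q = F q)"
        using o h pVT by (intro exI [of _ "V' \<inter> T"] exI [of _ H']) simp
    qed
    then show ?thesis using eq [of U] U by simp
  qed
qed

lemma analytic_subset_pullback:
  assumes f: "holomorphic_map X Y f" and A: "analytic_subset Y A"
  shows "analytic_subset X {x \<in> points X. f x \<in> A}"
  unfolding analytic_subset_def
proof (intro conjI ballI)
  fix p assume p: "p \<in> points X"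
  then have "f p \<in> points Y" using holomorphic_mapD(1)[OF f] by blast
  then obtain U F where U: "openin (opens Y) U" "f p \<in> U" "finite F" "F \<subseteq> hol Y U"
      "A \<inter> U = {q \<in> U. \<forall>h\<in>F. h q = 0}"
    using A unfolding analytic_subset_def by blast
  show "\<exists>U F. openin (opens X) U \<and> p \<in> U \<and> finite F \<and> F \<subseteq> hol X U \<and>
        {x \<in> points X. f x \<in> A} \<inter> U = {q \<in> U. \<forall>h\<in>F. h q = 0}"
  proof (intro exI conjI)
    show "openin (opens X) {x \<in> points X. f x \<in> U}" by (rule holomorphic_mapD(2)[OF f U(1)])
    show "finite ((\<lambda>h x. h (f x)) ` F)" using U(3) by simp
    show "(\<lambda>h x. h (f x)) ` F \<subseteq> hol X {x \<in> points X. f x \<in> U}"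
      using holomorphic_mapD(3)[OF f] U(4) by blast
    show "{x \<in> points X. f x \<in> A} \<inter> {x \<in> points X. f x \<in> U} =
       {q \<in> {x \<in> points X. f x \<in> U}. \<forall>h\<in>(\<lambda>h x. h (f x)) ` F. h q = 0}"
      using U(5) by auto
  qed (use p U in auto)
qed auto

section \<open>Subsets of the total space of O(2) given by weighted homogeneous forms\<close>

lemma O2_pt_openin:
  assumes "open N" "N \<subseteq> {w. base w \<noteq> 0}" "\<And>w t. w \<in> N \<Longrightarrow> t \<noteq> 0 \<Longrightarrow> scl t w \<in> N"
  shows "openin (opens O2_space) (O2_pt ` N)" "{w. base w \<noteq> 0 \<and> O2_pt w \<in> O2_pt ` N} = N"
proof -
  show "{w. base w \<noteq> 0 \<and> O2_pt w \<in> O2_pt ` N} = N"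
  proof (intro subset_antisym subsetI)
    fix w assume "w \<in> {w. base w \<noteq> 0 \<and> O2_pt w \<in> O2_pt ` N}"
    then obtain w' where "w' \<in> N" "O2_pt w' = O2_pt w" by auto
    then show "w \<in> N" using assms(3) by (auto simp: O2_pt_eq_iff)
  qed (use assms(2) in auto)
  then show "openin (opens O2_space) (O2_pt ` N)"
    unfolding O2_space_def openin_quotient_space using assms(1,2) by auto
qed

text \<open>A form of weight k becomes a function on the quotient after division by the k-th power
  of a base coordinate that does not vanish near the given point.\<close>

lemma analytic_subset_O2:
  assumes fin: "finite H" and H: "\<And>h. h \<in> H \<Longrightarrow> holo_on h UNIV \<and> (\<exists>k. \<forall>t w. h (scl t w) = t ^ k * h w)"
  shows "analytic_subset O2_space (O2_pt ` {w. base w \<noteq> 0 \<and> (\<forall>h\<in>H. h w = 0)})"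
  unfolding analytic_subset_def
proof (intro conjI ballI)
  let ?A = "O2_pt ` {w. base w \<noteq> 0 \<and> (\<forall>h\<in>H. h w = 0)}"
  have pts: "points O2_space = O2_pt ` {w. base w \<noteq> 0}"
    using open_base_nonzero by (simp add: O2_space_def)
  then show "?A \<subseteq> points O2_space" by blast
  fix p assume "p \<in> points O2_space"
  then obtain w0 where w0: "base w0 \<noteq> 0" "p = O2_pt w0" using pts by auto
  then obtain i where i: "w0 $ Some i \<noteq> 0" by (auto simp: vec_eq_iff)
  obtain deg where deg: "\<And>h t w. h \<in> H \<Longrightarrow> h (scl t w) = t ^ deg h * h w"
    using H by metis
  define N where "N = {w :: complex ^ (4 option). w $ Some i \<noteq> 0}"
  have N: "open N" "N \<subseteq> {w. base w \<noteq> 0}" "\<And>w t. w \<in> N \<Longrightarrow> t \<noteq> 0 \<Longrightarrow> scl t w \<in> N"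
    using open_component_ne by (auto simp: N_def vec_eq_iff)
  note NO = O2_pt_openin [OF N]
  have NO': "{w \<in> {w. base w \<noteq> 0}. O2_pt w \<in> O2_pt ` N} = N" using NO(2) by simp
  define r where "r = (\<lambda>q. SOME w. w \<in> N \<and> O2_pt w = q)"
  have r: "r (O2_pt w) \<in> N \<and> O2_pt (r (O2_pt w)) = O2_pt w" if "w \<in> N" for w
    unfolding r_def by (rule someI [of _ w]) (use that in simp)
  define f where "f = (\<lambda>h q. h (r q) / (r q $ Some i) ^ deg h)"
  have f: "f h (O2_pt w) = h w / (w $ Some i) ^ deg h" if h: "h \<in> H" and w: "w \<in> N" for h w
  proof -
    obtain t where "t \<noteq> 0" "r (O2_pt w) = scl t w"
      using r [OF w] O2_pt_eq_iff by metis
    then show ?thesis by (simp add: f_def deg [OF h] power_mult_distrib)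
  qed
  have "f h \<in> hol O2_space (O2_pt ` N)" if h: "h \<in> H" for h
  proof -
    have "holo_on (\<lambda>w. h w / (w $ Some i) ^ deg h) N"
      using H [OF h] by (intro holo_on_divide holo_on_power holo_on_component) (auto simp: N_def intro: holo_on_subset)
    then have "holo_on (\<lambda>w. f h (O2_pt w)) N"
      by (rule holo_on_cong_open [OF _ N(1)]) (simp add: f h)
    then show ?thesis
      using NO(1) unfolding O2_space_def hol_quotient_iff NO' by simp
  qed
  moreover have "?A \<inter> O2_pt ` N = {q \<in> O2_pt ` N. \<forall>g\<in>f ` H. g q = 0}"
  proof (intro subset_antisym subsetI)
    fix q assume "q \<in> ?A \<inter> O2_pt ` N"
    then obtain w w' where w: "w \<in> N" "q = O2_pt w" "\<forall>h\<in>H. h w' = 0" "q = O2_pt w'" by auto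
    then obtain t where "t \<noteq> 0" "w = scl t w'" using O2_pt_eq_iff by metis
    then have "h w = 0" if "h \<in> H" for h
      using deg [OF that, of t w'] w(3) that by simp
    then show "q \<in> {q \<in> O2_pt ` N. \<forall>g\<in>f ` H. g q = 0}" using w(1,2) f by auto
  next
    fix q assume "q \<in> {q \<in> O2_pt ` N. \<forall>g\<in>f ` H. g q = 0}"
    then obtain w where w: "w \<in> N" "q = O2_pt w" "\<forall>h\<in>H. f h q = 0" by auto
    then have "\<forall>h\<in>H. h w = 0" using f by (auto simp: N_def)
    then show "q \<in> ?A \<inter> O2_pt ` N" using w N(2) by auto
  qed
  moreover have "p \<in> O2_pt ` N" using w0 i by (auto simp: N_def)
  ultimately show "\<exists>U F. openin (opens O2_space) U \<and> p \<in> U \<and> finite F \<and> F \<subseteq> hol O2_space U \<and>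
      ?A \<inter> U = {q \<in> U. \<forall>f\<in>F. f q = 0}"
    using NO(1) fin by (intro exI [of _ "O2_pt ` N"] exI [of _ "f ` H"]) auto
qed

lemma closedin_O2:
  assumes fin: "finite H" and H: "\<And>h. h \<in> H \<Longrightarrow> holo_on h UNIV \<and> (\<exists>k. \<forall>t w. h (scl t w) = t ^ k * h w)"
  shows "closedin (opens O2_space) (O2_pt ` {w. base w \<noteq> 0 \<and> (\<forall>h\<in>H. h w = 0)})" (is "closedin _ ?A")
proof -
  define N where "N = {w. base w \<noteq> 0} \<inter> (\<Union>h\<in>H. {w \<in> UNIV. h w \<noteq> 0})"
  have "open N"
    unfolding N_def using H by (intro open_Int open_base_nonzero open_UN ballI open_holo_nonzero) auto
  moreover have scl: "scl t w \<in> N" if wt: "w \<in> N" "t \<noteq> 0" for t w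
  proof -
    obtain h where h: "h \<in> H" "h w \<noteq> 0" using wt(1) by (auto simp: N_def)
    then obtain k where "h (scl t w) = t ^ k * h w" using H by blast
    then have "h (scl t w) \<noteq> 0" using h wt by simp
    moreover have "base (scl t w) \<noteq> 0" using wt by (auto simp: N_def vec_eq_iff)
    ultimately show ?thesis using h(1) by (auto simp: N_def)
  qed
  moreover have NB: "N \<subseteq> {w. base w \<noteq> 0}" by (auto simp: N_def)
  ultimately have o: "openin (opens O2_space) (O2_pt ` N)" "{w. base w \<noteq> 0 \<and> O2_pt w \<in> O2_pt ` N} = N"
    using O2_pt_openin [of N] by blast+
  have pts: "points O2_space = O2_pt ` {w. base w \<noteq> 0}"
    using open_base_nonzero by (simp add: O2_space_def)
  have "points O2_space - ?A = O2_pt ` N"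
  proof (intro subset_antisym subsetI)
    fix q assume "q \<in> points O2_space - ?A"
    then obtain w where w: "base w \<noteq> 0" "q = O2_pt w" and q: "q \<notin> ?A" using pts by auto
    have "\<not> (\<forall>h\<in>H. h w = 0)"
    proof
      assume "\<forall>h\<in>H. h w = 0"
      then have "q \<in> ?A" unfolding w(2) by (intro imageI CollectI conjI w(1))
      then show False using q by contradiction
    qed
    then have "w \<in> N" using w(1) by (auto simp: N_def)
    then show "q \<in> O2_pt ` N" using w(2) by (rule rev_image_eqI)
  next
    fix q assume "q \<in> O2_pt ` N"
    then obtain w where w: "w \<in> N" "q = O2_pt w" by blast
    have "q \<notin> ?A"
    proof
      assume "q \<in> ?A"
      then obtain w' where w': "base w' \<noteq> 0" "\<forall>h\<in>H. h w' = 0" "O2_pt w' = O2_pt w" using w(2) by auto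
      then have "w' \<in> N" using o(2) w by auto
      then show False using w'(2) by (auto simp: N_def)
    qed
    moreover have "q \<in> points O2_space" unfolding pts using w NB by blast
    ultimately show "q \<in> points O2_space - ?A" by blast
  qed
  moreover have "?A \<subseteq> points O2_space" unfolding pts by blast
  ultimately show ?thesis
    using o(1) by (simp only: closedin_def)
qed

text \<open>Identity theorem: the interior of the preimage of an analytic subset is open and closed.\<close>

lemma irreducible_image_of_connected:
  fixes N :: "(complex ^ 'n) set"
  assumes N: "open N" "connected N" "N \<noteq> {}"
    and \<phi>: "holomorphic_map (quotient_space N (\<lambda>x. x)) X \<phi>"
    and A: "analytic_subset X (\<phi> ` N)"
  shows "irreducible_analytic X (\<phi> ` N)"
  unfolding irreducible_analytic_def
proof (intro conjI allI impI A)
  show "\<phi> ` N \<noteq> {}" using N by simp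
  fix A1 A2 assume "analytic_subset X A1 \<and> analytic_subset X A2 \<and> \<phi> ` N = A1 \<union> A2"
  then have A12: "analytic_subset X A1" "analytic_subset X A2" "\<phi> ` N = A1 \<union> A2" by auto
  have pts: "\<phi> x \<in> points X" if "x \<in> N" for x
    using holomorphic_mapD(1)[OF \<phi>] N(1) that by simp
  have loc: "\<exists>r F. r > 0 \<and> ball x r \<subseteq> N \<and> finite F \<and> (\<forall>f\<in>F. holo_on f (ball x r)) \<and>
      (\<forall>y\<in>ball x r. \<phi> y \<in> B \<longleftrightarrow> (\<forall>f\<in>F. f y = 0))" if B: "analytic_subset X B" and x: "x \<in> N" for B x
  proof -
    obtain U F where U: "openin (opens X) U" "\<phi> x \<in> U" "finite F" "F \<subseteq> hol X U"
        "B \<inter> U = {q \<in> U. \<forall>f\<in>F. f q = 0}"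
      using B pts [OF x] unfolding analytic_subset_def by blast
    have "open {x \<in> N. \<phi> x \<in> U}"
      using holomorphic_mapD(2)[OF \<phi> U(1)] N(1) by (simp add: openin_quotient_space)
    then obtain r where r: "r > 0" "ball x r \<subseteq> {x \<in> N. \<phi> x \<in> U}"
      using x U(2) openE by (metis (no_types, lifting) mem_Collect_eq)
    have "holo_on (\<lambda>y. f (\<phi> y)) (ball x r)" if "f \<in> F" for f
    proof -
      have "f \<in> hol X U" using U(4) that by blast
      then have "holo_on (\<lambda>y. f (\<phi> y)) {x \<in> N. x \<in> {x \<in> points (quotient_space N (\<lambda>x. x)). \<phi> x \<in> U}}"
        using holomorphic_mapD(3)[OF \<phi>, of f U] unfolding hol_quotient_iff by simp
      then show ?thesis
        by (rule holo_on_subset) (use r N(1) in auto)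
    qed
    moreover have "\<phi> y \<in> B \<longleftrightarrow> (\<forall>f\<in>F. f (\<phi> y) = 0)" if "y \<in> ball x r" for y
    proof -
      have "\<phi> y \<in> U" using r(2) that by blast
      then show ?thesis using U(5) by blast
    qed
    moreover have "ball x r \<subseteq> N" using r(2) by blast
    ultimately show ?thesis
      using r(1) U(3) by (intro exI [of _ r] exI [of _ "(\<lambda>f y. f (\<phi> y)) ` F"]) simp
  qed
  have closed: "\<exists>r>0. ball x r \<subseteq> N \<and> (\<forall>y\<in>ball x r. \<phi> y \<notin> B)"
    if B: "analytic_subset X B" and x: "x \<in> N" "\<phi> x \<notin> B" for B x
  proof -
    obtain r F where r: "r > 0" "ball x r \<subseteq> N" "\<forall>f\<in>F. holo_on f (ball x r)"
        "\<forall>y\<in>ball x r. \<phi> y \<in> B \<longleftrightarrow> (\<forall>f\<in>F. f y = 0)"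
      using loc [OF B x(1)] by blast
    then obtain f where f: "f \<in> F" "f x \<noteq> 0" using x(2) by auto
    have o: "open {y \<in> ball x r. f y \<noteq> 0}" using r(3) f(1) by (intro open_holo_nonzero) auto
    have xin: "x \<in> {y \<in> ball x r. f y \<noteq> 0}" using f(2) r(1) by simp
    obtain e where e: "e > 0" "ball x e \<subseteq> {y \<in> ball x r. f y \<noteq> 0}"
      by (rule openE [OF o xin])
    have "\<phi> y \<notin> B" if "y \<in> ball x e" for y
    proof -
      have "y \<in> ball x r" "f y \<noteq> 0" using e(2) that by auto
      then show ?thesis using r(4) f(1) by blast
    qed
    moreover have "ball x e \<subseteq> N" using e(2) r(2) by blast
    ultimately show ?thesis using e(1) by blast
  qed
  show "\<phi> ` N = A1 \<or> \<phi> ` N = A2"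
  proof (cases "\<phi> ` N = A1")
    case False
    then obtain x0 where x0: "x0 \<in> N" "\<phi> x0 \<notin> A1" using A12(3) by blast
    \<comment> \<open>If some point maps outside \<open>A1\<close>, then so does a neighbourhood of
      it, which therefore maps into \<open>A2\<close>: this interior is not empty.\<close>
    define I where "I = interior {x \<in> N. \<phi> x \<in> A2}"
    obtain r0 where r0: "r0 > 0" "ball x0 r0 \<subseteq> N" "\<forall>y\<in>ball x0 r0. \<phi> y \<notin> A1"
      using closed [OF A12(1) x0] by blast
    have "ball x0 r0 \<subseteq> {x \<in> N. \<phi> x \<in> A2}" using r0 A12(3) by blast
    then have "ball x0 r0 \<subseteq> I" unfolding I_def by (intro interior_maximal open_ball)
    then have "x0 \<in> I" using r0(1) by auto
    have IN: "I \<subseteq> N" unfolding I_def using interior_subset by blast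
    have "openin (top_of_set N) I"
      by (rule open_subset [OF IN]) (simp add: I_def)
    moreover
    have "openin (top_of_set N) (N - I)"
    proof (subst openin_subopen, intro ballI)
      fix x assume x: "x \<in> N - I"
      obtain r F where r: "r > 0" "ball x r \<subseteq> N" "\<forall>f\<in>F. holo_on f (ball x r)"
          "\<forall>y\<in>ball x r. \<phi> y \<in> A2 \<longleftrightarrow> (\<forall>f\<in>F. f y = 0)"
        using loc [OF A12(2)] x by blast
      have "ball x r \<inter> I = {}"
      proof (rule ccontr)
        assume "ball x r \<inter> I \<noteq> {}"
        then obtain y where y: "y \<in> ball x r" "y \<in> I" by blast
        have o: "open (ball x r \<inter> I)" unfolding I_def by (intro open_Int open_ball open_interior)
        have yin: "y \<in> ball x r \<inter> I" using y by blast
        obtain e where e: "e > 0" "ball y e \<subseteq> ball x r \<inter> I" by (rule openE [OF o yin])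
        \<comment> \<open>\<open>f\<close> vanishes near \<open>y\<close>. Continuation along the
          complex line through \<open>y\<close> and \<open>z\<close>, inside the convex slice
          \<open>T\<close> of the ball, reaches \<open>z\<close> at the parameter 1.\<close>
        have "f z = 0" if f: "f \<in> F" and z: "z \<in> ball x r" for f z
        proof (cases "z = y")
          case True
          have "y \<in> {x \<in> N. \<phi> x \<in> A2}" using y(2) interior_subset unfolding I_def by blast
          then show ?thesis using True y(1) r(4) f by blast
        next
          case zy: False
          define T where "T = {t::complex. y + t *s (z - y) \<in> ball x r}"
          have cont: "continuous_on UNIV (\<lambda>t. y + t *s (z - y))"
            by (intro linear_continuous_on continuous_intros linear_conv_bounded_linear [THEN iffD1] linearI)
               (auto simp: vec_eq_iff algebra_simps)
          have "open T"
            using open_vimage [OF open_ball cont] by (simp add: T_def vimage_def)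
          have "convex T"
          proof (rule convexI)
            fix s t :: complex and u v :: real
            assume st: "s \<in> T" "t \<in> T" "0 \<le> u" "0 \<le> v" "u + v = 1"
            have "y + (u *\<^sub>R s + v *\<^sub>R t) *s (z - y) = u *\<^sub>R (y + s *s (z - y)) + v *\<^sub>R (y + t *s (z - y))"
            proof -
              have v: "v = 1 - u" using st(5) by simp
              have "(y + (u *\<^sub>R s + v *\<^sub>R t) *s (z - y)) $ j
                  = (u *\<^sub>R (y + s *s (z - y)) + v *\<^sub>R (y + t *s (z - y))) $ j" for j
                unfolding v vector_add_component vector_scaleR_component vector_smult_component
                  vector_minus_component
                unfolding scaleR_conv_of_real of_real_diff of_real_1
                by (simp add: algebra_simps)
              then show ?thesis unfolding vec_eq_iff by blast
            qed
            then show "u *\<^sub>R s + v *\<^sub>R t \<in> T"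
              using st convexD [OF convex_ball] by (simp add: T_def)
          qed
          have T01: "0 \<in> T" "1 \<in> T" using y z by (auto simp: T_def)
          have hol: "(\<lambda>t. f (y + t *s (z - y))) holomorphic_on T"
            by (rule holomorphic_on_line) (use r(3) f T_def in auto)
          define e' where "e' = e / norm (z - y)"
          have e': "e' > 0" using e zy by (simp add: e'_def)
          have "f (y + t *s (z - y)) = 0" if "t \<in> T" "t \<in> ball 0 e'" for t
          proof -
            define a where "a = t *s (z - y)"
            have "norm a < e" unfolding a_def norm_smult_vec
              using that zy by (simp add: e'_def pos_less_divide_eq)
            then have "y + a \<in> ball y e" by (simp add: dist_norm)
            then have "y + t *s (z - y) \<in> ball y e" by (simp only: a_def)
            then have "y + t *s (z - y) \<in> ball x r" "y + t *s (z - y) \<in> I" using e(2) by blast+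
            moreover have "\<phi> (y + t *s (z - y)) \<in> A2"
              using calculation(2) interior_subset unfolding I_def by blast
            ultimately show ?thesis using r(4) f by blast
          qed
          moreover have "0 islimpt T \<inter> ball 0 e'"
          proof (rule interior_limit_point)
            show "0 \<in> interior (T \<inter> ball 0 e')"
              using \<open>open T\<close> T01 e' by (simp add: interior_open open_Int)
          qed
          ultimately have "f (y + 1 *s (z - y)) = 0"
            using analytic_continuation [OF hol \<open>open T\<close> convex_connected [OF \<open>convex T\<close>], of "T \<inter> ball 0 e'" 0 1] T01
            by auto
          then show ?thesis by simp
        qed
        then have "ball x r \<subseteq> {x \<in> N. \<phi> x \<in> A2}" using r by blast
        then have "ball x r \<subseteq> I" unfolding I_def by (intro interior_maximal open_ball)
        then have "x \<in> I" using r(1) by auto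
        then show False using x by simp
      qed
      then have "ball x r \<subseteq> N - I" using r by blast
      then show "\<exists>T. openin (top_of_set N) T \<and> x \<in> T \<and> T \<subseteq> N - I"
        using r(1) by (intro exI [of _ "ball x r"]) (auto intro: open_subset)
    qed
    then have "closedin (top_of_set N) I" using IN by (simp add: closedin_def)
    ultimately have "I = {} \<or> I = N" using N(2) unfolding connected_clopen by blast
    then have "I = N" using \<open>x0 \<in> I\<close> by blast
    then have "\<phi> ` N \<subseteq> A2" unfolding I_def using interior_subset by blast
    then show ?thesis using A12(3) by blast
  qed simp
qed

section \<open>The small resolution near the touching conics\<close>

text \<open>\<open>P\<close> stands for the points of the double covering and \<open>G\<close> for
  those off its singular set; the resolution enters through \<open>\<mu>\<close> and a holomorphic
  inverse \<open>\<nu>\<close> of it over \<open>G\<close>.\<close>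

locale small_res =
  fixes Z :: "'z cspace" and \<mu> :: "'z \<Rightarrow> (complex ^ (4 option)) set"
    and \<nu> :: "(complex ^ (4 option)) set \<Rightarrow> 'z" and P G :: "(complex ^ (4 option)) set set"
  assumes sheaf: "function_sheaf Z"
    and mu: "holomorphic_map Z O2_space \<mu>" and mu_P: "x \<in> points Z \<Longrightarrow> \<mu> x \<in> P"
    and nu: "holomorphic_map (induced O2_space G) Z \<nu>"
    and mu_nu: "y \<in> G \<Longrightarrow> \<mu> (\<nu> y) = y"
    and nu_mu: "x \<in> points Z \<Longrightarrow> \<mu> x \<in> G \<Longrightarrow> \<nu> (\<mu> x) = x"
    and P_points: "P \<subseteq> points O2_space"
    and G_open: "\<exists>T. openin (opens O2_space) T \<and> G = P \<inter> T"
begin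

lemma G_points: "G \<subseteq> points O2_space" using P_points G_open by blast

lemma nu_points: "y \<in> G \<Longrightarrow> \<nu> y \<in> points Z"
  using holomorphic_mapD(1)[OF nu, of y] G_points by auto

lemma hol_cong_Z:
  assumes "f \<in> hol Z U" "\<And>x. x \<in> U \<Longrightarrow> f x = g x" shows "g \<in> hol Z U"
proof -
  have "\<forall>U f g. f \<in> hol Z U \<longrightarrow> (\<forall>p\<in>U. f p = g p) \<longrightarrow> g \<in> hol Z U"
    by (rule conjunct2 [OF sheaf [unfolded function_sheaf_def]])
  then show ?thesis using assms by blast
qed

lemma hol_glue_Z:
  assumes "openin (opens Z) U"
    and "\<And>p. p \<in> U \<Longrightarrow> \<exists>V. openin (opens Z) V \<and> p \<in> V \<and> V \<subseteq> U \<and> f \<in> hol Z V"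
  shows "f \<in> hol Z U"
proof -
  have "f \<in> hol Z U \<longleftrightarrow> openin (opens Z) U \<and>
        (\<forall>p\<in>U. \<exists>V. openin (opens Z) V \<and> p \<in> V \<and> V \<subseteq> U \<and> f \<in> hol Z V)"
    by (rule spec [OF spec [OF conjunct1 [OF sheaf [unfolded function_sheaf_def]]]])
  with assms show ?thesis by simp
qed

definition good :: "'z set" where "good = {x \<in> points Z. \<mu> x \<in> G}"

lemma open_good: "openin (opens Z) good"
proof -
  obtain T where T: "openin (opens O2_space) T" "G = P \<inter> T" using G_open by blast
  have "good = {x \<in> points Z. \<mu> x \<in> T}" unfolding good_def using T(2) mu_P by auto
  then show ?thesis using holomorphic_mapD(2)[OF mu T(1)] by simp
qed

lemma hol_const_pullback:
  assumes "openin (opens O2_space) T" shows "(\<lambda>x. a) \<in> hol Z {x \<in> points Z. \<mu> x \<in> T}"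
proof (rule holomorphic_mapD(3)[OF mu])
  show "(\<lambda>y. a) \<in> hol O2_space T"
    using assms unfolding O2_space_def by (rule hol_quotient_const)
qed

lemma hol_const_Z: "(\<lambda>x. a) \<in> hol Z (points Z)"
proof -
  have "{x \<in> points Z. \<mu> x \<in> points O2_space} = points Z"
    using holomorphic_mapD(1)[OF mu] by blast
  then show ?thesis using hol_const_pullback [OF openin_topspace] by simp
qed

text \<open>Over \<open>G\<close> a function on \<open>Z\<close> becomes, through
  \<open>\<nu>\<close>, locally the restriction of a function on the total space of O(2), whose
  domain can be shrunk. Pulling it back by \<open>\<mu>\<close> gives holomorphy on small
  neighbourhoods, and these glue.\<close>

lemma hol_restrict_good:
  assumes f: "f \<in> hol Z U" and V: "openin (opens Z) V" "V \<subseteq> U" "V \<subseteq> good"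
  shows "f \<in> hol Z V"
proof (rule hol_glue_Z [OF V(1)])
  fix p assume p: "p \<in> V"
  let ?D = "{y \<in> points (induced O2_space G). \<nu> y \<in> U}"
  have pg: "p \<in> points Z" "\<mu> p \<in> G" using p V(3) by (auto simp: good_def)
  have np: "\<nu> (\<mu> p) = p" using nu_mu pg by blast
  have "(\<lambda>y. f (\<nu> y)) \<in> hol (induced O2_space G) ?D"
    by (rule holomorphic_mapD(3)[OF nu f])
  moreover have "\<mu> p \<in> ?D" using pg np p V(2) G_points by auto
  ultimately obtain T F0 where T: "openin (opens O2_space) T" "\<mu> p \<in> T" "F0 \<in> hol O2_space T"
      "\<And>q. q \<in> T \<inter> ?D \<Longrightarrow> f (\<nu> q) = F0 q"
    unfolding hol_induced_iff by blast
  have "openin (opens (induced O2_space G)) {y \<in> points (induced O2_space G). \<nu> y \<in> V}"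
    by (rule holomorphic_mapD(2)[OF nu V(1)])
  then obtain T2 where T2: "openin (opens O2_space) T2" "{y \<in> points (induced O2_space G). \<nu> y \<in> V} = T2 \<inter> G"
    by (auto simp: openin_subtopology)
  obtain T3 where T3: "openin (opens O2_space) T3" "G = P \<inter> T3" using G_open by blast
  have G3: "y \<in> G \<longleftrightarrow> y \<in> P \<and> y \<in> T3" for y using T3(2) by blast
  define T' where "T' = T \<inter> T2 \<inter> T3"
  have T': "openin (opens O2_space) T'" unfolding T'_def using T T2 T3 by blast
  have F0: "F0 \<in> hol O2_space T'"
    using T(3) T' unfolding O2_space_def by (rule hol_quotient_restrict) (auto simp: T'_def)
  let ?W = "{x \<in> points Z. \<mu> x \<in> T'}"
  have W: "x \<in> V \<and> f x = F0 (\<mu> x)" if "x \<in> ?W" for x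
  proof -
    have x: "x \<in> points Z" "\<mu> x \<in> G" using that mu_P G3 by (auto simp: T'_def)
    then have "\<mu> x \<in> T2 \<inter> G" using that by (auto simp: T'_def)
    then have "\<nu> (\<mu> x) \<in> V" using T2(2) by blast
    then have xV: "x \<in> V" using nu_mu x by simp
    have "\<mu> x \<in> T \<inter> ?D" using that x xV V(2) nu_mu [OF x] G_points by (auto simp: T'_def)
    then show ?thesis using T(4)[of "\<mu> x"] nu_mu [OF x] xV by simp
  qed
  have "(\<lambda>x. F0 (\<mu> x)) \<in> hol Z ?W" by (rule holomorphic_mapD(3)[OF mu F0])
  then have "f \<in> hol Z ?W" by (rule hol_cong_Z) (use W in simp)
  moreover have "openin (opens Z) ?W" by (rule holomorphic_mapD(2)[OF mu T'])
  moreover have "\<mu> p \<in> T2 \<inter> G" unfolding T2(2)[symmetric] using pg np p G_points by auto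
  then have "p \<in> ?W" using T(2) G3 pg by (auto simp: T'_def)
  moreover have "?W \<subseteq> V" using W by blast
  ultimately show "\<exists>W. openin (opens Z) W \<and> p \<in> W \<and> W \<subseteq> V \<and> f \<in> hol Z W" by blast
qed

text \<open>Constants need not be holomorphic on every open subset of \<open>Z\<close>, since restriction is not part
  of the definition of a sheaf of functions; hence the complement of \<open>B\<close> is taken downstairs.\<close>

lemma analytic_inter:
  assumes A: "analytic_subset Z A" and B0: "analytic_subset O2_space B0" "closedin (opens O2_space) B0"
    and B: "B = {x \<in> points Z. \<mu> x \<in> B0}" and good: "B \<subseteq> good"
  shows "analytic_subset Z (A \<inter> B)"
  unfolding analytic_subset_def
proof (intro conjI ballI)
  show "A \<inter> B \<subseteq> points Z" using A by (auto simp: analytic_subset_def)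
  have anB: "analytic_subset Z B" unfolding B by (rule analytic_subset_pullback [OF mu B0(1)])
  fix p assume p: "p \<in> points Z"
  show "\<exists>U F. openin (opens Z) U \<and> p \<in> U \<and> finite F \<and> F \<subseteq> hol Z U \<and> A \<inter> B \<inter> U = {q \<in> U. \<forall>f\<in>F. f q = 0}"
  proof (cases "p \<in> B")
    case False
    define T where "T = points O2_space - B0"
    have T: "openin (opens O2_space) T" using B0(2) by (simp add: T_def closedin_def)
    let ?U = "{x \<in> points Z. \<mu> x \<in> T}"
    have "openin (opens Z) ?U" by (rule holomorphic_mapD(2)[OF mu T])
    moreover have "p \<in> ?U" using p False holomorphic_mapD(1)[OF mu p] by (simp add: T_def B)
    moreover have "(\<lambda>x. 1) \<in> hol Z ?U" by (rule hol_const_pullback [OF T])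
    moreover have "?U \<inter> B = {}" by (auto simp: T_def B)
    ultimately show ?thesis by (intro exI [of _ ?U] exI [of _ "{\<lambda>x. 1}"]) auto
  next
    case True
    obtain U1 F1 where 1: "openin (opens Z) U1" "p \<in> U1" "finite F1" "F1 \<subseteq> hol Z U1"
        "A \<inter> U1 = {q \<in> U1. \<forall>f\<in>F1. f q = 0}"
      using A p unfolding analytic_subset_def by blast
    obtain U2 F2 where 2: "openin (opens Z) U2" "p \<in> U2" "finite F2" "F2 \<subseteq> hol Z U2"
        "B \<inter> U2 = {q \<in> U2. \<forall>f\<in>F2. f q = 0}"
      using anB p unfolding analytic_subset_def by blast
    define U where "U = U1 \<inter> U2 \<inter> good"
    have U: "openin (opens Z) U" unfolding U_def using 1(1) 2(1) open_good by blast
    have "f \<in> hol Z U" if "f \<in> F1 \<union> F2" for f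
      using that 1(4) 2(4) hol_restrict_good [OF _ U] unfolding U_def by blast
    moreover have "A \<inter> B \<inter> U = {q \<in> U. \<forall>f\<in>F1 \<union> F2. f q = 0}"
      using 1(5) 2(5) unfolding U_def by blast
    moreover have "p \<in> U" using 1(2) 2(2) True good by (auto simp: U_def)
    ultimately show ?thesis
      using U 1(3) 2(3) by (intro exI [of _ U] exI [of _ "F1 \<union> F2"]) auto
  qed
qed

end

text \<open>The interface between algebra and geometry: \<open>cone_P\<close> gives the equation u v
  = s^2 y1^4 for the double plane, and \<open>psi_G\<close> places the parametrized part where
  \<open>\<mu>\<close> has its inverse.\<close>

locale resolved_pencil = conic_family r1 r2 c d l + small_res Z \<mu> \<nu> P G
  for r1 r2 c d l :: complex and Z :: "'z cspace" and \<mu> \<nu> P G +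
  assumes cone_P: "base w \<noteq> 0 \<Longrightarrow> w $ Some 0 = l * w $ Some 1 \<Longrightarrow>
      O2_pt w \<in> P \<Longrightarrow> uf w * vf w = r1\<^sup>2 * r2\<^sup>2 * w $ Some 1 ^ 4"
    and psi_G: "x \<in> params \<Longrightarrow> O2_pt (psi x) \<in> G"
begin

definition Psi :: "complex ^ 3 \<Rightarrow> 'z" where "Psi x = \<nu> (O2_pt (psi x))"

definition plane :: "(complex ^ 4) set set" where
  "plane = {proj_pt y | y. y \<noteq> 0 \<and> y $ 0 = l * y $ 1}"

definition S :: "'z cspace" where
  "S = induced Z {x \<in> points Z. \<Phi>0 (\<mu> x) \<in> plane}"

lemma base_psi: "x \<in> params \<Longrightarrow> base (psi x) \<noteq> 0"
  using psi_in_cone by (auto simp: cone_def)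

lemma mu_Psi: "x \<in> params \<Longrightarrow> \<mu> (Psi x) = O2_pt (psi x)"
  unfolding Psi_def by (rule mu_nu [OF psi_G])

lemma Psi_points: "x \<in> params \<Longrightarrow> Psi x \<in> points Z"
  unfolding Psi_def by (rule nu_points [OF psi_G])

lemma in_plane_iff: "base w \<noteq> 0 \<Longrightarrow> \<Phi>0 (O2_pt w) \<in> plane \<longleftrightarrow> w $ Some 0 = l * w $ Some 1"
proof -
  assume w: "base w \<noteq> 0"
  have "proj_pt (base w) \<in> plane \<longleftrightarrow> w $ Some 0 = l * w $ Some 1"
  proof
    assume "proj_pt (base w) \<in> plane"
    then obtain y where y: "y \<noteq> 0" "y $ 0 = l * y $ 1" "proj_pt y = proj_pt (base w)"
      by (auto simp: plane_def)
    then obtain t where "t \<noteq> 0" "base w = t *s y" by (auto simp: proj_pt_eq_iff)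
    then have "base w $ 0 = l * base w $ 1" using y(2) by simp
    then show "w $ Some 0 = l * w $ Some 1" by simp
  next
    assume "w $ Some 0 = l * w $ Some 1"
    then show "proj_pt (base w) \<in> plane" unfolding plane_def using w by (intro CollectI exI [of _ "base w"]) simp
  qed
  then show ?thesis by (simp add: \<Phi>0_O2_pt)
qed

lemma Psi_in_S: "x \<in> params \<Longrightarrow> \<Phi>0 (\<mu> (Psi x)) \<in> plane"
  using in_plane_iff [OF base_psi] psi_in_cone by (simp add: mu_Psi cone_def)

lemma O2_pt_psi_scl3: "x \<in> params \<Longrightarrow> s \<noteq> 0 \<Longrightarrow> O2_pt (psi (scl3 s x)) = O2_pt (psi x)"
proof -
  assume x: "x \<in> params" and s: "s \<noteq> 0"
  have "psi (scl3 s x) = scl (s\<^sup>2) (psi x)" using x by (intro psi_scl3) (simp add: params_def)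
  then have "O2_pt (psi x) = O2_pt (psi (scl3 s x))"
    unfolding O2_pt_eq_iff using s by (intro exI [of _ "s\<^sup>2"]) simp
  then show ?thesis by simp
qed

lemma Psi_scl3: "x \<in> params \<Longrightarrow> s \<noteq> 0 \<Longrightarrow> Psi (scl3 s x) = Psi x"
  by (simp add: Psi_def O2_pt_psi_scl3)

lemma Psi_eqD:
  assumes "x \<in> params" "y \<in> params" "Psi x = Psi y"
  shows "x $ 1 = y $ 1" "\<exists>s. s \<noteq> 0 \<and> y = scl3 s x"
proof -
  have "O2_pt (psi x) = O2_pt (psi y)" using assms mu_Psi by metis
  then obtain t where "t \<noteq> 0" "psi y = scl t (psi x)" by (auto simp: O2_pt_eq_iff)
  from psi_inj [OF assms(1,2) this(2,1)] show "x $ 1 = y $ 1" "\<exists>s. s \<noteq> 0 \<and> y = scl3 s x" by auto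
qed

lemma holomorphic_psi: "holomorphic_map (quotient_space params (\<lambda>x. x)) (induced O2_space G) (\<lambda>x. O2_pt (psi x))"
proof (rule holomorphic_map_into_induced)
  show "holomorphic_map (quotient_space params (\<lambda>x. x)) O2_space (\<lambda>x. O2_pt (psi x))"
    unfolding O2_space_def
    by (rule holomorphic_map_lift_global [OF open_params open_base_nonzero holo_map_psi])
       (use base_psi in auto)
qed (use psi_G open_params in \<open>auto intro: hol_local_quotient\<close>)

lemma holomorphic_Psi: "holomorphic_map (quotient_space params (\<lambda>x. x)) Z Psi"
  using holomorphic_map_compose [OF holomorphic_psi nu] by (simp only: Psi_def [abs_def])

lemma holomorphic_Psi_S: "holomorphic_map (quotient_space params (\<lambda>x. x)) S Psi"
  unfolding S_def
  by (rule holomorphic_map_into_induced [OF holomorphic_Psi])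
     (use open_params Psi_points Psi_in_S in \<open>auto intro: hol_local_quotient\<close>)

lemma cone_scl: "w \<in> cone \<Longrightarrow> t \<noteq> 0 \<Longrightarrow> scl t w \<in> cone"
  by (simp add: cone_def power_mult_distrib algebra_simps power2_eq_square power4_eq_xxxx)

lemma local_inverse:
  assumes x0: "x0 \<in> params"
  obtains N \<Lambda> where "open N" "N \<subseteq> {w. base w \<noteq> 0}" "psi x0 \<in> N" "holo_map \<Lambda> N" "\<Lambda> ` N \<subseteq> params"
    "\<And>w t. w \<in> N \<Longrightarrow> t \<noteq> 0 \<Longrightarrow> scl t w \<in> N"
    "\<And>w t. w \<in> N \<Longrightarrow> t \<noteq> 0 \<Longrightarrow> Psi (\<Lambda> (scl t w)) = Psi (\<Lambda> w)"
    "\<And>w. w \<in> N \<Longrightarrow> w \<in> cone \<Longrightarrow> O2_pt w = O2_pt (psi (\<Lambda> w))"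
proof -
  obtain N \<Lambda> where N: "open N" "N \<subseteq> {w. base w \<noteq> 0}" "psi x0 \<in> N" "holo_map \<Lambda> N" "\<Lambda> ` N \<subseteq> params"
    and s: "\<And>w t. w \<in> N \<Longrightarrow> t \<noteq> 0 \<Longrightarrow> scl t w \<in> N \<and> \<Lambda> (scl t w) = scl3 t (\<Lambda> w)"
    and c: "\<And>w. w \<in> N \<Longrightarrow> w \<in> cone \<Longrightarrow> \<exists>s. s \<noteq> 0 \<and> w = scl s (psi (\<Lambda> w))"
    by (rule psi_section [OF x0]) blast
  show ?thesis
  proof (rule that [OF N])
    show "scl t w \<in> N" if "w \<in> N" "t \<noteq> 0" for w t using s [OF that] by simp
    show "Psi (\<Lambda> (scl t w)) = Psi (\<Lambda> w)" if "w \<in> N" "t \<noteq> 0" for w t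
    proof -
      have "\<Lambda> w \<in> params" using N(5) that(1) by blast
      then show ?thesis using s [OF that] Psi_scl3 that(2) by simp
    qed
    show "O2_pt w = O2_pt (psi (\<Lambda> w))" if "w \<in> N" "w \<in> cone" for w
      using c [OF that] O2_pt_eq_iff by metis
  qed
qed

text \<open>The target \<open>quotient_space params Psi\<close> is the product with the projective
  line in abstract form; \<open>\<nu>\<close> lifts to it by means of the sections from
  \<open>local_inverse\<close>.\<close>

lemma holomorphic_inverse:
  "holomorphic_map (induced O2_space (O2_pt ` psi ` params)) (quotient_space params Psi) \<nu>"
  unfolding O2_space_def
proof (rule holomorphic_map_lift [OF open_base_nonzero open_params])
  fix w0 assume "w0 \<in> {w. base w \<noteq> 0}" "O2_pt w0 \<in> O2_pt ` psi ` params"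
  then obtain x0 where x0: "x0 \<in> params" "O2_pt (psi x0) = O2_pt w0" by auto
  obtain N \<Lambda> where N: "open N" "N \<subseteq> {w. base w \<noteq> 0}" "psi x0 \<in> N" "holo_map \<Lambda> N" "\<Lambda> ` N \<subseteq> params"
    and s: "\<And>w t. w \<in> N \<Longrightarrow> t \<noteq> 0 \<Longrightarrow> scl t w \<in> N"
      "\<And>w t. w \<in> N \<Longrightarrow> t \<noteq> 0 \<Longrightarrow> Psi (\<Lambda> (scl t w)) = Psi (\<Lambda> w)"
    and c: "\<And>w. w \<in> N \<Longrightarrow> w \<in> cone \<Longrightarrow> O2_pt w = O2_pt (psi (\<Lambda> w))"
    by (rule local_inverse [OF x0(1)]) blast
  have w0: "w0 \<in> N" using x0(2) N(3) s(1) by (auto simp: O2_pt_eq_iff)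
  have sat: "\<forall>y\<in>N. \<forall>z\<in>{w. base w \<noteq> 0}. O2_pt y = O2_pt z \<longrightarrow> z \<in> N \<and> Psi (\<Lambda> y) = Psi (\<Lambda> z)"
    using s by (auto simp: O2_pt_eq_iff)
  have f: "\<forall>y\<in>N. O2_pt y \<in> O2_pt ` psi ` params \<longrightarrow> \<nu> (O2_pt y) = Psi (\<Lambda> y)"
  proof (intro ballI impI)
    fix y assume y: "y \<in> N" "O2_pt y \<in> O2_pt ` psi ` params"
    then obtain x where x: "x \<in> params" "O2_pt (psi x) = O2_pt y" by auto
    then obtain t where "t \<noteq> 0" "y = scl t (psi x)" by (auto simp: O2_pt_eq_iff)
    then have "y \<in> cone" using cone_scl psi_in_cone x(1) by blast
    then show "\<nu> (O2_pt y) = Psi (\<Lambda> y)" using c [OF y(1)] by (simp add: Psi_def)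
  qed
  show "\<exists>N \<Lambda>. open N \<and> N \<subseteq> {w. base w \<noteq> 0} \<and> w0 \<in> N \<and>
       (\<forall>y\<in>N. \<forall>z\<in>{w. base w \<noteq> 0}. O2_pt y = O2_pt z \<longrightarrow> z \<in> N \<and> Psi (\<Lambda> y) = Psi (\<Lambda> z)) \<and>
       holo_map \<Lambda> N \<and> \<Lambda> ` N \<subseteq> params \<and> (\<forall>y\<in>N. O2_pt y \<in> O2_pt ` psi ` params \<longrightarrow> \<nu> (O2_pt y) = Psi (\<Lambda> y))"
    by (intro exI [of _ N] exI [of _ \<Lambda>] conjI N(1,2,4,5) w0 sat f)
qed

lemma nu_mu_Psi: "q \<in> Psi ` params \<Longrightarrow> \<nu> (\<mu> q) = q"
  using mu_Psi by (auto simp: Psi_def)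

lemma holomorphic_identity:
  "holomorphic_map (induced Z (Psi ` params)) (quotient_space params Psi) (\<lambda>q. \<nu> (\<mu> q))"
proof -
  have "holomorphic_map (induced Z (Psi ` params)) (induced O2_space (O2_pt ` psi ` params)) \<mu>"
    by (rule holomorphic_map_restrict [OF mu]) (auto simp: mu_Psi)
  from holomorphic_map_compose [OF this holomorphic_inverse] show ?thesis .
qed

lemma points_S: "points S = {x \<in> points Z. \<Phi>0 (\<mu> x) \<in> plane}"
  by (auto simp: S_def)

lemma Psi_points_S: "x \<in> params \<Longrightarrow> Psi x \<in> points S"
  using Psi_points Psi_in_S by (simp add: points_S)

text \<open>A point of the surface over the domain of a local section lies in the plane and over the
  double covering, so \<open>cone_P\<close> puts it on the cone and the section supplies parameters
  for it.\<close>

lemma open_image_Psi: "openin (opens S) (Psi ` params)"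
proof (subst openin_subopen, intro ballI)
  fix q assume "q \<in> Psi ` params"
  then obtain x0 where x0: "x0 \<in> params" "q = Psi x0" by blast
  obtain N \<Lambda> where N: "open N" "N \<subseteq> {w. base w \<noteq> 0}" "psi x0 \<in> N" "holo_map \<Lambda> N" "\<Lambda> ` N \<subseteq> params"
    and s: "\<And>w t. w \<in> N \<Longrightarrow> t \<noteq> 0 \<Longrightarrow> scl t w \<in> N"
      "\<And>w t. w \<in> N \<Longrightarrow> t \<noteq> 0 \<Longrightarrow> Psi (\<Lambda> (scl t w)) = Psi (\<Lambda> w)"
    and c: "\<And>w. w \<in> N \<Longrightarrow> w \<in> cone \<Longrightarrow> O2_pt w = O2_pt (psi (\<Lambda> w))"
    by (rule local_inverse [OF x0(1)]) blast
  have o: "openin (opens O2_space) (O2_pt ` N)" by (rule O2_pt_openin(1)[OF N(1,2) s(1)])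
  define T where "T = {x \<in> points Z. \<mu> x \<in> O2_pt ` N} \<inter> {x \<in> points Z. \<Phi>0 (\<mu> x) \<in> plane}"
  have "openin (opens S) T"
    using holomorphic_mapD(2)[OF mu o] by (auto simp: T_def S_def openin_subtopology)
  moreover have "q \<in> T"
    using x0 N(3) Psi_points Psi_in_S by (auto simp: T_def mu_Psi)
  moreover have "T \<subseteq> Psi ` params"
  proof
    fix x assume "x \<in> T"
    then obtain w where w: "x \<in> points Z" "w \<in> N" "\<mu> x = O2_pt w" "\<Phi>0 (\<mu> x) \<in> plane"
      by (auto simp: T_def)
    have b: "base w \<noteq> 0" using w(2) N(2) by blast
    then have 0: "w $ Some 0 = l * w $ Some 1" using w(3,4) in_plane_iff by simp
    have "O2_pt w \<in> P" using mu_P [OF w(1)] w(3) by simp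
    then have "w \<in> cone" using b 0 cone_P by (simp add: cone_def)
    then have eq: "\<mu> x = O2_pt (psi (\<Lambda> w))" using c [OF w(2)] w(3) by simp
    have L: "\<Lambda> w \<in> params" using N(5) w(2) by blast
    have "x = \<nu> (\<mu> x)" using nu_mu [OF w(1)] psi_G [OF L] eq by simp
    then have "x = Psi (\<Lambda> w)" by (simp add: eq Psi_def)
    then show "x \<in> Psi ` params" using L by blast
  qed
  ultimately show "\<exists>T. openin (opens S) T \<and> q \<in> T \<and> T \<subseteq> Psi ` params" by blast
qed

text \<open>One direction pulls back along \<open>Psi\<close>; the other pulls back along the
  identity, regarded as a holomorphic map from a subspace of \<open>Z\<close> to the quotient of
  \<open>params\<close>. The same scheme gives \<open>hol_S_iff\<close>.\<close>

lemma openin_S_iff: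
  assumes V: "V \<subseteq> Psi ` params"
  shows "openin (opens S) V \<longleftrightarrow> open {x \<in> params. Psi x \<in> V}"
proof
  assume "openin (opens S) V"
  from holomorphic_mapD(2)[OF holomorphic_Psi_S this]
  show "open {x \<in> params. Psi x \<in> V}"
    using open_params by (simp add: openin_quotient_space)
next
  assume "open {x \<in> params. Psi x \<in> V}"
  then have "openin (opens (quotient_space params Psi)) V"
    using V by (simp add: openin_quotient_space)
  from holomorphic_mapD(2)[OF holomorphic_identity this]
  have "openin (subtopology (opens Z) (Psi ` params)) {q \<in> points (induced Z (Psi ` params)). \<nu> (\<mu> q) \<in> V}"
    by simp
  moreover have "{q \<in> points (induced Z (Psi ` params)). \<nu> (\<mu> q) \<in> V} = V"
    using V nu_mu_Psi Psi_points by auto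
  ultimately obtain T where T: "openin (opens Z) T" "V = T \<inter> Psi ` params"
    by (auto simp: openin_subtopology)
  obtain T' where T': "openin (opens Z) T'" "Psi ` params = T' \<inter> {x \<in> points Z. \<Phi>0 (\<mu> x) \<in> plane}"
    using open_image_Psi by (auto simp: S_def openin_subtopology)
  have "V = (T \<inter> T') \<inter> {x \<in> points Z. \<Phi>0 (\<mu> x) \<in> plane}" using T(2) T'(2) by blast
  then show "openin (opens S) V"
    using T(1) T'(1) unfolding S_def opens_induced openin_subtopology by blast
qed

lemma hol_S_iff:
  assumes V: "V \<subseteq> Psi ` params"
  shows "f \<in> hol S V \<longleftrightarrow> open {x \<in> params. Psi x \<in> V} \<and> holo_on (\<lambda>x. f (Psi x)) {x \<in> params. Psi x \<in> V}"
proof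
  assume "f \<in> hol S V"
  from holomorphic_mapD(3)[OF holomorphic_Psi_S this]
  show "open {x \<in> params. Psi x \<in> V} \<and> holo_on (\<lambda>x. f (Psi x)) {x \<in> params. Psi x \<in> V}"
    using open_params by (simp add: hol_quotient_iff openin_quotient_space)
next
  assume H: "open {x \<in> params. Psi x \<in> V} \<and> holo_on (\<lambda>x. f (Psi x)) {x \<in> params. Psi x \<in> V}"
  then have "f \<in> hol (quotient_space params Psi) V"
    using V by (simp add: hol_quotient_iff openin_quotient_space)
  from holomorphic_mapD(3)[OF holomorphic_identity this]
  have 1: "(\<lambda>q. f (\<nu> (\<mu> q))) \<in> hol (induced Z (Psi ` params)) {q \<in> points (induced Z (Psi ` params)). \<nu> (\<mu> q) \<in> V}" .
  have 2: "{q \<in> points (induced Z (Psi ` params)). \<nu> (\<mu> q) \<in> V} = V"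
    using V nu_mu_Psi Psi_points by auto
  have "f \<in> hol (induced Z (Psi ` params)) V"
    by (rule hol_induced_cong [OF 1 [unfolded 2]]) (use V nu_mu_Psi in auto)
  then have "\<forall>p\<in>V. \<exists>W F. openin (opens Z) W \<and> p \<in> W \<and> F \<in> hol Z W \<and> (\<forall>q\<in>W \<inter> V. f q = F q)"
    by (simp add: hol_induced_iff)
  moreover have "openin (opens S) V" using H openin_S_iff [OF V] by blast
  ultimately show "f \<in> hol S V" by (simp add: S_def hol_induced_iff)
qed

text \<open>The first coordinate is E. A translation in E commutes with the scaling of (m, n), hence
  it descends to the quotient.\<close>

lemma fibred_chart_S: "fibred_chart S params Psi 1"
proof
  show "openin (opens S) U" if "f \<in> hol S U" for f U
    using that hol_induced_openin unfolding S_def by blast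
  show "f \<in> hol S V" if "f \<in> hol S U" "openin (opens S) V" "V \<subseteq> U" for f U V
    using that hol_induced_restrict unfolding S_def by blast
  show "x $ 1 = y $ 1" if "x \<in> params" "y \<in> params" "Psi x = Psi y" for x y
    using Psi_eqD(1)[OF that] .
  show "Psi (x + t *s axis 1 1) = Psi (y + t *s axis 1 1)"
    if xy: "x \<in> params" "y \<in> params" "Psi x = Psi y" "x + t *s axis 1 1 \<in> params" for x y t
  proof -
    obtain s where s: "s \<noteq> 0" "y = scl3 s x" using Psi_eqD(2)[OF xy(1-3)] by blast
    have "y + t *s axis 1 1 = scl3 s (x + t *s axis 1 1)"
      by (simp add: s(2) vec3_eq_iff axis_def)
    then show ?thesis using Psi_scl3 [OF xy(4) s(1)] by simp
  qed
qed (rule open_params open_image_Psi openin_S_iff hol_S_iff; assumption?)+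

end

lemma hol_local_induced:
  assumes X: "\<And>f U V. f \<in> hol X U \<Longrightarrow> openin (opens X) V \<Longrightarrow> V \<subseteq> U \<Longrightarrow> f \<in> hol X V"
  shows "hol_local (induced X A)"
  unfolding hol_local_def
proof (intro allI impI)
  fix U f
  assume U: "openin (opens (induced X A)) U"
    and ex: "\<forall>p\<in>U. \<exists>V F. openin (opens (induced X A)) V \<and> p \<in> V \<and> F \<in> hol (induced X A) V \<and> (\<forall>q\<in>V \<inter> U. f q = F q)"
  have UA: "U \<subseteq> A" using openin_subset [OF U] by auto
  show "f \<in> hol (induced X A) U"
    unfolding hol_induced_iff
  proof (intro conjI ballI)
    show "openin (subtopology (opens X) A) U" using U by simp
    fix p assume p: "p \<in> U"
    then obtain V F where V: "openin (opens (induced X A)) V" "p \<in> V" "F \<in> hol (induced X A) V"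
        "\<forall>q\<in>V \<inter> U. f q = F q" using ex by blast
    obtain V' F' where V': "openin (opens X) V'" "p \<in> V'" "F' \<in> hol X V'" "\<forall>q\<in>V' \<inter> V. F q = F' q"
      using V(2,3) unfolding hol_induced_iff by blast
    obtain T where T: "openin (opens X) T" "V = T \<inter> A" using V(1) by (auto simp: openin_subtopology)
    have o: "openin (opens X) (V' \<inter> T)" using V'(1) T(1) by blast
    have h: "F' \<in> hol X (V' \<inter> T)" by (rule X [OF V'(3) o]) simp
    have "f q = F' q" if q: "q \<in> (V' \<inter> T) \<inter> U" for q
    proof -
      have "q \<in> V" using q UA T(2) by auto
      then show ?thesis using q V(4) V'(4) by simp
    qed
    then show "\<exists>V F. openin (opens X) V \<and> p \<in> V \<and> F \<in> hol X V \<and> (\<forall>q\<in>V \<inter> U. f q = F q)"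
      using o h V'(2) V(2) T(2) by (intro exI [of _ "V' \<inter> T"] exI [of _ F']) simp
  qed
qed

lemma vec2_eq_iff: "(x::complex ^ 2) = y \<longleftrightarrow> x $ 1 = y $ 1 \<and> x $ 2 = y $ 2"
  by (simp add: vec_eq_iff forall_2)

lemma holo_map_vector_2:
  assumes "holo_on f U" "holo_on g U"
  shows "holo_map (\<lambda>x. vector [f x, g x] :: complex ^ 2) U"
  using assms unfolding holo_map_def forall_2 by simp

lemma open_nonzero: "open {x :: complex ^ 'n. x \<noteq> 0}"
proof -
  have "{x :: complex ^ 'n. x \<noteq> 0} = - {0}" by blast
  then show ?thesis by (simp add: open_Compl)
qed

text \<open>An irreducible subset of the union is covered by its intersections with the two sets,
  hence it lies in one of them. Analyticity of these intersections is a premise because it will be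
  proved for the particular curves.\<close>

lemma irreducible_components_pair:
  assumes A1: "irreducible_analytic X A1" and A2: "irreducible_analytic X A2"
    and ne: "\<not> A1 \<subseteq> A2" "\<not> A2 \<subseteq> A1"
    and inter: "\<And>B. analytic_subset X B \<Longrightarrow> analytic_subset X (B \<inter> A1) \<and> analytic_subset X (B \<inter> A2)"
  shows "irreducible_components X (A1 \<union> A2) = {A1, A2}"
proof -
  have sub: "B \<subseteq> A1 \<or> B \<subseteq> A2" if B: "irreducible_analytic X B" "B \<subseteq> A1 \<union> A2" for B
  proof -
    have an: "analytic_subset X (B \<inter> A1)" "analytic_subset X (B \<inter> A2)"
      using inter B(1) by (auto simp: irreducible_analytic_def)
    have "B = (B \<inter> A1) \<union> (B \<inter> A2)" using B(2) by blast
    then have "B = B \<inter> A1 \<or> B = B \<inter> A2"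
      using an B(1) unfolding irreducible_analytic_def by blast
    then show ?thesis by blast
  qed
  show ?thesis
  proof (intro subset_antisym subsetI)
    fix B assume "B \<in> irreducible_components X (A1 \<union> A2)"
    then have B: "irreducible_analytic X B" "B \<subseteq> A1 \<union> A2"
      and max: "\<And>B'. irreducible_analytic X B' \<Longrightarrow> B \<subseteq> B' \<Longrightarrow> B' \<subseteq> A1 \<union> A2 \<Longrightarrow> B' = B"
      unfolding irreducible_components_def by blast+
    show "B \<in> {A1, A2}" using sub [OF B] max [OF A1] max [OF A2] by blast
  next
    fix B assume "B \<in> {A1, A2}"
    then show "B \<in> irreducible_components X (A1 \<union> A2)"
    proof
      assume B: "B = A1"
      have "B' = A1" if "irreducible_analytic X B'" "A1 \<subseteq> B'" "B' \<subseteq> A1 \<union> A2" for B'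
        using sub [OF that(1,3)] that(2) ne by blast
      then show ?thesis unfolding irreducible_components_def B using A1 by blast
    next
      assume "B \<in> {A2}"
      then have B: "B = A2" by simp
      have "B' = A2" if "irreducible_analytic X B'" "A2 \<subseteq> B'" "B' \<subseteq> A1 \<union> A2" for B'
        using sub [OF that(1,3)] that(2) ne by blast
      then show ?thesis unfolding irreducible_components_def B using A2 by blast
    qed
  qed
qed

section \<open>The members of the pencil as curves in the resolution\<close>

context resolved_pencil
begin

definition eqs :: "complex \<Rightarrow> complex ^ (4 option) \<Rightarrow> bool" where
  "eqs E w \<longleftrightarrow> w $ Some 0 = l * w $ Some 1 \<and> c\<^sup>2 * pf E w * qf E w = E * (w $ Some 1)\<^sup>2 \<and>
     E * d * w $ None = \<i> * (r1 * r2) * (E\<^sup>2 * (w $ Some 2)\<^sup>2 - (w $ Some 3)\<^sup>2)"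

definition K0 :: "complex \<Rightarrow> (complex ^ (4 option)) set set" where
  "K0 E = O2_pt ` {w. base w \<noteq> 0 \<and> eqs E w}"

definition K :: "complex \<Rightarrow> 'z set" where
  "K E = {x \<in> points Z. \<mu> x \<in> K0 E}"

definition conic :: "complex \<Rightarrow> (complex ^ 4) set set" where
  "conic E = {proj_pt y | y. y \<noteq> 0 \<and> y $ 0 = l * y $ 1 \<and>
     c\<^sup>2 * (r1 * E * y $ 2 + r2 * y $ 3) * (r2 * E * y $ 2 + r1 * y $ 3) = E * (y $ 1)\<^sup>2}"

lemma eqs_scl: "t \<noteq> 0 \<Longrightarrow> eqs E (scl t w) \<longleftrightarrow> eqs E w"
proof -
  assume t: "t \<noteq> 0"
  have 1: "c\<^sup>2 * (t * pf E w) * (t * qf E w) = E * (t * w $ Some 1)\<^sup>2 \<longleftrightarrow>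
     t\<^sup>2 * (c\<^sup>2 * pf E w * qf E w) = t\<^sup>2 * (E * (w $ Some 1)\<^sup>2)"
    by (simp add: power2_eq_square mult_ac)
  have 2: "E * d * (t\<^sup>2 * w $ None) = \<i> * (r1 * r2) * (E\<^sup>2 * (t * w $ Some 2)\<^sup>2 - (t * w $ Some 3)\<^sup>2) \<longleftrightarrow>
     t\<^sup>2 * (E * d * w $ None) = t\<^sup>2 * (\<i> * (r1 * r2) * (E\<^sup>2 * (w $ Some 2)\<^sup>2 - (w $ Some 3)\<^sup>2))"
    by (simp add: power2_eq_square algebra_simps)
  show ?thesis
    unfolding eqs_def scl_nth pf_scl qf_scl 1 2 mult_cancel_left using t by (simp add: mult_ac)
qed

lemma in_K0_iff: "base w \<noteq> 0 \<Longrightarrow> O2_pt w \<in> K0 E \<longleftrightarrow> eqs E w"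
proof
  assume "O2_pt w \<in> K0 E"
  then obtain w' where "eqs E w'" "O2_pt w' = O2_pt w" by (auto simp: K0_def)
  then show "eqs E w" using eqs_scl by (auto simp: O2_pt_eq_iff)
qed (auto simp: K0_def)

lemma eqs_psi: "E \<noteq> 0 \<Longrightarrow> {w. base w \<noteq> 0 \<and> eqs E w} = psi ` {x \<in> params. x $ 1 = E}"
  using conic_iff_psi [of E] base_psi unfolding eqs_def by blast

lemma K0_psi: "E \<noteq> 0 \<Longrightarrow> K0 E = O2_pt ` psi ` {x \<in> params. x $ 1 = E}"
  by (simp add: K0_def eqs_psi)

lemma K0_G: "E \<noteq> 0 \<Longrightarrow> K0 E \<subseteq> G"
  using psi_G by (auto simp: K0_psi)

lemma K_Psi: "E \<noteq> 0 \<Longrightarrow> K E = Psi ` {x \<in> params. x $ 1 = E}"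
proof (intro subset_antisym subsetI)
  assume E: "E \<noteq> 0"
  fix q assume q: "q \<in> K E"
  then obtain x where x: "x \<in> params" "x $ 1 = E" "\<mu> q = O2_pt (psi x)"
    using K0_psi [OF E] by (auto simp: K_def)
  have "\<nu> (\<mu> q) = q" using q K0_G [OF E] by (intro nu_mu) (auto simp: K_def)
  then have "q = Psi x" using x(3) by (simp add: Psi_def)
  then show "q \<in> Psi ` {x \<in> params. x $ 1 = E}" using x by blast
next
  assume E: "E \<noteq> 0"
  fix q assume "q \<in> Psi ` {x \<in> params. x $ 1 = E}"
  then show "q \<in> K E" using Psi_points mu_Psi K0_psi [OF E] by (auto simp: K_def)
qed

lemma K_good: "E \<noteq> 0 \<Longrightarrow> K E \<subseteq> good"
  using K0_G by (auto simp: K_def good_def)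

text \<open>The equations \<open>eqs\<close> once more, as a finite set of functions to which
  \<open>analytic_subset_O2\<close> and \<open>closedin_O2\<close> apply.\<close>

definition forms :: "complex \<Rightarrow> (complex ^ (4 option) \<Rightarrow> complex) set" where
  "forms E = {\<lambda>w. w $ Some 0 - l * w $ Some 1, \<lambda>w. c\<^sup>2 * pf E w * qf E w - E * (w $ Some 1)\<^sup>2,
     \<lambda>w. E * d * w $ None - \<i> * (r1 * r2) * (E\<^sup>2 * (w $ Some 2)\<^sup>2 - (w $ Some 3)\<^sup>2)}"

lemma forms_homogeneous:
  assumes "h \<in> forms E"
  shows "holo_on h UNIV \<and> (\<exists>k. \<forall>t w. h (scl t w) = t ^ k * h w)"
proof -
  have 1: "holo_on (\<lambda>w. w $ Some 0 - l * w $ Some 1) UNIV" by auto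
  have 2: "holo_on (\<lambda>w. c\<^sup>2 * pf E w * qf E w - E * (w $ Some 1)\<^sup>2) UNIV"
    unfolding pf_def qf_def by auto
  have 3: "holo_on (\<lambda>w. E * d * w $ None - \<i> * (r1 * r2) * (E\<^sup>2 * (w $ Some 2)\<^sup>2 - (w $ Some 3)\<^sup>2)) UNIV"
    by (intro holo_on_diff holo_on_mult holo_on_const holo_on_component holo_on_power)
  have h1: "\<exists>k. \<forall>t w. scl t w $ Some 0 - l * scl t w $ Some 1 = t ^ k * (w $ Some 0 - l * w $ Some 1)"
    by (rule exI [of _ 1]) (simp add: algebra_simps)
  have h2: "\<exists>k. \<forall>t w. c\<^sup>2 * pf E (scl t w) * qf E (scl t w) - E * (scl t w $ Some 1)\<^sup>2
      = t ^ k * (c\<^sup>2 * pf E w * qf E w - E * (w $ Some 1)\<^sup>2)"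
    by (rule exI [of _ 2]) (simp add: algebra_simps power2_eq_square)
  have h3: "\<exists>k. \<forall>t w. E * d * scl t w $ None - \<i> * (r1 * r2) * (E\<^sup>2 * (scl t w $ Some 2)\<^sup>2 - (scl t w $ Some 3)\<^sup>2)
      = t ^ k * (E * d * w $ None - \<i> * (r1 * r2) * (E\<^sup>2 * (w $ Some 2)\<^sup>2 - (w $ Some 3)\<^sup>2))"
    by (rule exI [of _ 2]) (simp add: algebra_simps power2_eq_square)
  show ?thesis using assms 1 2 3 h1 h2 h3 unfolding forms_def by blast
qed

lemma K0_forms: "K0 E = O2_pt ` {w. base w \<noteq> 0 \<and> (\<forall>h\<in>forms E. h w = 0)}"
  by (simp add: K0_def eqs_def forms_def)

lemma analytic_K0: "analytic_subset O2_space (K0 E)"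
  unfolding K0_forms by (rule analytic_subset_O2 [OF _ forms_homogeneous]) (auto simp: forms_def)

lemma closed_K0: "closedin (opens O2_space) (K0 E)"
  unfolding K0_forms by (rule closedin_O2 [OF _ forms_homogeneous]) (auto simp: forms_def)

lemma analytic_K: "analytic_subset Z (K E)"
  unfolding K_def by (rule analytic_subset_pullback [OF mu analytic_K0])

lemma analytic_inter_K: "E \<noteq> 0 \<Longrightarrow> analytic_subset Z A \<Longrightarrow> analytic_subset Z (A \<inter> K E)"
  by (rule analytic_inter [OF _ analytic_K0 closed_K0 K_def K_good])

lemma closed_K_S: "E \<noteq> 0 \<Longrightarrow> closedin (opens S) (K E)"
proof -
  assume E: "E \<noteq> 0"
  have o: "openin (opens O2_space) (points O2_space - K0 E)"
    using closed_K0 by (simp add: closedin_def)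
  have "openin (opens Z) {x \<in> points Z. \<mu> x \<in> points O2_space - K0 E}"
    by (rule holomorphic_mapD(2)[OF mu o])
  moreover have "points S - K E = {x \<in> points Z. \<mu> x \<in> points O2_space - K0 E} \<inter> {x \<in> points Z. \<Phi>0 (\<mu> x) \<in> plane}"
    using holomorphic_mapD(1)[OF mu] by (auto simp: points_S K_def)
  moreover have "K E \<subseteq> points S" using Psi_points_S by (auto simp: K_Psi [OF E])
  ultimately show ?thesis
    by (auto simp: closedin_def S_def openin_subtopology)
qed

definition emb :: "complex \<Rightarrow> complex ^ 2 \<Rightarrow> complex ^ 3" where
  "emb E x = vector [E, x $ 1, x $ 2]"

lemma emb_nth [simp]: "emb E x $ 1 = E" "emb E x $ 2 = x $ 1" "emb E x $ 3 = x $ 2"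
  by (simp_all add: emb_def)

lemma emb_params: "E \<noteq> 0 \<Longrightarrow> x \<noteq> 0 \<Longrightarrow> emb E x \<in> params"
  by (auto simp: params_def vec2_eq_iff)

lemma emb_scl: "emb E (t *s x) = scl3 t (emb E x)"
  by (simp add: vec3_eq_iff)

lemma holo_map_emb: "holo_map (emb E) U"
  unfolding emb_def [abs_def] by (intro holo_map_vector_3) auto

lemma emb_image: "E \<noteq> 0 \<Longrightarrow> emb E ` {x. x \<noteq> 0} = {x \<in> params. x $ 1 = E}"
proof (intro subset_antisym subsetI)
  fix y assume y: "y \<in> {x \<in> params. x $ 1 = E}"
  define x :: "complex ^ 2" where "x = vector [y $ 2, y $ 3]"
  have "y = emb E x" using y by (simp add: vec3_eq_iff x_def)
  moreover have "x \<noteq> 0" using y by (auto simp: x_def params_def vec2_eq_iff)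
  ultimately show "y \<in> emb E ` {x. x \<noteq> 0}" by blast
qed (auto simp: emb_params)

lemma holomorphic_Psi_emb:
  assumes E: "E \<noteq> 0"
  shows "holomorphic_map (quotient_space {x. x \<noteq> 0} (\<lambda>x. x)) Z (\<lambda>x. Psi (emb E x))"
proof -
  have "holomorphic_map (quotient_space {x. x \<noteq> 0} (\<lambda>x. x)) (quotient_space params (\<lambda>x. x)) (emb E)"
    by (rule holomorphic_map_lift_global [OF open_nonzero open_params holo_map_emb])
       (use emb_params E in auto)
  from holomorphic_map_compose [OF this holomorphic_Psi] show ?thesis .
qed

lemma K_emb: "E \<noteq> 0 \<Longrightarrow> K E = (\<lambda>x. Psi (emb E x)) ` {x. x \<noteq> 0}"
  by (simp only: K_Psi emb_image [symmetric] image_image not_False_eq_True)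

text \<open>The curve is the holomorphic image of the complex plane of dimension two without the
  origin, which is connected.\<close>

lemma irreducible_K:
  assumes E: "E \<noteq> 0" shows "irreducible_analytic Z (K E)"
  unfolding K_emb [OF E]
proof (rule irreducible_image_of_connected [OF open_nonzero _ _ holomorphic_Psi_emb [OF E]])
  have "{x :: complex ^ 2. x \<noteq> 0} = - {0}" by blast
  then show "connected {x :: complex ^ 2. x \<noteq> 0}"
    using connected_punctured_universe [of "0 :: complex ^ 2"] by simp
  have "(vector [1, 0] :: complex ^ 2) \<in> {x. x \<noteq> 0}" by (simp add: vec2_eq_iff)
  then show "{x :: complex ^ 2. x \<noteq> 0} \<noteq> {}" by blast
  show "analytic_subset Z ((\<lambda>x. Psi (emb E x)) ` {x. x \<noteq> 0})"
    using analytic_K [of E] by (simp add: K_emb [OF E])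
qed

definition pt :: "complex \<Rightarrow> (complex ^ 2) set \<Rightarrow> (complex ^ (4 option)) set" where
  "pt E p = O2_pt (psi (emb E (SOME x. x \<noteq> 0 \<and> proj_pt x = p)))"

lemma pt_eq: "E \<noteq> 0 \<Longrightarrow> x \<noteq> 0 \<Longrightarrow> pt E (proj_pt x) = O2_pt (psi (emb E x))"
proof -
  assume E: "E \<noteq> 0" and x: "x \<noteq> 0"
  define y where "y = (SOME y. y \<noteq> 0 \<and> proj_pt y = proj_pt x)"
  have y: "y \<noteq> 0 \<and> proj_pt y = proj_pt x"
    unfolding y_def by (rule someI [of _ x]) (use x in simp)
  then obtain t where t: "t \<noteq> 0" "y = t *s x" by (metis proj_pt_eq_iff)
  have "O2_pt (psi (emb E y)) = O2_pt (psi (emb E x))"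
    unfolding t(2) emb_scl by (rule O2_pt_psi_scl3 [OF emb_params [OF E x] t(1)])
  then show ?thesis by (simp add: pt_def y_def)
qed

lemma holomorphic_pt:
  assumes E: "E \<noteq> 0" shows "holomorphic_map projective_space (induced O2_space G) (pt E)"
  unfolding projective_space_def
proof (rule holomorphic_map_into_induced)
  have "holo_map (\<lambda>x. psi (emb E x)) {x. x \<noteq> 0}"
    by (rule holo_map_compose [OF holo_map_psi holo_map_emb]) (use emb_params E in auto)
  then show "holomorphic_map (quotient_space {x. x \<noteq> 0} proj_pt) O2_space (pt E)"
    unfolding O2_space_def
    by (rule holomorphic_map_lift_global [OF open_nonzero open_base_nonzero])
       (use base_psi emb_params E pt_eq in auto)
  show "pt E p \<in> G" if "p \<in> points (quotient_space {x. x \<noteq> 0} proj_pt)" for p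
    using that unfolding points_quotient [OF open_nonzero]
    by (auto simp: pt_eq E intro!: psi_G emb_params)
qed (rule hol_local_quotient)

definition unpt :: "complex \<Rightarrow> (complex ^ (4 option)) set \<Rightarrow> (complex ^ 2) set" where
  "unpt E q = proj_pt (SOME x. x \<noteq> 0 \<and> q = O2_pt (psi (emb E x)))"

lemma unpt_eq:
  assumes E: "E \<noteq> 0" and x: "x \<noteq> 0"
  shows "unpt E (O2_pt (psi (emb E x))) = proj_pt x"
proof -
  define y where "y = (SOME y. y \<noteq> 0 \<and> O2_pt (psi (emb E x)) = O2_pt (psi (emb E y)))"
  have y: "y \<noteq> 0 \<and> O2_pt (psi (emb E x)) = O2_pt (psi (emb E y))"
    unfolding y_def by (rule someI [of _ x]) (use x in simp)
  then have "Psi (emb E x) = Psi (emb E y)" by (simp add: Psi_def)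
  then obtain s where "s \<noteq> 0" "emb E y = scl3 s (emb E x)"
    using Psi_eqD(2) emb_params E x y by metis
  then have "s \<noteq> 0 \<and> y = s *s x" by (simp add: vec3_eq_iff vec2_eq_iff)
  then have "proj_pt x = proj_pt y" by (auto simp: proj_pt_eq_iff)
  then show ?thesis by (simp add: unpt_def y_def)
qed

text \<open>The inverse is (p / E : y1 / c) = (m^2 : m n) where p is nonzero, and (y1 / c : q) = (m
  n : n^2) where q is nonzero.\<close>

lemma holomorphic_unpt:
  assumes E: "E \<noteq> 0"
  shows "holomorphic_map (induced O2_space (K0 E)) (projective_space :: (complex ^ 2) set cspace) (unpt E)"
  unfolding O2_space_def projective_space_def
proof (rule holomorphic_map_lift [OF open_base_nonzero open_nonzero])
  fix w0 :: "complex ^ (4 option)" assume w0: "w0 \<in> {w. base w \<noteq> 0}" "O2_pt w0 \<in> K0 E"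
  have recover: "\<exists>x. x \<noteq> 0 \<and> w = psi (emb E x) \<and> pf E w = E * (x $ 1)\<^sup>2 \<and> qf E w = (x $ 2)\<^sup>2 \<and> w $ Some 1 = c * x $ 1 * x $ 2"
    if "base w \<noteq> 0" "O2_pt w \<in> K0 E" for w
  proof -
    have "w \<in> psi ` {x \<in> params. x $ 1 = E}"
      using in_K0_iff [OF that(1)] that eqs_psi [OF E] by blast
    then obtain x where x: "x \<noteq> 0" "w = psi (emb E x)"
      unfolding emb_image [OF E, symmetric] by auto
    have e: "emb E x $ 1 \<noteq> 0" using E by simp
    show ?thesis
      using x psi_relations(4,5)[OF e e e e e] psi_components(2)[OF e]
      by (intro exI [of _ x]) simp
  qed
  obtain x0 :: "complex ^ 2" where x0: "x0 \<noteq> 0" "pf E w0 = E * (x0 $ 1)\<^sup>2" "qf E w0 = (x0 $ 2)\<^sup>2"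
    using recover [of w0] w0 by auto
  \<comment> \<open>Both charts at once: \<open>h\<close> is the linear form whose nonvanishing
    defines the chart, and \<open>\<Lambda>\<close> lifts the inverse to homogeneous
    coordinates.\<close>
  have main: "\<exists>N \<Lambda>. open N \<and> N \<subseteq> {w. base w \<noteq> 0} \<and> w0 \<in> N \<and>
       (\<forall>y\<in>N. \<forall>z\<in>{w. base w \<noteq> 0}. O2_pt y = O2_pt z \<longrightarrow> z \<in> N \<and> proj_pt (\<Lambda> y) = proj_pt (\<Lambda> z)) \<and>
       holo_map \<Lambda> N \<and> \<Lambda> ` N \<subseteq> {x :: complex ^ 2. x \<noteq> 0} \<and> (\<forall>y\<in>N. O2_pt y \<in> K0 E \<longrightarrow> unpt E (O2_pt y) = proj_pt (\<Lambda> y))"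
    if h: "holo_on h UNIV" "\<And>t w. h (scl t w) = t * h w" "h w0 \<noteq> 0"
      and L: "holo_map \<Lambda> UNIV" "\<And>t w. \<Lambda> (scl t w) = t *s \<Lambda> w" "\<And>w. h w \<noteq> 0 \<Longrightarrow> \<Lambda> w \<noteq> 0"
      and r: "\<And>w x. w = psi (emb E x) \<Longrightarrow> x \<noteq> 0 \<Longrightarrow> pf E w = E * (x $ 1)\<^sup>2 \<Longrightarrow> qf E w = (x $ 2)\<^sup>2 \<Longrightarrow>
         w $ Some 1 = c * x $ 1 * x $ 2 \<Longrightarrow> h w \<noteq> 0 \<Longrightarrow> \<exists>t. t \<noteq> 0 \<and> \<Lambda> w = t *s x"
    for h and \<Lambda> :: "complex ^ (4 option) \<Rightarrow> complex ^ 2"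
  proof -
    define N where "N = {w. base w \<noteq> 0} \<inter> {w \<in> UNIV. h w \<noteq> 0}"
    have "open N" unfolding N_def by (intro open_Int open_base_nonzero open_holo_nonzero h open_UNIV)
    moreover have "N \<subseteq> {w. base w \<noteq> 0}" "w0 \<in> N" using h(3) w0 by (auto simp: N_def)
    moreover have "\<forall>y\<in>N. \<forall>z\<in>{w. base w \<noteq> 0}. O2_pt y = O2_pt z \<longrightarrow> z \<in> N \<and> proj_pt (\<Lambda> y) = proj_pt (\<Lambda> z)"
    proof (intro ballI impI)
      fix y z assume yz: "y \<in> N" "z \<in> {w. base w \<noteq> 0}" "O2_pt y = O2_pt z"
      then obtain t where t: "t \<noteq> 0" "z = scl t y" by (auto simp: O2_pt_eq_iff)
      have "z \<in> N" using yz t h(2) by (simp add: N_def)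
      moreover have "proj_pt (\<Lambda> y) = proj_pt (\<Lambda> z)" using t L(2) by (auto simp: proj_pt_eq_iff)
      ultimately show "z \<in> N \<and> proj_pt (\<Lambda> y) = proj_pt (\<Lambda> z)" by simp
    qed
    moreover have "holo_map \<Lambda> N" using L(1) holo_on_subset unfolding holo_map_def by blast
    moreover have "\<Lambda> ` N \<subseteq> {x. x \<noteq> 0}" using L(3) by (auto simp: N_def)
    moreover have "\<forall>y\<in>N. O2_pt y \<in> K0 E \<longrightarrow> unpt E (O2_pt y) = proj_pt (\<Lambda> y)"
    proof (intro ballI impI)
      fix y assume y: "y \<in> N" "O2_pt y \<in> K0 E"
      then have b: "base y \<noteq> 0" "h y \<noteq> 0" by (auto simp: N_def)
      obtain x where x: "x \<noteq> 0" "y = psi (emb E x)" "pf E y = E * (x $ 1)\<^sup>2" "qf E y = (x $ 2)\<^sup>2"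
          "y $ Some 1 = c * x $ 1 * x $ 2"
        using recover [OF b(1) y(2)] by blast
      obtain t where "t \<noteq> 0" "\<Lambda> y = t *s x" using r [OF x(2,1,3,4,5) b(2)] by blast
      then have "proj_pt x = proj_pt (\<Lambda> y)" by (auto simp: proj_pt_eq_iff)
      then show "unpt E (O2_pt y) = proj_pt (\<Lambda> y)" using unpt_eq [OF E x(1)] x(2) by simp
    qed
    ultimately show ?thesis by blast
  qed
  have hp: "holo_on (pf E) UNIV" "holo_on (qf E) UNIV"
    unfolding pf_def [abs_def] qf_def [abs_def] by auto
  show "\<exists>N \<Lambda>. open N \<and> N \<subseteq> {w. base w \<noteq> 0} \<and> w0 \<in> N \<and>
       (\<forall>y\<in>N. \<forall>z\<in>{w. base w \<noteq> 0}. O2_pt y = O2_pt z \<longrightarrow> z \<in> N \<and> proj_pt (\<Lambda> y) = proj_pt (\<Lambda> z)) \<and>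
       holo_map \<Lambda> N \<and> \<Lambda> ` N \<subseteq> {x :: complex ^ 2. x \<noteq> 0} \<and> (\<forall>y\<in>N. O2_pt y \<in> K0 E \<longrightarrow> unpt E (O2_pt y) = proj_pt (\<Lambda> y))"
  proof (cases "x0 $ 1 = 0")
    case False
    show ?thesis
    proof (rule main [of "pf E" "\<lambda>w. vector [pf E w / E, w $ Some 1 / c]"])
      show "holo_map (\<lambda>w. vector [pf E w / E, w $ Some 1 / c] :: complex ^ 2) UNIV"
        by (intro holo_map_vector_2 holo_on_divide hp holo_on_const holo_on_component) (use E c_nz in auto)
      show "\<exists>t. t \<noteq> 0 \<and> vector [pf E w / E, w $ Some 1 / c] = t *s x"
        if "pf E w = E * (x $ 1)\<^sup>2" "w $ Some 1 = c * x $ 1 * x $ 2" "pf E w \<noteq> 0" for w and x :: "complex ^ 2"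
        using that E c_nz by (intro exI [of _ "x $ 1"]) (auto simp: vec2_eq_iff power2_eq_square)
    qed (use hp x0 False E in \<open>auto simp: vec2_eq_iff\<close>)
  next
    case True
    then have x02: "x0 $ 2 \<noteq> 0" using x0(1) by (auto simp: vec2_eq_iff)
    show ?thesis
    proof (rule main [of "qf E" "\<lambda>w. vector [w $ Some 1 / c, qf E w]"])
      show "holo_map (\<lambda>w. vector [w $ Some 1 / c, qf E w] :: complex ^ 2) UNIV"
        by (intro holo_map_vector_2 holo_on_divide hp holo_on_const holo_on_component) (use c_nz in auto)
      show "\<exists>t. t \<noteq> 0 \<and> vector [w $ Some 1 / c, qf E w] = t *s x"
        if "qf E w = (x $ 2)\<^sup>2" "w $ Some 1 = c * x $ 1 * x $ 2" "qf E w \<noteq> 0" for w and x :: "complex ^ 2"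
        using that c_nz by (intro exI [of _ "x $ 2"]) (auto simp: vec2_eq_iff power2_eq_square)
    qed (use hp x0 x02 in \<open>auto simp: vec2_eq_iff\<close>)
  qed
qed

lemma points_induced_K: "points (induced Z (K E)) = K E"
  by (auto simp: K_def)

lemma smooth_rational_K:
  assumes E: "E \<noteq> 0" shows "smooth_rational_curve Z (K E)"
  unfolding smooth_rational_curve_def
proof (intro conjI exI)
  show "analytic_subset Z (K E)" by (rule analytic_K)
  have pts: "points (projective_space :: (complex ^ 2) set cspace) = proj_pt ` {x. x \<noteq> 0}"
    unfolding projective_space_def by (rule points_quotient [OF open_nonzero])
  have nu_pt: "\<nu> (pt E (proj_pt x)) = Psi (emb E x)" if "x \<noteq> 0" for x
    using pt_eq [OF E that] by (simp add: Psi_def)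
  show "biholomorphic_map (projective_space :: (complex ^ 2) set cspace) (induced Z (K E)) (\<lambda>p. \<nu> (pt E p))"
  proof (rule biholomorphic_mapI)
    have "holomorphic_map projective_space Z (\<lambda>p. \<nu> (pt E p))"
      by (rule holomorphic_map_compose [OF holomorphic_pt [OF E] nu])
    then show "holomorphic_map projective_space (induced Z (K E)) (\<lambda>p. \<nu> (pt E p))"
    proof (rule holomorphic_map_into_induced)
      show "\<nu> (pt E p) \<in> K E" if "p \<in> points projective_space" for p
        using that unfolding pts by (auto simp: nu_pt K_emb [OF E])
      show "hol_local (projective_space :: (complex ^ 2) set cspace)"
        unfolding projective_space_def by (rule hol_local_quotient)
    qed
    have "holomorphic_map (induced Z (K E)) (induced O2_space (K0 E)) \<mu>"
      by (rule holomorphic_map_restrict [OF mu]) (simp add: K_def)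
    from holomorphic_map_compose [OF this holomorphic_unpt [OF E]]
    show "holomorphic_map (induced Z (K E)) projective_space (\<lambda>q. unpt E (\<mu> q))" .
    show "unpt E (\<mu> (\<nu> (pt E p))) = p" if "p \<in> points projective_space" for p
      using that unfolding pts
      by (auto simp: nu_pt mu_Psi emb_params E unpt_eq)
    show "\<nu> (pt E (unpt E (\<mu> q))) = q" if "q \<in> points (induced Z (K E))" for q
      using that unfolding points_induced_K
      by (auto simp: K_emb [OF E] nu_pt mu_Psi emb_params E unpt_eq)
  qed (rule hol_induced_cong)
qed

text \<open>On the sheet z is this quadratic form in y, which is a section of O(2) over the whole
  projective space.\<close>

definition zsec :: "complex \<Rightarrow> complex ^ 4 \<Rightarrow> complex" where
  "zsec E y = \<i> * (r1 * r2) * (E\<^sup>2 * (y $ 2)\<^sup>2 - (y $ 3)\<^sup>2) / (E * d)"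

definition sec :: "complex \<Rightarrow> (complex ^ 4) set \<Rightarrow> (complex ^ (4 option)) set" where
  "sec E q = (let y = (SOME y. y \<noteq> 0 \<and> proj_pt y = q) in O2_pt (pack y (zsec E y)))"

lemma sec_eq: "y \<noteq> 0 \<Longrightarrow> sec E (proj_pt y) = O2_pt (pack y (zsec E y))"
proof -
  assume y: "y \<noteq> 0"
  define x where "x = (SOME x. x \<noteq> 0 \<and> proj_pt x = proj_pt y)"
  have x: "x \<noteq> 0 \<and> proj_pt x = proj_pt y"
    unfolding x_def by (rule someI [of _ y]) (use y in simp)
  then obtain t where t: "t \<noteq> 0" "x = t *s y" by (metis proj_pt_eq_iff)
  have "pack x (zsec E x) = scl t (pack y (zsec E y))"
    by (simp add: vec5_eq_iff t(2) zsec_def power_mult_distrib algebra_simps diff_divide_distrib)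
  then have "O2_pt (pack y (zsec E y)) = O2_pt (pack x (zsec E x))"
    using t(1) by (auto simp: O2_pt_eq_iff)
  then show ?thesis by (simp add: sec_def x_def Let_def)
qed

lemma holomorphic_sec:
  assumes E: "E \<noteq> 0" shows "holomorphic_map projective_space O2_space (sec E)"
  unfolding projective_space_def O2_space_def
proof (rule holomorphic_map_lift_global [OF open_nonzero open_base_nonzero])
  show "holo_map (\<lambda>y. pack y (zsec E y)) {x. x \<noteq> 0}"
    unfolding holo_map_def all_4_option pack_nth zsec_def
    by (intro conjI holo_on_divide holo_on_diff holo_on_mult holo_on_power holo_on_const holo_on_component)
       (use nz E in auto)
qed (auto simp: sec_eq)

lemma eqs_pack:
  assumes "E \<noteq> 0"
  shows "eqs E w \<longleftrightarrow> w $ Some 0 = l * w $ Some 1 \<and> c\<^sup>2 * pf E w * qf E w = E * (w $ Some 1)\<^sup>2 \<and>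
     w = pack (base w) (zsec E (base w))"
  using assms nz by (auto simp: eqs_def vec5_eq_iff zsec_def field_simps)

lemma holomorphic_\<Phi>0: "holomorphic_map O2_space projective_space \<Phi>0"
  unfolding projective_space_def O2_space_def
proof (rule holomorphic_map_lift_global [OF open_base_nonzero open_nonzero])
  show "holo_map base {w. base w \<noteq> 0}" by (auto simp: holo_map_def)
qed (auto simp: \<Phi>0_O2_pt)

text \<open>On the conic the inverse of the covering map is the global section \<open>sec E\<close>
  followed by \<open>\<nu>\<close>; its holomorphy is therefore inherited from projective space
  without charts on the conic.\<close>

lemma biholomorphic_K_conic:
  assumes E: "E \<noteq> 0"
  shows "biholomorphic_map (induced Z (K E)) (induced projective_space (conic E)) (\<Phi>0 \<circ> \<mu>)"
proof (rule biholomorphic_mapI)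
  have K: "\<exists>w. base w \<noteq> 0 \<and> eqs E w \<and> \<mu> q = O2_pt w" if "q \<in> K E" for q
    using that by (auto simp: K_def K0_def)
  have C1: "proj_pt (base w) \<in> conic E" if "base w \<noteq> 0" "eqs E w" for w
    using that unfolding conic_def eqs_def pf_def qf_def by (intro CollectI exI [of _ "base w"]) simp
  have C2: "\<exists>w. base w \<noteq> 0 \<and> eqs E w \<and> p = proj_pt (base w) \<and> sec E p = O2_pt w" if pC: "p \<in> conic E" for p
  proof -
    obtain y where y: "y \<noteq> 0" "p = proj_pt y" "y $ 0 = l * y $ 1"
        "c\<^sup>2 * (r1 * E * y $ 2 + r2 * y $ 3) * (r2 * E * y $ 2 + r1 * y $ 3) = E * (y $ 1)\<^sup>2"
      using pC by (auto simp: conic_def)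
    show ?thesis
      using y sec_eq [OF y(1), of E]
      by (intro exI [of _ "pack y (zsec E y)"]) (simp add: eqs_pack [OF E] pf_def qf_def)
  qed
  have "holomorphic_map Z projective_space (\<lambda>q. \<Phi>0 (\<mu> q))"
    by (rule holomorphic_map_compose [OF mu holomorphic_\<Phi>0])
  then show "holomorphic_map (induced Z (K E)) (induced projective_space (conic E)) (\<Phi>0 \<circ> \<mu>)"
    unfolding o_def
  proof (rule holomorphic_map_restrict)
    show "\<Phi>0 (\<mu> q) \<in> conic E" if "q \<in> K E" for q
      using K [OF that] C1 by (auto simp: \<Phi>0_O2_pt)
  qed
  have secG: "sec E p \<in> K0 E" if "p \<in> conic E" for p
    using C2 [OF that] by (auto simp: K0_def)
  have "holomorphic_map (induced projective_space (conic E)) (induced O2_space G) (sec E)"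
    by (rule holomorphic_map_restrict [OF holomorphic_sec [OF E]]) (use secG K0_G [OF E] in blast)
  from holomorphic_map_compose [OF this nu]
  have ns: "holomorphic_map (induced projective_space (conic E)) Z (\<lambda>p. \<nu> (sec E p))" .
  have inK: "\<nu> (sec E p) \<in> K E" if "p \<in> conic E" for p
    using secG [OF that] K0_G [OF E] nu_points mu_nu by (auto simp: K_def)
  show "holomorphic_map (induced projective_space (conic E)) (induced Z (K E)) (\<lambda>p. \<nu> (sec E p))"
  proof (rule holomorphic_map_into_induced [OF ns])
    show "hol_local (induced projective_space (conic E))"
      unfolding projective_space_def by (rule hol_local_induced) (rule hol_quotient_restrict)
  qed (use inK in auto)
  show "\<nu> (sec E ((\<Phi>0 \<circ> \<mu>) q)) = q" if "q \<in> points (induced Z (K E))" for q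
  proof -
    have q: "q \<in> K E" using that unfolding points_induced_K .
    obtain w where w: "base w \<noteq> 0" "eqs E w" "\<mu> q = O2_pt w" using K [OF q] by blast
    have "sec E (proj_pt (base w)) = O2_pt w"
      using sec_eq [OF w(1), of E] w(2) eqs_pack [OF E] by metis
    moreover have "\<nu> (\<mu> q) = q" using q K0_G [OF E] by (intro nu_mu) (auto simp: K_def)
    ultimately show ?thesis using w(3) by (simp add: \<Phi>0_O2_pt)
  qed
  show "(\<Phi>0 \<circ> \<mu>) (\<nu> (sec E p)) = p" if "p \<in> points (induced projective_space (conic E))" for p
  proof -
    have p: "p \<in> conic E" using that by simp
    obtain w where w: "p = proj_pt (base w)" "sec E p = O2_pt w" using C2 [OF p] by blast
    have "\<mu> (\<nu> (sec E p)) = sec E p" using secG [OF p] K0_G [OF E] mu_nu by blast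
    then show ?thesis using w by (simp add: \<Phi>0_O2_pt)
  qed
qed (rule hol_induced_cong)

end

section \<open>Divisors and linear equivalence\<close>

text \<open>The equation belongs to the ideal that it generates, as e = e * 1.\<close>

lemma local_equation_vanishes:
  assumes le: "local_equation X (divisor_of X A) U e" and one: "(\<lambda>q. 1) \<in> hol X U" and q: "q \<in> U" "q \<in> A"
  shows "e q = 0"
proof -
  have eU: "openin (opens X) U" "e \<in> hol X U"
    and J: "\<And>V. openin (opens X) V \<Longrightarrow> V \<subseteq> U \<Longrightarrow>
      divisor_of X A V = {g \<in> hol X V. \<exists>h\<in>hol X V. \<forall>q\<in>V. g q = e q * h q}"
    using le unfolding local_equation_def by blast+
  have "\<exists>h\<in>hol X U. \<forall>q\<in>U. e q = e q * h q"
    by (rule bexI [OF _ one]) simp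
  then have "e \<in> divisor_of X A U"
    using J [OF eU(1) subset_refl] eU(2) by simp
  then show ?thesis using q by (simp add: divisor_of_def)
qed

text \<open>Off the closed set \<open>A\<close> the ideal contains the function 1, so the equation
  has an inverse there.\<close>

lemma local_equation_nonzero:
  assumes le: "local_equation X (divisor_of X A) U e"
    and one: "\<And>V. openin (opens X) V \<Longrightarrow> (\<lambda>q. 1) \<in> hol X V"
    and A: "closedin (opens X) A" and q: "q \<in> U" "q \<notin> A"
  shows "e q \<noteq> 0"
proof
  assume eq: "e q = 0"
  have U: "openin (opens X) U"
    and J: "\<And>V. openin (opens X) V \<Longrightarrow> V \<subseteq> U \<Longrightarrow>
      divisor_of X A V = {g \<in> hol X V. \<exists>h\<in>hol X V. \<forall>q\<in>V. g q = e q * h q}"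
    using le unfolding local_equation_def by blast+
  have V: "openin (opens X) (U - A)" using U A by (rule openin_diff)
  have "(\<lambda>q. 1) \<in> divisor_of X A (U - A)"
    using one [OF V] by (simp add: divisor_of_def)
  then obtain h where "\<forall>q\<in>U - A. 1 = e q * h q"
    using J [OF V Diff_subset] by auto
  then have "1 = e q * h q" using q by blast
  then show False using eq by simp
qed

context resolved_pencil
begin

lemma fibre_K: "E \<noteq> 0 \<Longrightarrow> fibred_chart.fibre params Psi 1 E = K E"
  by (simp add: fibred_chart.fibre_def [OF fibred_chart_S] K_Psi)

text \<open>The constant is holomorphic on all of \<open>Z\<close>, and every function on a subspace
  that is locally a restriction is holomorphic.\<close>

lemma hol_const_S: "openin (opens S) V \<Longrightarrow> (\<lambda>q. a) \<in> hol S V"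
proof -
  assume V: "openin (opens S) V"
  then have "V \<subseteq> points Z" using openin_subset [OF V] by (auto simp: points_S)
  then show ?thesis
    using V hol_const_Z openin_topspace unfolding S_def hol_induced_iff opens_induced by blast
qed

lemma K_subset_image: "E \<noteq> 0 \<Longrightarrow> K E \<subseteq> Psi ` params"
  by (auto simp: K_Psi)

lemma local_equation_K:
  assumes E: "E \<noteq> 0" and p: "p \<in> points S"
  shows "\<exists>U e. p \<in> U \<and> local_equation S (divisor_of S (K E)) U e"
proof (cases "p \<in> K E")
  case True
  then have "p \<in> Psi ` params" using K_subset_image [OF E] by blast
  moreover have "\<exists>e. local_equation S (divisor_of S (K E)) (Psi ` params) e"
    using fibred_chart.local_equation_fibre [OF fibred_chart_S, of E] unfolding fibre_K [OF E] by blast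
  ultimately show ?thesis by blast
next
  case False
  have o: "openin (opens S) (points S - K E)" using closed_K_S [OF E] by (simp add: closedin_def)
  have "local_equation S (divisor_of S (K E)) (points S - K E) (\<lambda>q. 1)"
    unfolding local_equation_def
  proof (intro conjI allI impI o hol_const_S)
    show "divisor_of S (K E) V = {g \<in> hol S V. \<exists>h\<in>hol S V. \<forall>q\<in>V. g q = 1 * h q}"
      if V: "openin (opens S) V \<and> V \<subseteq> points S - K E" for V
    proof -
      have "V \<inter> K E = {}" using V by blast
      then show ?thesis by (auto simp: divisor_of_def)
    qed
  qed auto
  then show ?thesis using p False by blast
qed

lemma divisor_in_pencil:
  assumes E: "E \<noteq> 0" shows "divisor_of S (K E) \<in> pencil_of S (K E)"
proof -
  have "effective_divisor S (divisor_of S (K E))"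
    unfolding effective_divisor_def
  proof (intro conjI allI ballI)
    show "\<exists>U e. p \<in> U \<and> local_equation S (divisor_of S (K E)) U e" if "p \<in> points S" for p
      using local_equation_K [OF E that] .
    show "f \<in> divisor_of S (K E) U \<longleftrightarrow> f \<in> hol S U \<and>
        (\<forall>p\<in>U. \<exists>V. openin (opens S) V \<and> p \<in> V \<and> V \<subseteq> U \<and> f \<in> divisor_of S (K E) V)" for U f
    proof
      assume f: "f \<in> divisor_of S (K E) U"
      then have h: "f \<in> hol S U" by (simp add: divisor_of_def)
      then have "openin (opens S) U" using hol_induced_openin unfolding S_def by blast
      then show "f \<in> hol S U \<and> (\<forall>p\<in>U. \<exists>V. openin (opens S) V \<and> p \<in> V \<and> V \<subseteq> U \<and> f \<in> divisor_of S (K E) V)"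
        using f h by blast
    next
      assume H: "f \<in> hol S U \<and> (\<forall>p\<in>U. \<exists>V. openin (opens S) V \<and> p \<in> V \<and> V \<subseteq> U \<and> f \<in> divisor_of S (K E) V)"
      have "f p = 0" if p: "p \<in> U \<inter> K E" for p
      proof -
        obtain V where "p \<in> V" "f \<in> divisor_of S (K E) V" using H p by blast
        then show ?thesis using p by (simp add: divisor_of_def)
      qed
      then show "f \<in> divisor_of S (K E) U" using H by (simp add: divisor_of_def)
    qed
  qed
  moreover have "linearly_equivalent S (divisor_of S (K E)) (divisor_of S (K E))"
    unfolding linearly_equivalent_def
  proof (intro exI [of _ "\<lambda>_. 1"] ballI)
    fix p assume "p \<in> points S"
    then obtain U e where "p \<in> U" "local_equation S (divisor_of S (K E)) U e"
      using local_equation_K [OF E] by blast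
    then show "\<exists>U e e'. p \<in> U \<and> local_equation S (divisor_of S (K E)) U e \<and>
        local_equation S (divisor_of S (K E)) U e' \<and> (\<forall>q\<in>U. e q \<noteq> 0 \<longrightarrow> 1 = e' q / e q)"
      by (intro exI [of _ U] exI [of _ e]) simp
  qed
  ultimately show ?thesis by (simp add: pencil_of_def complete_linear_system_def)
qed

lemma trivial_normal_bundle_K: "E \<noteq> 0 \<Longrightarrow> trivial_normal_bundle S (K E)"
  using fibred_chart.trivial_normal_bundle_fibre [OF fibred_chart_S, of E] by (simp add: fibre_K)

text \<open>A meromorphic function with divisor \<open>K' - K E0\<close> is holomorphic on the disjoint member
  \<open>K E1\<close> of the pencil, hence constant there by Liouville, although it vanishes exactly at the
  points of \<open>K'\<close>.\<close>

lemma not_linearly_equivalent: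
  assumes E0: "E0 \<noteq> 0" and E1: "E1 \<noteq> 0" "E1 \<noteq> E0" and K': "closedin (opens S) K'"
    and t0: "Psi (vector [E1, 1, t0]) \<in> K'" and 0: "Psi (vector [E1, 1, 0]) \<notin> K'"
  shows "\<not> linearly_equivalent S (divisor_of S (K E0)) (divisor_of S K')"
proof
  assume "linearly_equivalent S (divisor_of S (K E0)) (divisor_of S K')"
  then obtain F where F: "\<And>p. p \<in> points S \<Longrightarrow> \<exists>U e e'. p \<in> U \<and>
         local_equation S (divisor_of S (K E0)) U e \<and> local_equation S (divisor_of S K') U e' \<and>
        (\<forall>q\<in>U. e q \<noteq> 0 \<longrightarrow> F q = e' q / e q)"
    unfolding linearly_equivalent_def by blast
  define D where "D = {x \<in> params. x $ 1 = E1}"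
  have key: "(\<exists>W. x \<in> W \<and> holo_on (\<lambda>x. F (Psi x)) W) \<and> (F (Psi x) = 0 \<longleftrightarrow> Psi x \<in> K')" if x: "x \<in> D" for x
  proof -
    have xp: "x \<in> params" "x $ 1 = E1" using x by (auto simp: D_def)
    obtain U e e' where U: "Psi x \<in> U" "local_equation S (divisor_of S (K E0)) U e"
        "local_equation S (divisor_of S K') U e'" "\<And>q. q \<in> U \<Longrightarrow> e q \<noteq> 0 \<Longrightarrow> F q = e' q / e q"
      using F [OF Psi_points_S [OF xp(1)]] by blast
    have oU: "openin (opens S) U" and h: "e \<in> hol S U" "e' \<in> hol S U"
      using U(2,3) by (auto simp: local_equation_def)
    have nK: "Psi x \<notin> K E0"
    proof
      assume "Psi x \<in> K E0"
      then obtain y where "y \<in> params" "y $ 1 = E0" "Psi x = Psi y" by (auto simp: K_Psi [OF E0])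
      then show False using Psi_eqD(1)[OF xp(1)] xp(2) E1(2) by metis
    qed
    \<comment> \<open>Members with different parameters are disjoint, so the denominator of F = e' /
      e is invertible near this point.\<close>
    have e: "e (Psi x) \<noteq> 0"
      by (rule local_equation_nonzero [OF U(2) hol_const_S closed_K_S [OF E0] U(1) nK])
    let ?N = "{y \<in> params. Psi y \<in> U}"
    have N: "open ?N" "holo_on (\<lambda>y. e (Psi y)) ?N" "holo_on (\<lambda>y. e' (Psi y)) ?N"
      using holomorphic_mapD(3)[OF holomorphic_Psi_S h(1)] holomorphic_mapD(3)[OF holomorphic_Psi_S h(2)] open_params
      by (auto simp: hol_quotient_iff openin_quotient_space)
    define W where "W = {y \<in> ?N. e (Psi y) \<noteq> 0}"
    have W: "open W" unfolding W_def by (rule open_holo_nonzero [OF N(2,1)])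
    have "holo_on (\<lambda>y. e' (Psi y) / e (Psi y)) W"
      by (intro holo_on_divide holo_on_subset [OF N(2)] holo_on_subset [OF N(3)]) (auto simp: W_def)
    then have "holo_on (\<lambda>y. F (Psi y)) W"
      by (rule holo_on_cong_open [OF _ W]) (auto simp: W_def U(4))
    moreover have "x \<in> W" using xp U(1) e by (simp add: W_def)
    moreover have "e' (Psi x) = 0 \<longleftrightarrow> Psi x \<in> K'"
      using local_equation_vanishes [OF U(3) hol_const_S [OF oU] U(1)]
        local_equation_nonzero [OF U(3) hol_const_S K' U(1)] by blast
    then have "F (Psi x) = 0 \<longleftrightarrow> Psi x \<in> K'" using U(1,4) e by simp
    ultimately show ?thesis by blast
  qed
  have hol: "holo_on (\<lambda>x. F (Psi x)) D"
    unfolding holo_on_def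
  proof
    fix x assume "x \<in> D"
    then obtain W where "x \<in> W" "holo_on (\<lambda>x. F (Psi x)) W" using key by blast
    then show "\<exists>Da. ((\<lambda>x. F (Psi x)) has_derivative Da) (at x) \<and> (\<forall>c v. Da (c *s v) = c * Da v)"
      unfolding holo_on_def by blast
  qed
  \<comment> \<open>\<open>a\<close> and \<open>b\<close> are \<open>F\<close> in the two affine
    charts (1 : t) and (t : 1) of the line \<open>K E1\<close>.\<close>
  define a where "a = (\<lambda>t. F (Psi (vector [E1, 1, t])))"
  define b where "b = (\<lambda>t. F (Psi (vector [E1, t, 1])))"
  have la: "(vector [E1, 1, t] :: complex ^ 3) = vector [E1, 1, 0] + t *s axis 3 1" for t
    by (simp add: vec3_eq_iff axis_def)
  have lb: "(vector [E1, t, 1] :: complex ^ 3) = vector [E1, 0, 1] + t *s axis 2 1" for t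
    by (simp add: vec3_eq_iff axis_def)
  have Da: "vector [E1, 1, t] \<in> D" and Db: "vector [E1, t, 1] \<in> D" for t
    using E1 by (simp_all add: D_def params_def)
  have "(\<lambda>t. F (Psi (vector [E1, 1, 0] + t *s axis 3 1))) holomorphic_on UNIV"
    by (rule holomorphic_on_line [OF hol]) (simp only: la [symmetric] Da)
  then have a: "a holomorphic_on UNIV"
    by (simp only: a_def la [symmetric])
  have "(\<lambda>t. F (Psi (vector [E1, 0, 1] + t *s axis 2 1))) holomorphic_on UNIV"
    by (rule holomorphic_on_line [OF hol]) (simp only: lb [symmetric] Db)
  then have b: "b holomorphic_on UNIV"
    by (simp only: b_def lb [symmetric])
  have ab: "a t = b (1 / t)" if "t \<noteq> 0" for t
  proof -
    have "(vector [E1, 1, t] :: complex ^ 3) = scl3 t (vector [E1, 1 / t, 1])"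
      using that by (simp add: vec3_eq_iff)
    moreover have "vector [E1, 1 / t, 1] \<in> params" using Db by (simp add: D_def)
    ultimately show ?thesis using Psi_scl3 that by (simp add: a_def b_def)
  qed
  \<comment> \<open>The closed unit discs of the two charts cover the line, so the entire function
    \<open>a\<close> is bounded.\<close>
  have "bounded (a ` cball 0 1)" "bounded (b ` cball 0 1)"
    using a b by (auto intro!: compact_imp_bounded compact_continuous_image
        intro: continuous_on_subset holomorphic_on_imp_continuous_on)
  then have "bounded (a ` cball 0 1 \<union> b ` cball 0 1)" by simp
  moreover have "range a \<subseteq> a ` cball 0 1 \<union> b ` cball 0 1"
  proof
    fix v assume "v \<in> range a"
    then obtain t where t: "v = a t" by blast
    show "v \<in> a ` cball 0 1 \<union> b ` cball 0 1"
    proof (cases "norm t \<le> 1")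
      case False
      then have "t \<noteq> 0" by auto
      then have "v = b (1 / t)" "norm (1 / t) \<le> 1"
        using ab [of t] t False by (auto simp: norm_divide divide_le_eq)
      then show ?thesis by (auto simp: image_iff)
    qed (use t in auto)
  qed
  ultimately have "a constant_on UNIV"
    by (intro Liouville_theorem a) (rule bounded_subset)
  then have "a t0 = a 0" unfolding constant_on_def by auto
  moreover have "a t0 = 0" "a 0 \<noteq> 0" using key [OF Da] t0 0 unfolding a_def by blast+
  ultimately show False by simp
qed

text \<open>The member at \<open>- E0\<close> has the same equation for z as the opposite sheet at
  \<open>E0\<close>. On it the conic equation of the opposite sheet becomes 2 r1 r2 c^2 (y3^2 + E0^2
  y2^2) = 0. This form has a zero on the member and, as r1^2 + r2^2 is nonzero, does not vanish at
  (1 : 0).\<close>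

lemma meets_opposite:
  assumes nz2: "r1\<^sup>2 + r2\<^sup>2 \<noteq> 0" and E0: "E0 \<noteq> 0" and K': "closedin (opens S) K'"
    and mem: "\<And>x. x \<in> params \<Longrightarrow> Psi x \<in> K' \<longleftrightarrow>
      psi x $ Some 0 = l * psi x $ Some 1 \<and> c\<^sup>2 * qf E0 (psi x) * pf E0 (psi x) = E0 * (psi x $ Some 1)\<^sup>2 \<and>
      E0 * (- d) * psi x $ None = \<i> * (r2 * r1) * (E0\<^sup>2 * (psi x $ Some 2)\<^sup>2 - (psi x $ Some 3)\<^sup>2)"
  shows "\<not> linearly_equivalent S (divisor_of S (K E0)) (divisor_of S K')"
proof -
  have iff: "Psi x \<in> K' \<longleftrightarrow> (psi x $ Some 3)\<^sup>2 + E0\<^sup>2 * (psi x $ Some 2)\<^sup>2 = 0"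
    if x: "x \<in> params" "x $ 1 = - E0" for x
  proof -
    define y1 y2 y3 where "y1 = psi x $ Some 1" and "y2 = psi x $ Some 2" and "y3 = psi x $ Some 3"
    have x1: "x $ 1 \<noteq> 0" and mE: "- E0 \<noteq> 0" using x E0 by auto
    have L: "psi x $ Some 0 = l * psi x $ Some 1"
      "c\<^sup>2 * pf (- E0) (psi x) * qf (- E0) (psi x) = (- E0) * (psi x $ Some 1)\<^sup>2"
      "(- E0) * d * psi x $ None = \<i> * (r1 * r2) * ((- E0)\<^sup>2 * (psi x $ Some 2)\<^sup>2 - (psi x $ Some 3)\<^sup>2)"
      using iffD2 [OF conic_iff_psi [OF mE base_psi [OF x(1)]]] x by blast+
    have z: "E0 * (- d) * psi x $ None = \<i> * (r2 * r1) * (E0\<^sup>2 * (psi x $ Some 2)\<^sup>2 - (psi x $ Some 3)\<^sup>2)"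
      using L(3) by (simp add: mult_ac)
    have q: "c\<^sup>2 * (- (r1 * E0 * y2) + r2 * y3) * (- (r2 * E0 * y2) + r1 * y3) = - (E0 * y1\<^sup>2)"
      using L(2) by (simp add: pf_def qf_def y1_def y2_def y3_def)
    have "c\<^sup>2 * qf E0 (psi x) * pf E0 (psi x) - E0 * y1\<^sup>2 = c\<^sup>2 * (2 * r1 * r2) * (y3\<^sup>2 + E0\<^sup>2 * y2\<^sup>2)"
    proof -
      have "c\<^sup>2 * qf E0 (psi x) * pf E0 (psi x) - E0 * y1\<^sup>2 =
          c\<^sup>2 * (r2 * E0 * y2 + r1 * y3) * (r1 * E0 * y2 + r2 * y3) + - (E0 * y1\<^sup>2)"
        by (simp add: pf_def qf_def y2_def y3_def)
      also have "\<dots> = c\<^sup>2 * (2 * r1 * r2) * (y3\<^sup>2 + E0\<^sup>2 * y2\<^sup>2)"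
        unfolding q [symmetric] by algebra
      finally show ?thesis .
    qed
    then have "c\<^sup>2 * qf E0 (psi x) * pf E0 (psi x) = E0 * y1\<^sup>2 \<longleftrightarrow> y3\<^sup>2 + E0\<^sup>2 * y2\<^sup>2 = 0"
      using c_nz nz by (metis eq_iff_diff_eq_0 mult_eq_0_iff power_not_zero zero_neq_numeral)
    then show ?thesis
      using mem [OF x(1)] L(1) z by (simp add: y1_def y2_def y3_def)
  qed
  have fac: "(r1 + \<i> * r2) * (r1 - \<i> * r2) = r1\<^sup>2 + r2\<^sup>2"
    by (simp add: algebra_simps power2_eq_square)
  then have m: "r1 - \<i> * r2 \<noteq> 0" using nz2 by auto
  \<comment> \<open>At (1 : t) one has E0 d y2 = E0 r1 + r2 t^2 and d y3 = r1 t^2 + E0 r2; the value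
    \<open>t0\<close> solves y3 = i E0 y2.\<close>
  define t0 where "t0 = csqrt (\<i> * E0 * (r1 + \<i> * r2) / (r1 - \<i> * r2))"
  have t0: "t0\<^sup>2 * (r1 - \<i> * r2) = \<i> * E0 * (r1 + \<i> * r2)" using m by (simp add: t0_def)
  define x :: "complex \<Rightarrow> complex ^ 3" where "x = (\<lambda>t. vector [- E0, 1, t])"
  have xn: "x t $ 1 = - E0" "x t $ 2 = 1" "x t $ 3 = t" for t by (simp_all add: x_def)
  have xp: "x t \<in> params" for t using E0 by (simp add: params_def xn)
  have x1: "x t $ 1 \<noteq> 0" for t using E0 by (simp add: xn)
  have y2: "E0 * d * psi (x t) $ Some 2 = E0 * r1 + r2 * t\<^sup>2" for t
  proof -
    have "- (E0 * d * psi (x t) $ Some 2) = - (E0 * r1 + r2 * t\<^sup>2)"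
      using psi_components(3)[OF x1, of t] by (simp add: xn)
    then show ?thesis by (simp only: neg_equal_iff_equal)
  qed
  have y3: "d * psi (x t) $ Some 3 = r1 * t\<^sup>2 + E0 * r2" for t
    using psi_components(4)[OF x1, of t] by (simp add: xn)
  have sq: "d\<^sup>2 * ((psi (x t) $ Some 3)\<^sup>2 + E0\<^sup>2 * (psi (x t) $ Some 2)\<^sup>2)
      = (r1 * t\<^sup>2 + E0 * r2)\<^sup>2 + (E0 * r1 + r2 * t\<^sup>2)\<^sup>2" for t
  proof -
    have "d\<^sup>2 * ((psi (x t) $ Some 3)\<^sup>2 + E0\<^sup>2 * (psi (x t) $ Some 2)\<^sup>2)
        = (d * psi (x t) $ Some 3)\<^sup>2 + (E0 * d * psi (x t) $ Some 2)\<^sup>2"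
      by (simp add: power_mult_distrib algebra_simps)
    also have "\<dots> = (r1 * t\<^sup>2 + E0 * r2)\<^sup>2 + (E0 * r1 + r2 * t\<^sup>2)\<^sup>2"
      unfolding y2 y3 ..
    finally show ?thesis .
  qed
  have in0: "Psi (x t) \<in> K' \<longleftrightarrow> (r1 * t\<^sup>2 + E0 * r2)\<^sup>2 + (E0 * r1 + r2 * t\<^sup>2)\<^sup>2 = 0" for t
    using iff [OF xp xn(1)] sq [of t] nz by (metis mult_eq_0_iff power_not_zero)
  have "r1 * t0\<^sup>2 + E0 * r2 = \<i> * (E0 * r1 + r2 * t0\<^sup>2)"
    using t0 by (simp add: algebra_simps)
  then have "Psi (x t0) \<in> K'" unfolding in0 by (simp add: power_mult_distrib)
  moreover have "Psi (x 0) \<notin> K'"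
  proof -
    have "(E0 * r2)\<^sup>2 + (E0 * r1)\<^sup>2 = E0\<^sup>2 * (r1\<^sup>2 + r2\<^sup>2)" by algebra
    then show ?thesis unfolding in0 using E0 nz2 by simp
  qed
  moreover have "- E0 \<noteq> E0" using E0 by simp
  ultimately show ?thesis
    using not_linearly_equivalent [OF E0, of "- E0" K' t0] E0 K' unfolding x_def by simp
qed

end

section \<open>Real structure and the two sheets\<close>

text \<open>The points over \<open>P\<^sub>\<infinity>\<close> and its conjugate have y1 = 0 and one
  of y2, y3 equal to 0. If y1 = 0, then m n = 0, and the vanishing of y2 or y3 would force m = n =
  0.\<close>

lemma (in conic_family) psi_avoids_vertices:
  assumes x: "x \<in> params"
  shows "psi x $ Some 1 = 0 \<Longrightarrow> psi x $ Some 2 \<noteq> 0" "psi x $ Some 1 = 0 \<Longrightarrow> psi x $ Some 3 \<noteq> 0"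
proof -
  have x1: "x $ 1 \<noteq> 0" using x by (simp add: params_def)
  note C = psi_components [OF x1]
  show "psi x $ Some 2 \<noteq> 0" if y: "psi x $ Some 1 = 0"
  proof
    assume "psi x $ Some 2 = 0"
    then have "x $ 1 * r1 * (x $ 2)\<^sup>2 = r2 * (x $ 3)\<^sup>2" using C(3) by simp
    moreover have "x $ 2 = 0 \<or> x $ 3 = 0" using y C(2) c_nz by simp
    ultimately show False using x nz by (auto simp: params_def)
  qed
  show "psi x $ Some 3 \<noteq> 0" if y: "psi x $ Some 1 = 0"
  proof
    assume "psi x $ Some 3 = 0"
    then have "r1 * (x $ 3)\<^sup>2 = x $ 1 * r2 * (x $ 2)\<^sup>2" using C(4) by simp
    moreover have "x $ 2 = 0 \<or> x $ 3 = 0" using y C(2) c_nz by simp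
    ultimately show False using x nz by (auto simp: params_def)
  qed
qed

lemma (in conic_family) uf_vf:
  "uf w * vf w = (w $ Some 2 * w $ Some 3 + (r1\<^sup>2 + r2\<^sup>2) / 2 * (w $ Some 1)\<^sup>2)\<^sup>2 + (w $ None)\<^sup>2"
  by (simp add: uf_def vf_def algebra_simps power2_eq_square)

context resolved_pencil
begin

lemma in_conic_iff:
  assumes y: "y \<noteq> 0"
  shows "proj_pt y \<in> conic E \<longleftrightarrow> y $ 0 = l * y $ 1 \<and>
     c\<^sup>2 * (r1 * E * y $ 2 + r2 * y $ 3) * (r2 * E * y $ 2 + r1 * y $ 3) = E * (y $ 1)\<^sup>2"
proof
  assume "proj_pt y \<in> conic E"
  then obtain x where x: "x $ 0 = l * x $ 1"
     "c\<^sup>2 * (r1 * E * x $ 2 + r2 * x $ 3) * (r2 * E * x $ 2 + r1 * x $ 3) = E * (x $ 1)\<^sup>2"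
     "proj_pt x = proj_pt y" by (auto simp: conic_def)
  then obtain t where t: "t \<noteq> 0" "y = t *s x" by (auto simp: proj_pt_eq_iff)
  have "c\<^sup>2 * (r1 * E * (t * x $ 2) + r2 * (t * x $ 3)) * (r2 * E * (t * x $ 2) + r1 * (t * x $ 3))
      = t\<^sup>2 * (c\<^sup>2 * (r1 * E * x $ 2 + r2 * x $ 3) * (r2 * E * x $ 2 + r1 * x $ 3))"
    by algebra
  also have "\<dots> = E * (t * x $ 1)\<^sup>2" unfolding x(2) by algebra
  finally show "y $ 0 = l * y $ 1 \<and>
     c\<^sup>2 * (r1 * E * y $ 2 + r2 * y $ 3) * (r2 * E * y $ 2 + r1 * y $ 3) = E * (y $ 1)\<^sup>2"
    using t x(1) by simp
qed (use y in \<open>auto simp: conic_def\<close>)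

text \<open>Substituting E d^2 y1^2 = -2 p q into z^2 = s^2 y1^4 - (y2 y3 + Q y1^2)^2 turns the
  right-hand side into a square; its two roots are the two sheets.\<close>

lemma two_sheets:
  assumes E: "E \<noteq> 0" and w0: "w $ Some 0 = l * w $ Some 1"
    and C: "c\<^sup>2 * pf E w * qf E w = E * (w $ Some 1)\<^sup>2"
    and uv: "uf w * vf w = r1\<^sup>2 * r2\<^sup>2 * w $ Some 1 ^ 4"
  shows "E * d * w $ None = \<i> * (r1 * r2) * (E\<^sup>2 * (w $ Some 2)\<^sup>2 - (w $ Some 3)\<^sup>2) \<or>
     E * d * w $ None = - (\<i> * (r1 * r2) * (E\<^sup>2 * (w $ Some 2)\<^sup>2 - (w $ Some 3)\<^sup>2))"
proof -
  define y1 y2 y3 z where "y1 = w $ Some 1" and "y2 = w $ Some 2" and "y3 = w $ Some 3" and "z = w $ None"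
  define Y where "Y = 2 * y2 * y3 + (r1\<^sup>2 + r2\<^sup>2) * y1\<^sup>2"
  have z: "4 * z\<^sup>2 = 4 * (r1 * r2)\<^sup>2 * y1 ^ 4 - Y\<^sup>2"
  proof -
    have h: "Y / 2 = y2 * y3 + (r1\<^sup>2 + r2\<^sup>2) / 2 * y1\<^sup>2" by (simp add: Y_def add_divide_distrib)
    have "(Y / 2)\<^sup>2 + z\<^sup>2 = (r1 * r2)\<^sup>2 * y1 ^ 4"
      unfolding h using uv [unfolded uf_vf] by (simp add: y1_def y2_def y3_def z_def power_mult_distrib)
    then show ?thesis by (simp add: power_divide field_simps)
  qed
  have C': "E * d\<^sup>2 * y1\<^sup>2 = - 2 * ((r1 * E * y2 + r2 * y3) * (r2 * E * y2 + r1 * y3))"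
  proof -
    have "E * d\<^sup>2 * y1\<^sup>2 = d\<^sup>2 * (c\<^sup>2 * pf E w * qf E w)" unfolding C y1_def by algebra
    also have "\<dots> = (c\<^sup>2 * d\<^sup>2) * (pf E w * qf E w)" by algebra
    finally show ?thesis by (simp add: cd pf_def qf_def y2_def y3_def)
  qed
  have "4 * d\<^sup>2 * (E * d * z)\<^sup>2 = 4 * d\<^sup>2 * (\<i> * (r1 * r2) * (E\<^sup>2 * y2\<^sup>2 - y3\<^sup>2))\<^sup>2"
  proof -
    have "4 * d\<^sup>2 * (E * d * z)\<^sup>2 = E\<^sup>2 * d ^ 4 * (4 * z\<^sup>2)" by algebra
    also have "\<dots> = 4 * (r1 * r2)\<^sup>2 * (E * d\<^sup>2 * y1\<^sup>2)\<^sup>2 - (2 * E * d\<^sup>2 * (y2 * y3) + (r1\<^sup>2 + r2\<^sup>2) * (E * d\<^sup>2 * y1\<^sup>2))\<^sup>2"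
      unfolding z Y_def by algebra
    also have "\<dots> = - (4 * d\<^sup>2 * ((r1 * r2) * (E\<^sup>2 * y2\<^sup>2 - y3\<^sup>2))\<^sup>2)"
      unfolding C' unfolding d by algebra
    also have "\<dots> = 4 * d\<^sup>2 * (\<i> * (r1 * r2) * (E\<^sup>2 * y2\<^sup>2 - y3\<^sup>2))\<^sup>2"
      by (simp add: power_mult_distrib)
    finally show ?thesis .
  qed
  then have "(E * d * z)\<^sup>2 = (\<i> * (r1 * r2) * (E\<^sup>2 * y2\<^sup>2 - y3\<^sup>2))\<^sup>2"
    using nz by (simp only: mult_cancel_left) simp
  then show ?thesis unfolding power2_eq_iff y2_def y3_def z_def .
qed

definition conj_w :: "complex ^ (4 option) \<Rightarrow> complex ^ (4 option)" where
  "conj_w w = pack (vec4 (cnj (w $ Some 0)) (cnj (w $ Some 1)) (cnj (w $ Some 3)) (cnj (w $ Some 2))) (cnj (w $ None))"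

lemma \<sigma>0_O2_pt: "\<sigma>0 (O2_pt w) = O2_pt (conj_w w)"
proof -
  have eq: "conj_w (scl t w) = scl (cnj t) (conj_w w)" for t
    by (simp add: vec5_eq_iff conj_w_def)
  have "\<sigma>0 (O2_pt w) = conj_w ` {scl t w | t. t \<noteq> 0}"
    by (simp add: \<sigma>0_def conj_w_def [abs_def] O2_pt_scl)
  also have "\<dots> = {scl t (conj_w w) | t. t \<noteq> 0}"
  proof (intro subset_antisym subsetI)
    fix v assume "v \<in> {scl t (conj_w w) | t. t \<noteq> 0}"
    then obtain t where "t \<noteq> 0" "v = scl t (conj_w w)" by blast
    then have "v = conj_w (scl (cnj t) w)" "cnj t \<noteq> 0" by (simp_all add: eq)
    then show "v \<in> conj_w ` {scl t w | t. t \<noteq> 0}" by blast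
  next
    fix v assume "v \<in> conj_w ` {scl t w | t. t \<noteq> 0}"
    then obtain t where "t \<noteq> 0" "v = conj_w (scl t w)" by blast
    then have "v = scl (cnj t) (conj_w w)" "cnj t \<noteq> 0" by (simp_all add: eq)
    then show "v \<in> {scl t (conj_w w) | t. t \<noteq> 0}" by blast
  qed
  finally show ?thesis by (simp add: O2_pt_scl)
qed

text \<open>On the unit circle the conjugate of E is 1 / E. The real structure exchanges y2 and y3,
  and multiplication of the conjugated equations by E^2 restores their form. It is c^2 that must be
  real, and this follows from c^2 d^2 = -2.\<close>

lemma eqs_conj:
  assumes re: "cnj r1 = r1" "cnj r2 = r2" "cnj d = d" "cnj l = l" and E: "E * cnj E = 1" and w: "eqs E w"
  shows "eqs E (conj_w w)"
proof -
  have "(cnj c)\<^sup>2 * (cnj d)\<^sup>2 = cnj (c\<^sup>2 * d\<^sup>2)" by simp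
  also have "\<dots> = c\<^sup>2 * d\<^sup>2" unfolding cd by simp
  finally have "(cnj c)\<^sup>2 * d\<^sup>2 = c\<^sup>2 * d\<^sup>2" unfolding re .
  then have rc: "(cnj c)\<^sup>2 = c\<^sup>2" using nz by simp
  define y1 y2 y3 z e where "y1 = cnj (w $ Some 1)" and "y2 = cnj (w $ Some 2)" and "y3 = cnj (w $ Some 3)"
    and "z = cnj (w $ None)" and "e = cnj E"
  have Ee: "E * e = 1" using E by (simp add: e_def)
  note W = w [unfolded eqs_def pf_def qf_def]
  have 1: "cnj (w $ Some 0) = l * y1"
    using arg_cong [where f = cnj, OF conjunct1 [OF W]] re by (simp add: y1_def)
  have 2: "c\<^sup>2 * (r1 * e * y2 + r2 * y3) * (r2 * e * y2 + r1 * y3) = e * y1\<^sup>2"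
    using arg_cong [where f = cnj, OF conjunct1 [OF conjunct2 [OF W]]] re rc
    by (simp add: y1_def y2_def y3_def e_def)
  have 3: "e * d * z = - (\<i> * (r1 * r2) * (e\<^sup>2 * y2\<^sup>2 - y3\<^sup>2))"
    using arg_cong [where f = cnj, OF conjunct2 [OF conjunct2 [OF W]]] re
    by (simp add: y2_def y3_def z_def e_def)
  have "c\<^sup>2 * (r1 * E * y3 + r2 * y2) * (r2 * E * y3 + r1 * y2) = E * y1\<^sup>2"
  proof -
    have "E * y1\<^sup>2 = E\<^sup>2 * (e * y1\<^sup>2)" using Ee by algebra
    also have "\<dots> = c\<^sup>2 * (r1 * (E * e) * y2 + r2 * E * y3) * (r2 * (E * e) * y2 + r1 * E * y3)"
      unfolding 2 [symmetric] by algebra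
    also have "\<dots> = c\<^sup>2 * (r1 * E * y3 + r2 * y2) * (r2 * E * y3 + r1 * y2)"
      unfolding Ee by algebra
    finally show ?thesis ..
  qed
  moreover have "E * d * z = \<i> * (r1 * r2) * (E\<^sup>2 * y3\<^sup>2 - y2\<^sup>2)"
  proof -
    have "E * d * z = E\<^sup>2 * (e * d * z)" using Ee by algebra
    also have "\<dots> = - (\<i> * (r1 * r2) * ((E * e)\<^sup>2 * y2\<^sup>2 - E\<^sup>2 * y3\<^sup>2))"
      unfolding 3 by algebra
    also have "\<dots> = \<i> * (r1 * r2) * (E\<^sup>2 * y3\<^sup>2 - y2\<^sup>2)"
      unfolding Ee by (simp add: algebra_simps)
    finally show ?thesis .
  qed
  ultimately show ?thesis
    using 1 by (simp add: eqs_def pf_def qf_def conj_w_def y1_def y2_def y3_def z_def)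
qed

text \<open>The equations are preserved by conjugation, which gives one inclusion; since
  \<open>\<tau>\<close> is an involution, equality follows.\<close>

lemma K_real:
  assumes re: "cnj r1 = r1" "cnj r2 = r2" "cnj d = d" "cnj l = l" and E: "E * cnj E = 1"
    and \<tau>: "real_structure Z \<tau>" and lift: "\<And>x. x \<in> points Z \<Longrightarrow> \<mu> (\<tau> x) = \<sigma>0 (\<mu> x)"
  shows "\<tau> ` K E = K E"
proof -
  have pts: "\<tau> x \<in> points Z" if "x \<in> points Z" for x
    using \<tau> that by (auto simp: real_structure_def antiholomorphic_map_def continuous_map_def)
  have inv: "\<tau> (\<tau> x) = x" if "x \<in> points Z" for x
    using \<tau> that by (simp add: real_structure_def)
  have into: "\<tau> x \<in> K E" if x: "x \<in> K E" for x
  proof -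
    obtain w where w: "base w \<noteq> 0" "eqs E w" "\<mu> x = O2_pt w" and xZ: "x \<in> points Z"
      using x by (auto simp: K_def K0_def)
    have "base (conj_w w) \<noteq> 0" using w(1) by (auto simp: vec4_eq_iff conj_w_def)
    then have "O2_pt (conj_w w) \<in> K0 E" using eqs_conj [OF re E w(2)] by (auto simp: K0_def)
    then show ?thesis using pts [OF xZ] lift [OF xZ] w(3) by (simp add: K_def \<sigma>0_O2_pt)
  qed
  show ?thesis
  proof (intro subset_antisym subsetI)
    fix x assume x: "x \<in> K E"
    then have "x = \<tau> (\<tau> x)" using inv by (simp add: K_def)
    then show "x \<in> \<tau> ` K E" using into [OF x] by (rule image_eqI)
  qed (use into in blast)
qed

end

text \<open>Each of the three points is the common zero set of forms of weights 1 and 2. Closedness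
  makes the part off the singular points open in the double covering.\<close>

lemma closedin_singular_points: "closedin (opens O2_space) (Z0_sing l0)"
proof -
  have pt: "closedin (opens O2_space) {O2_pt w0}"
    if b: "base w0 \<noteq> 0" and fin: "finite H" and lin: "\<And>h. h \<in> H \<Longrightarrow> holo_on h UNIV \<and> (\<exists>k. \<forall>t w. h (scl t w) = t ^ k * h w)"
      and zero: "\<And>h. h \<in> H \<Longrightarrow> h w0 = 0"
      and only: "\<And>w. base w \<noteq> 0 \<Longrightarrow> \<forall>h\<in>H. h w = 0 \<Longrightarrow> \<exists>t. w = scl t w0" for w0 H
  proof -
    have "O2_pt ` {w. base w \<noteq> 0 \<and> (\<forall>h\<in>H. h w = 0)} = {O2_pt w0}"
    proof (intro subset_antisym subsetI)
      fix q assume "q \<in> O2_pt ` {w. base w \<noteq> 0 \<and> (\<forall>h\<in>H. h w = 0)}"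
      then obtain w where w: "base w \<noteq> 0" "\<forall>h\<in>H. h w = 0" "q = O2_pt w" by blast
      then obtain t where t: "w = scl t w0" using only by blast
      then have "t \<noteq> 0" using w(1) by auto
      then have "O2_pt w0 = O2_pt w" using t by (auto simp: O2_pt_eq_iff)
      then show "q \<in> {O2_pt w0}" using w(3) by simp
    next
      fix q assume "q \<in> {O2_pt w0}"
      then show "q \<in> O2_pt ` {w. base w \<noteq> 0 \<and> (\<forall>h\<in>H. h w = 0)}" using b zero by blast
    qed
    then show ?thesis using closedin_O2 [OF fin lin] by simp
  qed
  have co: "holo_on (\<lambda>w. w $ j) UNIV \<and> (\<exists>k. \<forall>t w. scl t w $ j = t ^ k * w $ j)" for j :: "4 option"
  proof (cases j)
    case None
    then show ?thesis by (intro conjI holo_on_component exI [of _ 2]) simp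
  next
    case (Some i)
    then show ?thesis by (intro conjI holo_on_component exI [of _ 1]) simp
  qed
  have co': "holo_on (\<lambda>w. w $ Some 0 - of_real l0 * w $ Some 1) UNIV \<and>
      (\<exists>k. \<forall>t w. scl t w $ Some 0 - of_real l0 * scl t w $ Some 1 = t ^ k * (w $ Some 0 - of_real l0 * w $ Some 1))"
    by (intro conjI holo_on_diff holo_on_mult holo_on_const holo_on_component exI [of _ 1]) (simp add: algebra_simps)
  have 1: "closedin (opens O2_space) {O2_pt (pack (vec4 0 0 0 1) 0)}"
  proof (rule pt [of _ "{\<lambda>w. w $ None, \<lambda>w. w $ Some 0, \<lambda>w. w $ Some 1, \<lambda>w. w $ Some 2}"])
    show "\<exists>t. w = scl t (pack (vec4 0 0 0 1) 0)"
      if "\<forall>h\<in>{\<lambda>w. w $ None, \<lambda>w. w $ Some 0, \<lambda>w. w $ Some 1, \<lambda>w. w $ Some 2}. h w = 0" for w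
      by (rule exI [of _ "w $ Some 3"]) (use that in \<open>simp add: vec5_eq_iff\<close>)
  qed (use co in \<open>auto simp: vec4_eq_iff\<close>)
  have 2: "closedin (opens O2_space) {O2_pt (pack (vec4 0 0 1 0) 0)}"
  proof (rule pt [of _ "{\<lambda>w. w $ None, \<lambda>w. w $ Some 0, \<lambda>w. w $ Some 1, \<lambda>w. w $ Some 3}"])
    show "\<exists>t. w = scl t (pack (vec4 0 0 1 0) 0)"
      if "\<forall>h\<in>{\<lambda>w. w $ None, \<lambda>w. w $ Some 0, \<lambda>w. w $ Some 1, \<lambda>w. w $ Some 3}. h w = 0" for w
      by (rule exI [of _ "w $ Some 2"]) (use that in \<open>simp add: vec5_eq_iff\<close>)
  qed (use co in \<open>auto simp: vec4_eq_iff\<close>)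
  have 3: "closedin (opens O2_space) {O2_pt (pack (vec4 (of_real l0) 1 0 0) 0)}"
  proof (rule pt [of _ "{\<lambda>w. w $ None, \<lambda>w. w $ Some 0 - of_real l0 * w $ Some 1, \<lambda>w. w $ Some 2, \<lambda>w. w $ Some 3}"])
    show "\<exists>t. w = scl t (pack (vec4 (of_real l0) 1 0 0) 0)"
      if "\<forall>h\<in>{\<lambda>w. w $ None, \<lambda>w. w $ Some 0 - of_real l0 * w $ Some 1, \<lambda>w. w $ Some 2, \<lambda>w. w $ Some 3}. h w = 0" for w
      by (rule exI [of _ "w $ Some 1"]) (use that in \<open>simp add: vec5_eq_iff mult.commute\<close>)
    show "holo_on h UNIV \<and> (\<exists>k. \<forall>t w. h (scl t w) = t ^ k * h w)"
      if "h \<in> {\<lambda>w. w $ None, \<lambda>w. w $ Some 0 - of_real l0 * w $ Some 1, \<lambda>w. w $ Some 2, \<lambda>w. w $ Some 3}" for h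
      using that co co' by blast
  qed (auto simp: vec4_eq_iff)
  have "Z0_sing l0 = {O2_pt (pack (vec4 0 0 0 1) 0)} \<union> ({O2_pt (pack (vec4 0 0 1 0) 0)} \<union> {O2_pt (pack (vec4 (of_real l0) 1 0 0) 0)})"
    by (auto simp: Z0_sing_def)
  then show ?thesis using 1 2 3 by (simp only: closedin_Un)
qed

text \<open>The inverse in the definition of a small resolution is a map between a subspace of the
  subspace \<open>P\<close> and a subspace of \<open>Z\<close>; composing it with the identity on
  one side and the inclusion on the other gives \<open>\<nu>\<close> the form used in
  \<open>small_res\<close>.\<close>

lemma small_res_inverse:
  assumes res: "small_resolution Z (induced O2_space P) \<Sigma> \<mu>"
    and P: "P \<subseteq> points O2_space" and \<Sigma>: "closedin (opens O2_space) \<Sigma>"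
  shows "small_res Z \<mu> (inv_into {x \<in> points Z. \<mu> x \<notin> \<Sigma>} \<mu>) P (P - \<Sigma>)"
proof -
  let ?R = "{x \<in> points Z. \<mu> x \<notin> \<Sigma>}" and ?Z0 = "induced O2_space P"
  have sheaf: "function_sheaf Z" and hol: "holomorphic_map Z ?Z0 \<mu>"
    and bih: "biholomorphic_map (induced Z ?R) (induced ?Z0 (points ?Z0 - \<Sigma>)) \<mu>"
    using res unfolding small_resolution_def complex_manifold_def by blast+
  have ptsZ0: "points ?Z0 = P" using P by auto
  have ptsR: "points (induced Z ?R) = ?R" by auto
  have ptsG: "points (induced ?Z0 (P - \<Sigma>)) = P - \<Sigma>" using P by auto
  note bih = bih [unfolded ptsZ0]
  have bij: "bij_betw \<mu> ?R (P - \<Sigma>)"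
    and inv: "holomorphic_map (induced ?Z0 (P - \<Sigma>)) (induced Z ?R) (inv_into ?R \<mu>)"
    using bih unfolding biholomorphic_map_def ptsR ptsG by blast+
  show ?thesis
  proof
    show "function_sheaf Z" by (rule sheaf)
    have "holomorphic_map ?Z0 O2_space (\<lambda>x. x)"
      by (rule holomorphic_map_inclusion) (simp add: O2_space_def)
    from holomorphic_map_compose [OF hol this] show "holomorphic_map Z O2_space \<mu>" by simp
    show "\<mu> x \<in> P" if "x \<in> points Z" for x
      using holomorphic_mapD(1)[OF hol that] ptsZ0 by simp
    have "holomorphic_map (induced O2_space (P - \<Sigma>)) (induced ?Z0 (P - \<Sigma>)) (\<lambda>x. x)"
    proof (rule holomorphic_map_induced_induced)
      show "f \<in> hol O2_space V" if "f \<in> hol O2_space U" "openin (opens O2_space) V" "V \<subseteq> U" for f U V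
        using that hol_quotient_restrict unfolding O2_space_def by blast
      show "hol_opens O2_space" by (simp add: O2_space_def)
    qed blast
    from holomorphic_map_compose [OF this inv]
    have "holomorphic_map (induced O2_space (P - \<Sigma>)) (induced Z ?R) (inv_into ?R \<mu>)" .
    from holomorphic_map_compose [OF this holomorphic_map_inclusion [OF hol_opens_function_sheaf [OF sheaf]]]
    show "holomorphic_map (induced O2_space (P - \<Sigma>)) Z (inv_into ?R \<mu>)" .
    show "\<mu> (inv_into ?R \<mu> y) = y" if "y \<in> P - \<Sigma>" for y
      using bij that by (meson bij_betw_inv_into_right)
    show "inv_into ?R \<mu> (\<mu> x) = x" if "x \<in> points Z" "\<mu> x \<in> P - \<Sigma>" for x
      using bij_betw_inv_into_left [OF bij, of x] that by simp
    show "P \<subseteq> points O2_space" by (rule P)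
    show "\<exists>T. openin (opens O2_space) T \<and> P - \<Sigma> = P \<inter> T"
      using \<Sigma> P by (intro exI [of _ "points O2_space - \<Sigma>"]) (auto simp: closedin_def)
  qed
qed

section \<open>Specialization to the real data: the two sheets as two instances of one
  family\<close>

theorem proposition4p2:
  fixes a b q0 q1 q2 l0 l \<theta> :: real
    and Z :: "'z cspace"
    and \<mu> :: "'z \<Rightarrow> (complex ^ (4 option)) set"
    and \<tau> :: "'z \<Rightarrow> 'z"
  assumes "a > 0" and "b > 0"
    and nonneg: "\<And>t::real. (Qform q0 q1 q2 t 1)\<^sup>2 - f_cubic a b t \<ge> 0"
    and equality: "\<And>t::real. (Qform q0 q1 q2 t 1)\<^sup>2 - f_cubic a b t = 0 \<longleftrightarrow> t = l0"
    and double_root: "order l0 (discr_poly a b q0 q1 q2) = 2"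
    and Q_pos: "\<And>t::real. f_cubic a b t \<ge> 0 \<Longrightarrow> t \<noteq> l0 \<Longrightarrow>
                  Qform q0 q1 q2 t 1 > sqrt (f_cubic a b t)"
    and resolution: "small_resolution Z (Z0_space a b q0 q1 q2) (Z0_sing l0) \<mu>"
    and real_str: "real_structure Z \<tau>"
    and lift: "\<And>x. x \<in> points Z \<Longrightarrow> \<mu> (\<tau> x) = \<sigma>0 (\<mu> x)"
    and "f_cubic a b l > 0" and "l \<noteq> l0"
  shows
    "let Q = Qform q0 q1 q2 l 1;
         f = f_cubic a b l;
         \<Phi> = \<Phi>0 \<circ> \<mu>;
         S = S_surface Z \<mu> l;
         C = touching_conic l Q f \<theta>;
         comps = irreducible_components Z {x \<in> points Z. \<Phi> x \<in> C}
     in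
       (card comps = 2 \<and>
        (\<forall>K\<in>comps. smooth_rational_curve Z K \<and>
           biholomorphic_map (induced Z K) (induced projective_space C) \<Phi>)) \<and>
       (\<forall>K\<in>comps. trivial_normal_bundle S K) \<and>
       (\<forall>K\<in>comps. \<forall>K'\<in>comps. K \<noteq> K' \<longrightarrow>
          divisor_of S K \<in> pencil_of S K \<and> divisor_of S K' \<in> pencil_of S K' \<and>
          pencil_of S K \<noteq> pencil_of S K') \<and>
       (\<forall>K\<in>comps. \<tau> ` K = K)"
proof -
  define Q where "Q = Qform q0 q1 q2 l (1 :: real)"
  define f where "f = f_cubic a b l"
  \<comment> \<open>\<open>Q + k\<close> and \<open>Q - k\<close> are the roots of X^2 - 2 Q X + f.
    Both are positive because Q > sqrt f > 0, so real square roots r1 and r2 can be taken.\<close>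
  define k where "k = sqrt (Q\<^sup>2 - f)"
  define \<rho>1 where "\<rho>1 = sqrt (Q + k)"
  define \<rho>2 where "\<rho>2 = sqrt (Q - k)"
  have f: "f > 0" using \<open>f_cubic a b l > 0\<close> by (simp add: f_def)
  have Qf: "Q > sqrt f" using Q_pos [of l] f \<open>l \<noteq> l0\<close> by (simp add: Q_def f_def)
  have sf: "sqrt f > 0" using f by simp
  have Q0: "Q > 0" using Qf sf by linarith
  have "(sqrt f)\<^sup>2 < Q\<^sup>2" using Qf sf by (intro power_strict_mono) auto
  then have fQ: "f < Q\<^sup>2" using f by simp
  then have k: "k > 0" "k\<^sup>2 = Q\<^sup>2 - f" by (simp_all add: k_def)
  have kQ: "k < Q" by (rule power_less_imp_less_base [of k 2 Q]) (use k f Q0 in auto)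
  have \<rho>: "\<rho>1 > 0" "\<rho>2 > 0" "\<rho>1\<^sup>2 = Q + k" "\<rho>2\<^sup>2 = Q - k"
    using k kQ Q0 by (simp_all add: \<rho>1_def \<rho>2_def)
  have \<rho>12: "\<rho>1 * \<rho>2 = sqrt f"
  proof -
    have "(\<rho>1 * \<rho>2)\<^sup>2 = (Q + k) * (Q - k)" by (simp only: power_mult_distrib \<rho>)
    also have "\<dots> = f" using k(2) by (simp add: algebra_simps power2_eq_square)
    finally have "(\<rho>1 * \<rho>2)\<^sup>2 = f" .
    then show ?thesis using \<rho> by (simp add: real_sqrt_unique)
  qed
  define r1 r2 d where "r1 = complex_of_real \<rho>1" and "r2 = complex_of_real \<rho>2" and "d = complex_of_real (2 * k)"
  \<comment> \<open>Chosen so that c^2 d^2 = -2; it is purely imaginary, whereas r1, r2 and d are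
    real.\<close>
  define c where "c = \<i> * complex_of_real (sqrt 2) / d"
  define L where "L = complex_of_real l"
  have r: "r1\<^sup>2 + r2\<^sup>2 = 2 * of_real Q" "r1\<^sup>2 * r2\<^sup>2 = of_real f" "r1\<^sup>2 - r2\<^sup>2 = d" "r1 * r2 = of_real (sqrt f)"
  proof -
    have "r1\<^sup>2 = of_real (\<rho>1\<^sup>2)" "r2\<^sup>2 = of_real (\<rho>2\<^sup>2)" by (simp_all add: r1_def r2_def)
    then have s: "r1\<^sup>2 = of_real (Q + k)" "r2\<^sup>2 = of_real (Q - k)" by (simp_all only: \<rho>)
    show "r1\<^sup>2 + r2\<^sup>2 = 2 * of_real Q" "r1\<^sup>2 - r2\<^sup>2 = d" by (simp_all add: s d_def)
    have "(Q + k) * (Q - k) = f" using k by (simp add: algebra_simps power2_eq_square)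
    then show "r1\<^sup>2 * r2\<^sup>2 = of_real f" unfolding s by (metis of_real_mult)
    show "r1 * r2 = of_real (sqrt f)" unfolding r1_def r2_def \<rho>12 [symmetric] by simp
  qed
  have nz: "r1 \<noteq> 0" "r2 \<noteq> 0" "d \<noteq> 0" using \<rho> k by (auto simp: r1_def r2_def d_def)
  have cd: "c\<^sup>2 * d\<^sup>2 = - 2"
  proof -
    have "c * d = \<i> * complex_of_real (sqrt 2)" using nz by (simp add: c_def)
    then have "(c * d)\<^sup>2 = \<i>\<^sup>2 * (complex_of_real (sqrt 2))\<^sup>2" by (simp only: power_mult_distrib)
    also have "\<dots> = - 2" by (simp flip: of_real_power)
    finally show ?thesis by (simp only: power_mult_distrib)
  qed
  have fam1: "conic_family r1 r2 c d"
    by (rule conic_family.intro [OF nz cd r(3) [symmetric]])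
  have cd': "c\<^sup>2 * (- d)\<^sup>2 = - 2" using cd by simp
  have fam2: "conic_family r2 r1 c (- d)"
    by (rule conic_family.intro [OF nz(2,1) _ cd']) (use nz r(3) in auto)
  define P where "P = {O2_pt w | w. base w \<noteq> 0 \<and> (w $ None)\<^sup>2 + quartic a b q0 q1 q2 (base w) = 0}"
  define G where "G = P - Z0_sing l0"
  define \<nu> where "\<nu> = inv_into {x \<in> points Z. \<mu> x \<notin> Z0_sing l0} \<mu>"
  have PO: "P \<subseteq> points O2_space"
    unfolding O2_space_def points_quotient [OF open_base_nonzero] by (auto simp: P_def)
  have sm: "small_res Z \<mu> \<nu> P G"
    unfolding \<nu>_def G_def
    by (rule small_res_inverse [OF _ PO closedin_singular_points])
       (use resolution in \<open>simp add: Z0_space_def P_def\<close>)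
  have inP: "O2_pt w \<in> P \<longleftrightarrow> (w $ None)\<^sup>2 + quartic a b q0 q1 q2 (base w) = 0" if "base w \<noteq> 0" for w
  proof
    assume "O2_pt w \<in> P"
    then obtain w' where w': "(w' $ None)\<^sup>2 + quartic a b q0 q1 q2 (base w') = 0" "O2_pt w' = O2_pt w"
      by (auto simp: P_def)
    then obtain t where t: "w = scl t w'" by (auto simp: O2_pt_eq_iff)
    have "(w $ None)\<^sup>2 + quartic a b q0 q1 q2 (base w) = t ^ 4 * ((w' $ None)\<^sup>2 + quartic a b q0 q1 q2 (base w'))"
      unfolding t quartic_def Qform_def base_nth scl_nth by algebra
    then show "(w $ None)\<^sup>2 + quartic a b q0 q1 q2 (base w) = 0" using w'(1) by simp
  qed (use that in \<open>auto simp: P_def\<close>)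
  have surf: "(w $ None)\<^sup>2 + quartic a b q0 q1 q2 (base w)
      = (w $ Some 2 * w $ Some 3 + of_real Q * (w $ Some 1)\<^sup>2)\<^sup>2 + (w $ None)\<^sup>2 - of_real f * w $ Some 1 ^ 4"
    if "w $ Some 0 = L * w $ Some 1" for w
  proof -
    have "Qform q0 q1 q2 (L * w $ Some 1) (w $ Some 1) = of_real Q * (w $ Some 1)\<^sup>2"
      by (simp add: Qform_def Q_def L_def algebra_simps power2_eq_square)
    moreover have "L * w $ Some 1 * w $ Some 1 * (L * w $ Some 1 + w $ Some 1) * (of_real a * (L * w $ Some 1) - of_real b * w $ Some 1)
        = of_real f * w $ Some 1 ^ 4"
      by (simp add: f_def f_cubic_def L_def algebra_simps power4_eq_xxxx)
    ultimately show ?thesis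
      unfolding quartic_def base_nth that by simp
  qed
  \<comment> \<open>Stated for arbitrary r1, r2 and d because it serves for both orders of the
    roots; the surface depends only on the symmetric functions of r1^2 and r2^2.\<close>
  have RP: "resolved_pencil r1 r2 c d L Z \<mu> \<nu> P G"
    if fam: "conic_family r1 r2 c d" and q: "r1\<^sup>2 + r2\<^sup>2 = 2 * of_real Q" "r1\<^sup>2 * r2\<^sup>2 = of_real f" for r1 r2 d
  proof -
    interpret conic_family r1 r2 c d L by (rule fam)
    have eqv: "O2_pt w \<in> P \<longleftrightarrow> uf w * vf w = r1\<^sup>2 * r2\<^sup>2 * w $ Some 1 ^ 4"
      if "base w \<noteq> 0" "w $ Some 0 = L * w $ Some 1" for w
      unfolding inP [OF that(1)] surf [OF that(2)] uf_vf q by simp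
    have psiG: "O2_pt (psi x) \<in> G" if x: "x \<in> params" for x
    proof -
      have cone: "psi x \<in> cone" by (rule psi_in_cone [OF x])
      then have "O2_pt (psi x) \<in> P" using eqv [of "psi x"] by (simp add: cone_def)
      moreover have "O2_pt (psi x) \<notin> Z0_sing l0"
      proof
        assume "O2_pt (psi x) \<in> Z0_sing l0"
        then have "\<exists>w\<in>{pack (vec4 0 0 0 1) 0, pack (vec4 0 0 1 0) 0, pack (vec4 (of_real l0) 1 0 0) 0}. O2_pt w = O2_pt (psi x)"
          unfolding Z0_sing_def by auto
        then obtain w t where w: "w \<in> {pack (vec4 0 0 0 1) 0, pack (vec4 0 0 1 0) 0, pack (vec4 (of_real l0) 1 0 0) 0}"
            "psi x = scl t w" by (auto simp: O2_pt_eq_iff)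
        \<comment> \<open>The first two alternatives are excluded by
          \<open>psi_avoids_vertices\<close>, the third, which is the point over
          \<open>P\<^sub>0\<close>, by \<open>psi_coordinate_nonzero\<close>.\<close>
        have "psi x $ Some 1 = 0 \<and> psi x $ Some 2 = 0 \<or> psi x $ Some 1 = 0 \<and> psi x $ Some 3 = 0 \<or>
            psi x $ Some 2 = 0 \<and> psi x $ Some 3 = 0"
          using w by auto
        then show False
          using psi_avoids_vertices [OF x] psi_coordinate_nonzero [OF x] by blast
      qed
      ultimately show ?thesis by (simp add: G_def)
    qed
    show ?thesis
      by (intro resolved_pencil.intro resolved_pencil_axioms.intro fam sm psiG) (simp add: eqv)
  qed
  interpret A: resolved_pencil r1 r2 c d L Z \<mu> \<nu> P G
    by (rule RP [OF fam1 r(1,2)])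
  \<comment> \<open>The second sheet: r1 and r2 are exchanged and d is replaced by -d, while
    \<open>c\<close> stays the same since only d^2 occurs in its condition.\<close>
  interpret B: resolved_pencil r2 r1 c "- d" L Z \<mu> \<nu> P G
    by (rule RP [OF fam2]) (use r in \<open>simp_all add: add.commute mult.commute\<close>)
  define E where "E = cis \<theta>"
  have E: "E \<noteq> 0" by (simp add: E_def)
  have Ec: "E * cnj E = 1" by (simp add: E_def cis_cnj cis_mult)
  have Ei: "E * cis (- \<theta>) = 1" by (simp add: E_def cis_mult)
  let ?C = "touching_conic l Q f \<theta>"
  have C: "?C = A.conic E"
  proof -
    have "2 * of_real (Q\<^sup>2 - f) * y1\<^sup>2 + of_real (sqrt f) * cis \<theta> * y2\<^sup>2 + 2 * of_real Q * y2 * y3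
        + of_real (sqrt f) * cis (- \<theta>) * y3\<^sup>2 = 0 \<longleftrightarrow>
        c\<^sup>2 * (r1 * E * y2 + r2 * y3) * (r2 * E * y2 + r1 * y3) = E * y1\<^sup>2" for y1 y2 y3 :: complex
    proof -
      define e where "e = cis (- \<theta>)"
      have Ee: "E * e = 1" using Ei by (simp add: e_def)
      define X where "X = 2 * of_real (Q\<^sup>2 - f) * y1\<^sup>2 + of_real (sqrt f) * E * y2\<^sup>2 + 2 * of_real Q * y2 * y3
        + of_real (sqrt f) * e * y3\<^sup>2"
      have d2: "d\<^sup>2 = 4 * of_real (Q\<^sup>2 - f)"
        unfolding d_def of_real_power [symmetric] k(2) [symmetric] by (simp add: power_mult_distrib)
      \<comment> \<open>After multiplication by 2 E the product E e becomes 1, the terms in y2 and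
        y3 factor as 2 p q, and 2 is rewritten as -c^2 d^2.\<close>
      have "2 * E * X = E * d\<^sup>2 * y1\<^sup>2 + 2 * (r1 * r2 * E\<^sup>2 * y2\<^sup>2 + (r1\<^sup>2 + r2\<^sup>2) * E * y2 * y3 + r1 * r2 * (E * e) * y3\<^sup>2)"
        unfolding d2 r(1,4) X_def by algebra
      also have "\<dots> = E * d\<^sup>2 * y1\<^sup>2 + 2 * ((r1 * E * y2 + r2 * y3) * (r2 * E * y2 + r1 * y3))"
        unfolding Ee by (simp add: algebra_simps power2_eq_square)
      also have "\<dots> = E * d\<^sup>2 * y1\<^sup>2 - (c\<^sup>2 * d\<^sup>2) * ((r1 * E * y2 + r2 * y3) * (r2 * E * y2 + r1 * y3))"
        unfolding cd by simp
      also have "\<dots> = d\<^sup>2 * (E * y1\<^sup>2 - c\<^sup>2 * (r1 * E * y2 + r2 * y3) * (r2 * E * y2 + r1 * y3))"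
        by algebra
      finally have key: "2 * E * X = d\<^sup>2 * (E * y1\<^sup>2 - c\<^sup>2 * (r1 * E * y2 + r2 * y3) * (r2 * E * y2 + r1 * y3))" .
      have "X = 0 \<longleftrightarrow> 2 * E * X = 0" using E by simp
      also have "\<dots> \<longleftrightarrow> c\<^sup>2 * (r1 * E * y2 + r2 * y3) * (r2 * E * y2 + r1 * y3) = E * y1\<^sup>2"
        unfolding key mult_eq_0_iff right_minus_eq power_eq_0_iff using nz(3) by metis
      finally show ?thesis by (simp only: X_def E_def e_def)
    qed
    then show ?thesis unfolding touching_conic_def A.conic_def by (simp only: L_def)
  qed
  have CB: "B.conic E = A.conic E"
    unfolding A.conic_def B.conic_def by (simp only: mult_ac)
  \<comment> \<open>The exchange of r1 and r2 turns \<open>B.pf\<close> into \<open>A.qf\<close> and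
    \<open>B.qf\<close> into \<open>A.pf\<close>; the equations of the two sheets differ only by the
    sign of z.\<close>
  have eqsB: "B.eqs E w \<longleftrightarrow> w $ Some 0 = L * w $ Some 1 \<and> c\<^sup>2 * A.qf E w * A.pf E w = E * (w $ Some 1)\<^sup>2 \<and>
     E * (- d) * w $ None = \<i> * (r2 * r1) * (E\<^sup>2 * (w $ Some 2)\<^sup>2 - (w $ Some 3)\<^sup>2)" for E w
    by (simp add: B.eqs_def B.pf_def B.qf_def A.pf_def A.qf_def)
  have eqsA: "A.eqs E w \<longleftrightarrow> w $ Some 0 = L * w $ Some 1 \<and> c\<^sup>2 * B.qf E w * B.pf E w = E * (w $ Some 1)\<^sup>2 \<and>
     E * (- (- d)) * w $ None = \<i> * (r1 * r2) * (E\<^sup>2 * (w $ Some 2)\<^sup>2 - (w $ Some 3)\<^sup>2)" for E w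
    by (simp add: A.eqs_def B.pf_def B.qf_def A.pf_def A.qf_def)
  have SAB: "A.S = S_surface Z \<mu> l" "B.S = S_surface Z \<mu> l"
    unfolding A.S_def B.S_def A.plane_def B.plane_def S_surface_def H_plane_def
    by (simp_all only: L_def)
  have PsiA: "A.Psi x \<in> B.K E \<longleftrightarrow> B.eqs E (A.psi x)" if "x \<in> A.params" for x E
    using that A.Psi_points A.mu_Psi B.in_K0_iff [OF A.base_psi] by (simp add: B.K_def)
  have PsiB: "B.Psi x \<in> A.K E \<longleftrightarrow> A.eqs E (B.psi x)" if "x \<in> B.params" for x E
    using that B.Psi_points B.mu_Psi A.in_K0_iff [OF B.base_psi] by (simp add: A.K_def)
  let ?K1 = "A.K E" and ?K2 = "B.K E"
  have preimage: "{x \<in> points Z. (\<Phi>0 \<circ> \<mu>) x \<in> ?C} = ?K1 \<union> ?K2"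
  proof (intro subset_antisym subsetI)
    fix x assume "x \<in> {x \<in> points Z. (\<Phi>0 \<circ> \<mu>) x \<in> ?C}"
    then have x: "x \<in> points Z" "\<Phi>0 (\<mu> x) \<in> A.conic E" using C by auto
    obtain w where w: "base w \<noteq> 0" "\<mu> x = O2_pt w" "O2_pt w \<in> P"
      using A.mu_P [OF x(1)] by (auto simp: P_def)
    have "proj_pt (base w) \<in> A.conic E" using x(2) w(2) by (simp add: \<Phi>0_O2_pt)
    then have c: "w $ Some 0 = L * w $ Some 1" "c\<^sup>2 * A.pf E w * A.qf E w = E * (w $ Some 1)\<^sup>2"
      using A.in_conic_iff [OF w(1)] by (simp_all add: A.pf_def A.qf_def)
    have c': "c\<^sup>2 * A.qf E w * A.pf E w = E * (w $ Some 1)\<^sup>2"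
      using c(2) by (simp add: mult_ac)
    have "A.eqs E w \<or> B.eqs E w"
      using A.two_sheets [OF E c A.cone_P [OF w(1) c(1) w(3)]]
    proof
      assume "E * d * w $ None = \<i> * (r1 * r2) * (E\<^sup>2 * (w $ Some 2)\<^sup>2 - (w $ Some 3)\<^sup>2)"
      then show ?thesis using c by (simp add: A.eqs_def)
    next
      assume z: "E * d * w $ None = - (\<i> * (r1 * r2) * (E\<^sup>2 * (w $ Some 2)\<^sup>2 - (w $ Some 3)\<^sup>2))"
      have "E * (- d) * w $ None = \<i> * (r2 * r1) * (E\<^sup>2 * (w $ Some 2)\<^sup>2 - (w $ Some 3)\<^sup>2)"
      proof -
        have "E * (- d) * w $ None = - (E * d * w $ None)" by simp
        also have "\<dots> = \<i> * (r2 * r1) * (E\<^sup>2 * (w $ Some 2)\<^sup>2 - (w $ Some 3)\<^sup>2)"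
          unfolding z by (simp add: mult.commute)
        finally show ?thesis .
      qed
      then show ?thesis using c(1) c' unfolding eqsB by blast
    qed
    then show "x \<in> ?K1 \<union> ?K2"
      using w x(1) A.in_K0_iff [OF w(1)] B.in_K0_iff [OF w(1)] by (auto simp: A.K_def B.K_def)
  next
    fix x assume "x \<in> ?K1 \<union> ?K2"
    then have xZ: "x \<in> points Z" and "(\<Phi>0 \<circ> \<mu>) x \<in> A.conic E \<union> B.conic E"
      using holomorphic_mapD(1)[OF conjunct1 [OF conjunct2 [OF A.biholomorphic_K_conic [OF E, unfolded biholomorphic_map_def]]], of x]
        holomorphic_mapD(1)[OF conjunct1 [OF conjunct2 [OF B.biholomorphic_K_conic [OF E, unfolded biholomorphic_map_def]]], of x]
        A.points_induced_K B.points_induced_K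
      by (auto simp: A.K_def B.K_def)
    then show "x \<in> {x \<in> points Z. (\<Phi>0 \<circ> \<mu>) x \<in> ?C}" using CB C by auto
  qed
  \<comment> \<open>The sheets carry opposite values of z, so they can meet only over the branch
    curve.\<close>
  have disjoint: "w $ None = 0" if "A.eqs E w" "B.eqs E w" for w
  proof -
    have "E * d * w $ None = E * (- d) * w $ None"
      using that unfolding A.eqs_def eqsB by (metis mult.commute)
    then have "2 * (E * d * w $ None) = 0" by simp
    then show ?thesis using E nz by simp
  qed
  \<comment> \<open>The parameter (1 : 0), at which z is a nonzero multiple of E; this point shows
    that neither sheet contains the other.\<close>
  define x0 :: "complex ^ 3" where "x0 = vector [E, 1, 0]"
  have x0: "x0 \<in> A.params" "x0 \<in> B.params" "x0 $ 1 = E" using E by (simp_all add: x0_def A.params_def B.params_def)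
  have zA: "A.psi x0 $ None \<noteq> 0" and zB: "B.psi x0 $ None \<noteq> 0"
    using E nz by (simp_all add: A.psi_def B.psi_def x0_def)
  have inA: "A.eqs E (A.psi x0)" and inB: "B.eqs E (B.psi x0)"
    using x0 A.eqs_psi [OF E] B.eqs_psi [OF E] by blast+
  have K12: "\<not> ?K1 \<subseteq> ?K2"
  proof
    assume "?K1 \<subseteq> ?K2"
    moreover have "A.Psi x0 \<in> ?K1" using x0 A.K_Psi [OF E] by blast
    ultimately show False using PsiA [OF x0(1)] disjoint [OF inA] zA by blast
  qed
  have K21: "\<not> ?K2 \<subseteq> ?K1"
  proof
    assume "?K2 \<subseteq> ?K1"
    moreover have "B.Psi x0 \<in> ?K2" using x0 B.K_Psi [OF E] by blast
    ultimately show False using PsiB [OF x0(2)] disjoint [OF _ inB] zB by blast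
  qed
  have comps: "irreducible_components Z (?K1 \<union> ?K2) = {?K1, ?K2}"
    by (rule irreducible_components_pair [OF A.irreducible_K [OF E] B.irreducible_K [OF E] K12 K21])
       (use A.analytic_inter_K [OF E] B.analytic_inter_K [OF E] in blast)
  have ne: "?K1 \<noteq> ?K2" using K12 by blast
  \<comment> \<open>Positivity of Q enters through r1^2 + r2^2 = 2 Q: it makes the opposite sheet a
    proper section of the member at -E.\<close>
  have Qnz: "r1\<^sup>2 + r2\<^sup>2 \<noteq> 0" "r2\<^sup>2 + r1\<^sup>2 \<noteq> 0" using r(1) Q0 by (simp_all add: add.commute)
  have nlA: "\<not> linearly_equivalent (S_surface Z \<mu> l) (divisor_of (S_surface Z \<mu> l) ?K1) (divisor_of (S_surface Z \<mu> l) ?K2)"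
    unfolding SAB(1) [symmetric]
    by (rule A.meets_opposite [OF Qnz(1) E]) (use B.closed_K_S [OF E] PsiA in \<open>simp_all add: SAB eqsB\<close>)
  have nlB: "\<not> linearly_equivalent (S_surface Z \<mu> l) (divisor_of (S_surface Z \<mu> l) ?K2) (divisor_of (S_surface Z \<mu> l) ?K1)"
    unfolding SAB(2) [symmetric]
    by (rule B.meets_opposite [OF Qnz(2) E]) (use A.closed_K_S [OF E] PsiB in \<open>simp_all add: SAB eqsA\<close>)
  have dp: "divisor_of (S_surface Z \<mu> l) ?K1 \<in> pencil_of (S_surface Z \<mu> l) ?K1"
    "divisor_of (S_surface Z \<mu> l) ?K2 \<in> pencil_of (S_surface Z \<mu> l) ?K2"
    using A.divisor_in_pencil [OF E] B.divisor_in_pencil [OF E] by (simp_all only: SAB)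
  \<comment> \<open>The divisor of the second sheet lies in its own pencil, but it is not linearly
    equivalent to that of the first sheet.\<close>
  have pne: "pencil_of (S_surface Z \<mu> l) ?K1 \<noteq> pencil_of (S_surface Z \<mu> l) ?K2"
    using dp(2) nlA by (auto simp: pencil_of_def complete_linear_system_def)
  have re: "cnj r1 = r1" "cnj r2 = r2" "cnj d = d" "cnj L = L" "cnj (- d) = - d"
    by (simp_all add: r1_def r2_def d_def L_def)
  have real: "\<tau> ` ?K1 = ?K1" "\<tau> ` ?K2 = ?K2"
    using A.K_real [OF re(1-4) Ec real_str lift] B.K_real [OF re(2,1,5,4) Ec real_str lift] by simp_all
  have bih: "biholomorphic_map (induced Z ?K1) (induced projective_space ?C) (\<Phi>0 \<circ> \<mu>)"
    "biholomorphic_map (induced Z ?K2) (induced projective_space ?C) (\<Phi>0 \<circ> \<mu>)"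
    using A.biholomorphic_K_conic [OF E] B.biholomorphic_K_conic [OF E] by (simp_all only: C CB)
  have tn: "trivial_normal_bundle (S_surface Z \<mu> l) ?K1" "trivial_normal_bundle (S_surface Z \<mu> l) ?K2"
    using A.trivial_normal_bundle_K [OF E] B.trivial_normal_bundle_K [OF E] by (simp_all only: SAB)
  show ?thesis
    unfolding Let_def Q_def [symmetric] f_def [symmetric] preimage comps
    using ne A.smooth_rational_K [OF E] B.smooth_rational_K [OF E] bih tn dp pne real by auto
qed

end
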